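(* Let $\mathcal{Q}$ be an infinite class of graphs. Suppose that $\max_{\Gamma\in\widehat{\mathcal{Q}}}\operatorname{Ent}(\Gamma)$ is attained by a unique graph limit $\Gamma_{\mathcal{Q}}$. Suppose further that $$\lim_{n\to\infty}\frac{\log_2|\mathcal{Q}_n|}{\binom n2}=\operatorname{Ent}(\Gamma_{\mathcal{Q}}).$$ Then: (i) If $G_n\in\mathcal{U}_n$ is a uniformly random element of $\mathcal{Q}_n$ (a uniformly random unlabelled element), then $G_n$ converges to $\Gamma_{\mathcal{Q}}$ in probability as $n\to\infty$. (ii) The same holds if $G_n\in\mathcal{L}_n$ is a uniformly random element of $\mathcal{Q}^L_n$ (a uniformly random labelled element).
   Context: All graphs are finite and simple; $|G|$ is the number of vertices of $G$. $\mathcal{U}$ is the set of unlabelled graphs (isomorphism classes), $\mathcal{U}_n$ is the set of those with exactly $n\ge 1$ vertices, and $\mathcal{L}_n$ is the set of graphs with vertex set $[n]=\{1,\dots,n\}$. A graph class is a subset $\mathcal{Q}\subseteq\mathcal{U}$; $\mathcal{Q}_n:=\mathcal{Q}\cap\mathcal{U}_n$, and $\mathcal{Q}^L_n$ is the set of graphs in $\mathcal{L}_n$ whose isomorphism class belongs to $\mathcal{Q}$. Random elements $G_n$ are considered for those $n$ with $\mathcal{Q}_n\ne\emptyset$ (under the hypotheses this is all sufficiently large $n$). For graphs $H,G$ with $|H|\le|G|$, $p(H;G)$ is the probability that a uniformly random injective map $\phi:V(H)\to V(G)$ satisfies $uv\in E(H)\iff\phi(u)\phi(v)\in E(G)$ for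 all $u\ne v$. A graphon is a symmetric measurable function $W:[0,1]^2\to[0,1]$ (functions equal a.e. are identified). For a graphon $W$ and a graph $H$, $$p(H;W):=\mathbb{E}\Big[\prod_{uv\in E(H)}W(X_u,X_v)\prod_{uv\in E(H)^c}(1-W(X_u,X_v))\Big],$$ where $(X_u)_{u\in V(H)}$ are i.i.d. uniform on $[0,1]$ and $E(H)^c=\{uv:u\ne v,\ uv\notin E(H)\}$. Two graphons $W,W'$ are equivalent if $p(H;W)=p(H;W')$ for all graphs $H$; a graph limit $\Gamma$ is an equivalence class of graphons, and $p(H;\Gamma):=p(H;W)$ for any representing $W$. A sequence of graphs $G_i$ converges to $\Gamma$ if $|G_i|\to\infty$ and $p(H;G_i)\to p(H;\Gamma)$ for every graph $H$. $\widehat{\mathcal{Q}}$ is the set of graph limits that are limits of sequences of graphs in $\mathcal{Q}$. A sequence of random graphs $G_n$ with $|G_n|=n$ converges to a graph limit $\Gamma$ in probability if $p(H;G_n)\to p(H;\Gamma)$ in probability for every graph $H$; equivalently, $\Pr[\delta_\square(G_n,\Gamma)<\delta]\to1$ for every $\delta>0$, where $\delta_\square$ is the cut distance. With $h(x)=-x\log_2x-(1-x)\log_2(1-x)$ on $[0,1]$ ($h(0)=h(1)=0$), the entropy of a graphon is $\operatorname{Ent}(W):=\int_0^1\int_0^1h(W(x,y))\,dx\,dy$. It depends only on the graph limit represented by $W$, so $\operatorname{Ent}(\Gamma)$ is defined as $\operatorname{Ent}(W)$ for any representing $W$. *)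

theory Defs
  imports "HOL-Probability.Probability"
begin

section \<open>Graphs and graph classes\<close>

text \<open>Isomorphism classes are taken among graphs whose vertices are natural numbers.\<close>

datatype sgraph = SGraph (verts: "nat set") (edges: "nat set set")

definition simple_graph :: "sgraph \<Rightarrow> bool" where
  "simple_graph G \<longleftrightarrow> finite (verts G) \<and> verts G \<noteq> {} \<and>
     edges G \<subseteq> {e. e \<subseteq> verts G \<and> card e = 2}"

definition graph_iso :: "sgraph \<Rightarrow> sgraph \<Rightarrow> bool" where
  "graph_iso G H \<longleftrightarrow> (\<exists>f. bij_betw f (verts G) (verts H) \<and>
     (\<forall>u\<in>verts G. \<forall>v\<in>verts G. {u, v} \<in> edges G \<longleftrightarrow> {f u, f v} \<in> edges H))"

definition iso_rel :: "(sgraph \<times> sgraph) set" where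
  "iso_rel = {(G, H). simple_graph G \<and> simple_graph H \<and> graph_iso G H}"

definition unlabelled_graphs :: "sgraph set set" where
  "unlabelled_graphs = Collect simple_graph // iso_rel"

abbreviation iso_class :: "sgraph \<Rightarrow> sgraph set" where
  "iso_class G \<equiv> iso_rel `` {G}"

definition unlabelled_graphs_n :: "nat \<Rightarrow> sgraph set set" where
  "unlabelled_graphs_n n = {C \<in> unlabelled_graphs. \<forall>G\<in>C. card (verts G) = n}"

definition labelled_graphs :: "nat \<Rightarrow> sgraph set" where
  "labelled_graphs n = {G. simple_graph G \<and> verts G = {1..n}}"

definition class_n :: "sgraph set set \<Rightarrow> nat \<Rightarrow> sgraph set set" where
  "class_n Q n = Q \<inter> unlabelled_graphs_n n"

definition class_labelled_n :: "sgraph set set \<Rightarrow> nat \<Rightarrow> sgraph set" where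
  "class_labelled_n Q n = {G \<in> labelled_graphs n. iso_class G \<in> Q}"

text \<open>An arbitrary member of an isomorphism class, used to evaluate isomorphism-invariant
  quantities on unlabelled graphs (see \<open>graph_density_iso\<close>).\<close>

definition graph_rep :: "sgraph set \<Rightarrow> sgraph" where
  "graph_rep C = (SOME G. G \<in> C)"

text \<open>The random map is extensional, so that there are finitely many. The value is
  unspecified if \<open>H\<close> has more vertices than \<open>G\<close>.\<close>

definition injections :: "sgraph \<Rightarrow> sgraph \<Rightarrow> (nat \<Rightarrow> nat) set" where
  "injections H G = {\<phi> \<in> verts H \<rightarrow>\<^sub>E verts G. inj_on \<phi> (verts H)}"

definition graph_density :: "sgraph \<Rightarrow> sgraph \<Rightarrow> real" where
  "graph_density H G = measure_pmf.prob (pmf_of_set (injections H G))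
     {\<phi>. \<forall>u\<in>verts H. \<forall>v\<in>verts H. u \<noteq> v \<longrightarrow>
          ({u, v} \<in> edges H \<longleftrightarrow> {\<phi> u, \<phi> v} \<in> edges G)}"

section \<open>Graphons and graph limits\<close>

text \<open>Only the values of a graphon on the unit square matter. Up to a.e. equality, Borel and
  Lebesgue measurability give the same objects.\<close>

abbreviation unit_leb :: "real measure" where
  "unit_leb \<equiv> restrict_space lborel {0..1}"

definition graphon :: "(real \<Rightarrow> real \<Rightarrow> real) \<Rightarrow> bool" where
  "graphon W \<longleftrightarrow> case_prod W \<in> borel_measurable (unit_leb \<Otimes>\<^sub>M unit_leb) \<and>
     (\<forall>x\<in>{0..1}. \<forall>y\<in>{0..1}. W x y \<in> {0..1} \<and> W x y = W y x)"

text \<open>Each unordered pair of vertices occurs once, in increasing order; the order is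
  irrelevant because \<open>W\<close> is symmetric.\<close>

definition graphon_density :: "sgraph \<Rightarrow> (real \<Rightarrow> real \<Rightarrow> real) \<Rightarrow> real" where
  "graphon_density H W = (LINT x | (\<Pi>\<^sub>M u\<in>verts H. unit_leb).
     (\<Prod>(u, v)\<in>{(u, v) \<in> verts H \<times> verts H. u < v \<and> {u, v} \<in> edges H}. W (x u) (x v)) *
     (\<Prod>(u, v)\<in>{(u, v) \<in> verts H \<times> verts H. u < v \<and> {u, v} \<notin> edges H}. 1 - W (x u) (x v)))"

definition graphon_rel :: "((real \<Rightarrow> real \<Rightarrow> real) \<times> (real \<Rightarrow> real \<Rightarrow> real)) set" where
  "graphon_rel = {(W, W'). graphon W \<and> graphon W' \<and>
     (\<forall>H. simple_graph H \<longrightarrow> graphon_density H W = graphon_density H W')}"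

type_synonym graph_limit = "(real \<Rightarrow> real \<Rightarrow> real) set"

definition graph_limits :: "graph_limit set" where
  "graph_limits = Collect graphon // graphon_rel"

definition limit_density :: "sgraph \<Rightarrow> graph_limit \<Rightarrow> real" where
  "limit_density H \<Gamma> = graphon_density H (SOME W. W \<in> \<Gamma>)"

definition graphs_converge :: "(nat \<Rightarrow> sgraph) \<Rightarrow> graph_limit \<Rightarrow> bool" where
  "graphs_converge G \<Gamma> \<longleftrightarrow>
     filterlim (\<lambda>i. card (verts (G i))) at_top sequentially \<and>
     (\<forall>H. simple_graph H \<longrightarrow> (\<lambda>i. graph_density H (G i)) \<longlonglongrightarrow> limit_density H \<Gamma>)"

definition class_limits :: "sgraph set set \<Rightarrow> graph_limit set" where
  "class_limits Q = {\<Gamma> \<in> graph_limits.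
     \<exists>G. (\<forall>i. simple_graph (G i) \<and> iso_class (G i) \<in> Q) \<and> graphs_converge G \<Gamma>}"

text \<open>Convergence in probability to a constant depends only on the individual laws, so a
  sequence of random graphs is given by the sequence of its distributions.\<close>

definition converges_in_prob :: "(nat \<Rightarrow> sgraph pmf) \<Rightarrow> graph_limit \<Rightarrow> bool" where
  "converges_in_prob \<mu> \<Gamma> \<longleftrightarrow> (\<forall>H. simple_graph H \<longrightarrow> (\<forall>\<epsilon>>0.
     (\<lambda>n. measure_pmf.prob (\<mu> n) {G. \<bar>graph_density H G - limit_density H \<Gamma>\<bar> > \<epsilon>})
       \<longlonglongrightarrow> 0))"

section \<open>Entropy\<close>

text \<open>As \<open>0 * log 2 0 = 0\<close>, this gives the convention that the entropy vanishes at \<open>0\<close> and \<open>1\<close>.\<close>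

definition binary_entropy :: "real \<Rightarrow> real" where
  "binary_entropy x = - x * log 2 x - (1 - x) * log 2 (1 - x)"

definition graphon_entropy :: "(real \<Rightarrow> real \<Rightarrow> real) \<Rightarrow> real" where
  "graphon_entropy W = (LINT y|unit_leb. LINT x|unit_leb. binary_entropy (W x y))"

definition limit_entropy :: "graph_limit \<Rightarrow> real" where
  "limit_entropy \<Gamma> = graphon_entropy (SOME W. W \<in> \<Gamma>)"

text \<open>Binary logarithm of a cardinality, with \<open>log 0 = -\<infinity>\<close> rather than HOL's \<open>log 2 0 = 0\<close>.
  Hence a finite limit of the normalised logarithms forces the sets to be eventually nonempty.\<close>

definition log2_card :: "'a set \<Rightarrow> ereal" where
  "log2_card A = (if A = {} then -\<infinity> else ereal (log 2 (real (card A))))"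

section \<open>Well-definedness\<close>

lemma graph_iso_refl: "graph_iso G G"
  unfolding graph_iso_def by (rule exI[of _ id]) auto

lemma graph_iso_sym:
  assumes "graph_iso G H"
  shows "graph_iso H G"
proof -
  obtain f where f: "bij_betw f (verts G) (verts H)"
    and e: "\<And>u v. u \<in> verts G \<Longrightarrow> v \<in> verts G \<Longrightarrow> {u, v} \<in> edges G \<longleftrightarrow> {f u, f v} \<in> edges H"
    using assms unfolding graph_iso_def by blast
  let ?g = "inv_into (verts G) f"
  have g: "bij_betw ?g (verts H) (verts G)" using f by (rule bij_betw_inv_into)
  have "{u, v} \<in> edges H \<longleftrightarrow> {?g u, ?g v} \<in> edges G" if "u \<in> verts H" "v \<in> verts H" for u v
    using e[of "?g u" "?g v"] that bij_betwE[OF g] bij_betw_inv_into_right[OF f] by simp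
  with g show ?thesis unfolding graph_iso_def by blast
qed

lemma graph_iso_trans:
  assumes "graph_iso G H" "graph_iso H K"
  shows "graph_iso G K"
proof -
  obtain f where f: "bij_betw f (verts G) (verts H)"
    and e: "\<And>u v. u \<in> verts G \<Longrightarrow> v \<in> verts G \<Longrightarrow> {u, v} \<in> edges G \<longleftrightarrow> {f u, f v} \<in> edges H"
    using assms(1) unfolding graph_iso_def by blast
  obtain g where g: "bij_betw g (verts H) (verts K)"
    and e': "\<And>u v. u \<in> verts H \<Longrightarrow> v \<in> verts H \<Longrightarrow> {u, v} \<in> edges H \<longleftrightarrow> {g u, g v} \<in> edges K"
    using assms(2) unfolding graph_iso_def by blast
  show ?thesis unfolding graph_iso_def
    by (rule exI[of _ "g \<circ> f"])
       (use bij_betw_trans[OF f g] e e' bij_betwE[OF f] in auto)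
qed

lemma equiv_iso_rel: "equiv (Collect simple_graph) iso_rel"
  by (rule equivI)
     (auto simp: iso_rel_def refl_on_def intro!: symI transI
           intro: graph_iso_refl graph_iso_sym graph_iso_trans)

lemma equiv_graphon_rel: "equiv (Collect graphon) graphon_rel"
  by (rule equivI) (auto simp: graphon_rel_def refl_on_def intro!: symI transI)

lemma finite_labelled_graphs: "finite (labelled_graphs n)"
proof (rule finite_subset)
  show "labelled_graphs n \<subseteq> (\<lambda>E. SGraph {1..n} E) ` Pow (Pow {1..n})"
  proof
    fix G assume "G \<in> labelled_graphs n"
    then show "G \<in> (\<lambda>E. SGraph {1..n} E) ` Pow (Pow {1..n})"
      by (cases G) (auto simp: labelled_graphs_def simple_graph_def)
  qed
qed simp

lemma finite_unlabelled_graphs_n: "finite (unlabelled_graphs_n n)"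
proof (rule finite_subset)
  show "unlabelled_graphs_n n \<subseteq> iso_class ` labelled_graphs n"
  proof
    fix C assume C: "C \<in> unlabelled_graphs_n n"
    then obtain G where G: "simple_graph G" "C = iso_class G"
      by (auto simp: unlabelled_graphs_n_def unlabelled_graphs_def elim: quotientE)
    then have "G \<in> C" by (simp add: iso_rel_def graph_iso_refl)
    with C have n: "card (verts G) = n" by (auto simp: unlabelled_graphs_n_def)
    have "finite (verts G)" using G by (simp add: simple_graph_def)
    with n obtain f where f: "bij_betw f (verts G) {1..n}"
      using finite_same_card_bij[of "verts G" "{1..n}"] by auto
    let ?H = "SGraph {1..n} ((`) f ` edges G)"
    have inj: "inj_on f (verts G)" using f by (rule bij_betw_imp_inj_on)
    have im: "f ` verts G = {1..n}" using f by (rule bij_betw_imp_surj_on)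
    have E: "e \<subseteq> verts G" "card e = 2" if "e \<in> edges G" for e
      using G that by (auto simp: simple_graph_def)
    have H: "simple_graph ?H"
      unfolding simple_graph_def
    proof (intro conjI)
      show "verts ?H \<noteq> {}" using im G by (auto simp: simple_graph_def)
      show "edges ?H \<subseteq> {e. e \<subseteq> verts ?H \<and> card e = 2}"
      proof
        fix e' assume "e' \<in> edges ?H"
        then obtain e where e: "e \<in> edges G" "e' = f ` e" by auto
        then show "e' \<in> {e. e \<subseteq> verts ?H \<and> card e = 2}"
          using E[OF e(1)] im inj by (auto simp: card_image inj_on_subset)
      qed
    qed simp
    have "graph_iso G ?H" unfolding graph_iso_def
    proof (intro exI[of _ f] conjI ballI)
      fix u v assume uv: "u \<in> verts G" "v \<in> verts G"
      have "{f u, f v} \<in> (`) f ` edges G \<Longrightarrow> {u, v} \<in> edges G"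
      proof -
        assume "{f u, f v} \<in> (`) f ` edges G"
        then obtain e where e: "e \<in> edges G" "f ` {u, v} = f ` e" by auto
        with E inj uv have "{u, v} = e"
          by (metis inj_on_image_eq_iff empty_subsetI insert_subset)
        with e show ?thesis by simp
      qed
      then show "{u, v} \<in> edges G \<longleftrightarrow> {f u, f v} \<in> edges ?H"
        by (auto intro!: image_eqI[of _ _ "{u, v}"])
    qed (use f in simp)
    with G H have "(G, ?H) \<in> iso_rel" by (simp add: iso_rel_def)
    with G have "C = iso_class ?H" using equiv_class_eq[OF equiv_iso_rel] by metis
    moreover have "?H \<in> labelled_graphs n" using H by (simp add: labelled_graphs_def)
    ultimately show "C \<in> iso_class ` labelled_graphs n" by blast
  qed
qed (simp add: finite_labelled_graphs)

lemma graph_density_iso: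
  assumes "simple_graph H" "simple_graph G" "simple_graph G'" "graph_iso G G'"
    and le: "card (verts H) \<le> card (verts G)"
  shows "graph_density H G = graph_density H G'"
proof -
  obtain f where f: "bij_betw f (verts G) (verts G')"
    and e: "\<And>u v. u \<in> verts G \<Longrightarrow> v \<in> verts G \<Longrightarrow> {u, v} \<in> edges G \<longleftrightarrow> {f u, f v} \<in> edges G'"
    using assms(4) unfolding graph_iso_def by blast
  let ?g = "inv_into (verts G) f"
  have g: "bij_betw ?g (verts G') (verts G)" using f by (rule bij_betw_inv_into)
  have fin: "finite (verts H)" "finite (verts G)" using assms by (auto simp: simple_graph_def)
  define T where "T \<phi> = restrict (f \<circ> \<phi>) (verts H)" for \<phi> :: "nat \<Rightarrow> nat"
  have T: "bij_betw T (injections H G) (injections H G')"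
  proof (rule bij_betwI[where g = "\<lambda>\<phi>. restrict (?g \<circ> \<phi>) (verts H)"])
    show "T \<in> injections H G \<rightarrow> injections H G'"
      using bij_betwE[OF f] bij_betw_imp_inj_on[OF f]
      by (auto simp: T_def injections_def inj_on_def PiE_iff)
    show "(\<lambda>\<phi>. restrict (?g \<circ> \<phi>) (verts H)) \<in> injections H G' \<rightarrow> injections H G"
      using bij_betwE[OF g] bij_betw_imp_inj_on[OF g]
      by (auto simp: injections_def inj_on_def PiE_iff)
  next
    fix \<phi> assume "\<phi> \<in> injections H G"
    then show "restrict (?g \<circ> T \<phi>) (verts H) = \<phi>"
      using bij_betw_inv_into_left[OF f]
      by (auto simp: T_def injections_def PiE_iff extensional_def fun_eq_iff restrict_def)
  next
    fix \<phi> assume "\<phi> \<in> injections H G'"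
    then show "T (restrict (?g \<circ> \<phi>) (verts H)) = \<phi>"
      using bij_betw_inv_into_right[OF f]
      by (auto simp: T_def injections_def PiE_iff extensional_def fun_eq_iff restrict_def)
  qed
  have ne: "injections H G \<noteq> {}"
  proof -
    obtain h where h: "h ` verts H \<subseteq> verts G" "inj_on h (verts H)"
      using card_le_inj[OF fin(1) fin(2) le] by blast
    then have "restrict h (verts H) \<in> injections H G"
      by (auto simp: injections_def inj_on_def)
    then show ?thesis by blast
  qed
  have fi: "finite (injections H G)"
    unfolding injections_def using fin by (auto intro!: finite_subset[OF _ finite_PiE[of "verts H" "\<lambda>_. verts G"]])
  have "pmf_of_set (injections H G') = map_pmf T (pmf_of_set (injections H G))"
    using map_pmf_of_set_inj[of T "injections H G"] T ne fi by (simp add: bij_betw_def)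
  then have "graph_density H G' = measure_pmf.prob (pmf_of_set (injections H G))
     (T -` {\<phi>. \<forall>u\<in>verts H. \<forall>v\<in>verts H. u \<noteq> v \<longrightarrow>
          ({u, v} \<in> edges H \<longleftrightarrow> {\<phi> u, \<phi> v} \<in> edges G')})"
    by (simp add: graph_density_def)
  also have "\<dots> = graph_density H G"
    unfolding graph_density_def
  proof (rule measure_pmf.finite_measure_eq_AE; (simp add: AE_measure_pmf_iff set_pmf_of_set[OF ne fi])?)
    show "\<forall>\<phi>\<in>injections H G.
       (\<forall>u\<in>verts H. \<forall>v\<in>verts H. u \<noteq> v \<longrightarrow> ({u, v} \<in> edges H) = ({T \<phi> u, T \<phi> v} \<in> edges G')) =
       (\<forall>u\<in>verts H. \<forall>v\<in>verts H. u \<noteq> v \<longrightarrow> ({u, v} \<in> edges H) = ({\<phi> u, \<phi> v} \<in> edges G))"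
    proof
      fix \<phi> assume "\<phi> \<in> injections H G"
      then have "\<phi> u \<in> verts G" if "u \<in> verts H" for u
        using that by (auto simp: injections_def)
      then show "(\<forall>u\<in>verts H. \<forall>v\<in>verts H. u \<noteq> v \<longrightarrow> ({u, v} \<in> edges H) = ({T \<phi> u, T \<phi> v} \<in> edges G')) =
       (\<forall>u\<in>verts H. \<forall>v\<in>verts H. u \<noteq> v \<longrightarrow> ({u, v} \<in> edges H) = ({\<phi> u, \<phi> v} \<in> edges G))"
        using e by (auto simp: T_def)
    qed
  qed
  finally show ?thesis by simp
qed

end

theory Submission
  imports Defs "HOL-Library.Diagonal_Subsequence"
begin

text \<open>
  Each graph on \<open>[n]\<close> carries a greedy chain of vertex partitions, every step of which refines by
  a pair of sets witnessing the cut norm; the energy increments along the chain sum to at most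
  \<open>1\<close>, so the cut norms tend to \<open>0\<close>. For a fixed level of the chain, there are only \<open>2^o(n^2)\<close>
  partitions and edge-count matrices, and the graphs sharing both number at most
  \<open>2^(n^2/2 * entropy)\<close> for the entropy of the block densities. Hence a family of \<open>2^(c n^2/2)\<close>
  graphs contains graphs all of whose levels have block entropy at least \<open>c - o(1)\<close>. Along a
  diagonal subsequence the block data converge, the limiting step graphons are Cauchy in \<open>L\<^sup>2\<close>, and
  their limit is a graphon \<open>W\<close> to which the graphs converge.

  To see \<open>Ent \<ge> c\<close> for every graphon equivalent to \<open>W\<close>, one passes through the Shannon entropy of
  the sampled random graph on \<open>k\<close> vertices, which depends on the densities only: it is at least
  \<open>(k choose 2) c\<close> by Gibbs' inequality, and at most \<open>(k choose 2) (Ent + e) + O(k)\<close> by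
  comparison with a mixture of step models.

  If convergence in probability failed, then infinitely often a positive proportion of the class
  would have some density bounded away from that of \<open>\<Gamma>\<^sub>Q\<close>. These graphs would have a limit of entropy
  at least \<open>Ent(\<Gamma>\<^sub>Q)\<close> other than \<open>\<Gamma>\<^sub>Q\<close>, contradicting uniqueness of the maximiser.
\<close>

section \<open>Bernoulli weights and Gibbs' inequality\<close>

text \<open>The chain has to be nested. Only then are the block averages successive projections of
  one function, so that energy differences are squared L2 distances and the limiting step graphons
  form a Cauchy sequence; partitions obtained separately for each accuracy would have no common
  limit. At a fixed level the cut norm of a single graph need not be small: it becomes small only
  after the limit along the graphs has been followed by the limit along the levels. The partition
  depends on the graph, so the count pays a factor 4^(m n) for fixing it, which is 2^o(n^2) because
  \<open>n\<close> is chosen after the level \<open>m\<close>.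

  Both parts of the theorem follow from one estimate: for large n there are fewer than eta |Q_n| bad
  labelled graphs, with the unlabelled count on the right. Every bad isomorphism class contains a
  bad labelled graph, which gives (i), and |Q_n| <= |Q^L_n| gives (ii), without any estimate of the
  number of labellings of a graph.\<close>

definition bern :: "'p set \<Rightarrow> 'p set \<Rightarrow> ('p \<Rightarrow> real) \<Rightarrow> real" where
  "bern P E a = (\<Prod>p\<in>E. a p) * (\<Prod>p\<in>P - E. 1 - a p)"

lemma bern_nonneg:
  assumes "\<And>p. p \<in> P \<Longrightarrow> a p \<in> {0..1}" "E \<subseteq> P"
  shows "0 \<le> bern P E a"
  using assms unfolding bern_def by (intro mult_nonneg_nonneg prod_nonneg) auto

lemma bern_le_1:
  assumes "\<And>p. p \<in> P \<Longrightarrow> a p \<in> {0..1}" "E \<subseteq> P"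
  shows "bern P E a \<le> 1"
  using assms unfolding bern_def by (intro mult_le_one prod_le_1 prod_nonneg) auto

lemma bern_cong:
  assumes "\<And>p. p \<in> P \<Longrightarrow> a p = b p" "E \<subseteq> P"
  shows "bern P E a = bern P E b"
  using assms unfolding bern_def by (intro arg_cong2[of _ _ _ _ "(*)"] prod.cong) auto

text \<open>\<open>bern P E a\<close> is the probability that a random subset of \<open>P\<close>,
  containing each \<open>p\<close> independently with probability \<open>a p\<close>, equals
  \<open>E\<close>. The sum is the expansion of the product of the factors
  \<open>a p + (1 - a p)\<close>.\<close>

lemma sum_bern:
  assumes "finite P"
  shows "(\<Sum>E\<in>Pow P. bern P E a) = 1"
  using prod_add[OF assms, of a "\<lambda>p. 1 - a p"] by (simp add: bern_def)

text \<open>Linearity of expectation: the random subset collects \<open>\<alpha> p\<close> for each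
  point it contains and \<open>\<beta> p\<close> for each point it misses. With logarithms as
  coefficients this yields entropies and cross entropies.\<close>

lemma sum_bern_linear:
  assumes "finite P"
  shows "(\<Sum>E\<in>Pow P. bern P E a * ((\<Sum>p\<in>E. \<alpha> p) + (\<Sum>p\<in>P - E. \<beta> p))) =
    (\<Sum>p\<in>P. a p * \<alpha> p + (1 - a p) * \<beta> p)"
  using assms
proof induction
  case empty
  then show ?case by simp
next
  case (insert p P)
  let ?L = "\<lambda>P E. (\<Sum>p\<in>E. \<alpha> p) + (\<Sum>p\<in>P - E. \<beta> p)"
  have fin: "finite E" if "E \<in> Pow P" for E
    using that insert(1) finite_subset by blast
  have 1: "bern (insert p P) E a = (1 - a p) * bern P E a \<and> ?L (insert p P) E = ?L P E + \<beta> p"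
    if "E \<in> Pow P" for E
  proof -
    have "insert p P - E = insert p (P - E)" "p \<notin> P - E" "finite (P - E)"
      using that insert(1,2) by auto
    then show ?thesis by (simp add: bern_def)
  qed
  have 2: "bern (insert p P) (insert p E) a = a p * bern P E a \<and>
      ?L (insert p P) (insert p E) = ?L P E + \<alpha> p"
    if "E \<in> Pow P" for E
  proof -
    have "insert p P - insert p E = P - E" "p \<notin> E" "finite E"
      using that insert(1,2) fin by auto
    then show ?thesis by (simp add: bern_def)
  qed
  have inj: "inj_on (insert p) (Pow P)"
    using insert(2) by (auto simp: inj_on_def)
  have "(\<Sum>E\<in>Pow (insert p P). bern (insert p P) E a * ?L (insert p P) E) =
      (\<Sum>E\<in>Pow P. bern (insert p P) E a * ?L (insert p P) E) +
      (\<Sum>E\<in>Pow P. bern (insert p P) (insert p E) a * ?L (insert p P) (insert p E))"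
    unfolding Pow_insert using insert(1,2)
    by (subst sum.union_disjoint) (auto simp: sum.reindex[OF inj])
  also have "\<dots> = (\<Sum>E\<in>Pow P. (1 - a p) * bern P E a * (?L P E + \<beta> p)) +
      (\<Sum>E\<in>Pow P. a p * bern P E a * (?L P E + \<alpha> p))"
    by (intro arg_cong2[of _ _ _ _ "(+)"] sum.cong) (simp_all only: 1 2 simp_thms)
  also have "\<dots> = (\<Sum>E\<in>Pow P. bern P E a * ?L P E + (a p * \<alpha> p + (1 - a p) * \<beta> p) * bern P E a)"
    unfolding sum.distrib[symmetric] by (intro sum.cong) (auto simp: algebra_simps)
  also have "\<dots> = (\<Sum>p\<in>P. a p * \<alpha> p + (1 - a p) * \<beta> p) + (a p * \<alpha> p + (1 - a p) * \<beta> p)"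
    unfolding sum.distrib insert.IH sum_distrib_left[symmetric] sum_bern[OF insert(1)] by simp
  finally show ?case using insert by simp
qed

text \<open>The factor \<open>bern P E a\<close> stays on both sides because of the convention
  \<open>log 2 0 = 0\<close>: if a factor of the product vanishes, the logarithm of the product is
  0, while the sum of the logarithms need not be.\<close>

lemma bern_log:
  assumes "finite P" "E \<subseteq> P" "\<And>p. p \<in> P \<Longrightarrow> a p \<in> {0..1}"
  shows "bern P E a * log 2 (bern P E a) =
    bern P E a * ((\<Sum>p\<in>E. log 2 (a p)) + (\<Sum>p\<in>P - E. log 2 (1 - a p)))"
proof (cases "bern P E a = 0")
  case False
  have fin: "finite E" "finite (P - E)" using assms finite_subset by auto
  have pos: "a p > 0" if "p \<in> E" for p
    using False assms(2,3) that fin by (force simp: bern_def)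
  have pos': "1 - a p > 0" if "p \<in> P - E" for p
    using False assms(2,3) that fin by (force simp: bern_def)
  have "ln (\<Prod>p\<in>E. a p) = (\<Sum>p\<in>E. ln (a p))" "ln (\<Prod>p\<in>P - E. 1 - a p) = (\<Sum>p\<in>P - E. ln (1 - a p))"
    using pos pos' fin by (auto intro!: ln_prod) fastforce+
  note ln = this
  have "log 2 (bern P E a) = log 2 (\<Prod>p\<in>E. a p) + log 2 (\<Prod>p\<in>P - E. 1 - a p)"
    unfolding bern_def using pos pos' by (intro log_mult_pos prod_pos) auto
  also have "\<dots> = (\<Sum>p\<in>E. log 2 (a p)) + (\<Sum>p\<in>P - E. log 2 (1 - a p))"
    by (simp add: log_def sum_divide_distrib[symmetric] ln)
  finally show ?thesis by simp
qed simp

lemma bern_entropy: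
  assumes "finite P" "\<And>p. p \<in> P \<Longrightarrow> a p \<in> {0..1}"
  shows "(\<Sum>E\<in>Pow P. bern P E a * log 2 (bern P E a)) = - (\<Sum>p\<in>P. binary_entropy (a p))"
proof -
  have "(\<Sum>E\<in>Pow P. bern P E a * log 2 (bern P E a)) =
      (\<Sum>E\<in>Pow P. bern P E a * ((\<Sum>p\<in>E. log 2 (a p)) + (\<Sum>p\<in>P - E. log 2 (1 - a p))))"
    using assms by (intro sum.cong bern_log) auto
  also have "\<dots> = - (\<Sum>p\<in>P. binary_entropy (a p))"
    unfolding sum_bern_linear[OF assms(1)] binary_entropy_def sum_negf[symmetric]
    by (intro sum.cong) auto
  finally show ?thesis .
qed

text \<open>Termwise from ln t <= t - 1 at t = q / p. The hypothesis \<open>ac\<close> replaces the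
  convention log 0 = -\<infinity>: as \<open>log 2 0 = 0\<close>, a point with q = 0 < p would
  contribute 0 on the left instead of -\<infinity>.\<close>

lemma gibbs_inequality:
  assumes "finite X" "\<And>x. x \<in> X \<Longrightarrow> 0 \<le> p x" "\<And>x. x \<in> X \<Longrightarrow> 0 \<le> q x"
    and ac: "\<And>x. x \<in> X \<Longrightarrow> 0 < p x \<Longrightarrow> 0 < q x"
    and "(\<Sum>x\<in>X. q x) \<le> (\<Sum>x\<in>X. p x)"
  shows "(\<Sum>x\<in>X. p x * log 2 (q x)) \<le> (\<Sum>x\<in>X. p x * log 2 (p x))"
proof -
  have "p x * log 2 (q x) - p x * log 2 (p x) \<le> (q x - p x) / ln 2" if x: "x \<in> X" for x
  proof (cases "p x = 0")
    case True
    then show ?thesis using assms(3)[OF x] by simp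
  next
    case False
    then have p: "p x > 0" "q x > 0" using assms(2)[OF x] ac[OF x] by auto
    have "ln (q x / p x) \<le> q x / p x - 1" using p by (intro ln_le_minus_one) auto
    then have "p x * (ln (q x) - ln (p x)) \<le> q x - p x"
      using p by (simp add: ln_div field_simps)
    then have "p x * (ln (q x) - ln (p x)) / ln 2 \<le> (q x - p x) / ln 2"
      by (intro divide_right_mono) auto
    then show ?thesis by (simp add: log_def right_diff_distrib diff_divide_distrib)
  qed
  then have "(\<Sum>x\<in>X. p x * log 2 (q x) - p x * log 2 (p x)) \<le> (\<Sum>x\<in>X. (q x - p x) / ln 2)"
    by (rule sum_mono)
  also have "\<dots> = ((\<Sum>x\<in>X. q x) - (\<Sum>x\<in>X. p x)) / ln 2"
    by (simp add: sum_divide_distrib[symmetric] sum_subtractf)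
  also have "\<dots> \<le> 0" using assms(5) by (simp add: field_simps)
  finally show ?thesis by (simp add: sum_subtractf)
qed

section \<open>Block averages\<close>

text \<open>\<open>f\<close> assigns to each vertex the index of its part; the density of an empty part is \<open>0 / 0 = 0\<close>.\<close>

definition wt :: "nat set \<Rightarrow> (nat \<Rightarrow> nat) \<Rightarrow> nat \<Rightarrow> real" where
  "wt V f i = real (card {v\<in>V. f v = i}) / real (card V)"

definition mass :: "nat set \<Rightarrow> (nat \<Rightarrow> nat \<Rightarrow> real) \<Rightarrow> (nat \<Rightarrow> nat) \<Rightarrow> nat \<Rightarrow> nat \<Rightarrow> real" where
  "mass V A f i j =
     (\<Sum>u\<in>V. \<Sum>v\<in>V. A u v * (of_bool (f u = i) * of_bool (f v = j))) / (real (card V))\<^sup>2"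

definition dens :: "nat set \<Rightarrow> (nat \<Rightarrow> nat \<Rightarrow> real) \<Rightarrow> (nat \<Rightarrow> nat) \<Rightarrow> nat \<Rightarrow> nat \<Rightarrow> real" where
  "dens V A f i j = mass V A f i j / (wt V f i * wt V f j)"

definition blk :: "nat set \<Rightarrow> (nat \<Rightarrow> nat \<Rightarrow> real) \<Rightarrow> (nat \<Rightarrow> nat) \<Rightarrow> nat \<Rightarrow> nat \<Rightarrow> real" where
  "blk V A f u v = dens V A f (f u) (f v)"

lemma wt_bounds: "finite V \<Longrightarrow> wt V f i \<in> {0..1}"
  by (auto simp: wt_def divide_le_eq_1 card_gt_0_iff intro!: card_mono)

lemma wt_altdef: "finite V \<Longrightarrow> wt V f i = (\<Sum>v\<in>V. of_bool (f v = i)) / real (card V)"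
  by (simp add: wt_def sum_of_bool_eq Int_def del: Int_Collect)

lemma block_sum:
  assumes "finite V" "f ` V \<subseteq> {..<N::nat}"
  shows "(\<Sum>u\<in>V. \<Sum>v\<in>V. A u v * g (f u) (f v)) =
    (real (card V))\<^sup>2 * (\<Sum>i<N. \<Sum>j<N. mass V A f i j * g i j)"
proof (cases "V = {}")
  case False
  then have n: "real (card V) \<noteq> 0" using assms by auto
  have "(real (card V))\<^sup>2 * (\<Sum>i<N. \<Sum>j<N. mass V A f i j * g i j) =
    (\<Sum>i<N. \<Sum>j<N. (\<Sum>u\<in>V. \<Sum>v\<in>V. A u v * (of_bool (f u = i) * of_bool (f v = j))) * g i j)"
    using n by (simp add: mass_def sum_distrib_left)
  also have "\<dots> = (\<Sum>i<N. \<Sum>j<N. \<Sum>u\<in>V. \<Sum>v\<in>V. A u v * (of_bool (f u = i) * (of_bool (f v = j) * g i j)))"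
    by (simp add: sum_distrib_right mult.assoc)
  also have "\<dots> = (\<Sum>i<N. \<Sum>u\<in>V. \<Sum>j<N. \<Sum>v\<in>V. A u v * (of_bool (f u = i) * (of_bool (f v = j) * g i j)))"
    by (intro sum.cong refl sum.swap)
  also have "\<dots> = (\<Sum>u\<in>V. \<Sum>i<N. \<Sum>j<N. \<Sum>v\<in>V. A u v * (of_bool (f u = i) * (of_bool (f v = j) * g i j)))"
    by (rule sum.swap)
  also have "\<dots> = (\<Sum>u\<in>V. \<Sum>i<N. \<Sum>v\<in>V. \<Sum>j<N. A u v * (of_bool (f u = i) * (of_bool (f v = j) * g i j)))"
    by (intro sum.cong refl sum.swap)
  also have "\<dots> = (\<Sum>u\<in>V. \<Sum>v\<in>V. \<Sum>i<N. \<Sum>j<N. A u v * (of_bool (f u = i) * (of_bool (f v = j) * g i j)))"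
    by (intro sum.cong refl sum.swap)
  also have "\<dots> = (\<Sum>u\<in>V. \<Sum>v\<in>V. A u v * g (f u) (f v))"
  proof (intro sum.cong refl)
    fix u v assume uv: "u \<in> V" "v \<in> V"
    then have "f u < N" "f v < N" using assms(2) by auto
    then have "{..<N} \<inter> {i. f u = i} = {f u}" "{..<N} \<inter> {j. f v = j} = {f v}"
      by auto
    then show "(\<Sum>i<N. \<Sum>j<N. A u v * (of_bool (f u = i) * (of_bool (f v = j) * g i j))) = A u v * g (f u) (f v)"
      by (simp flip: sum_distrib_left)
  qed
  finally show ?thesis by simp
qed simp

lemma mass_one: "finite V \<Longrightarrow> mass V (\<lambda>_ _. 1) f i j = wt V f i * wt V f j"
  by (simp add: mass_def wt_altdef sum_product power2_eq_square del: sum_of_bool_mult_eq sum_mult_of_bool_eq sum_of_bool_eq)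

lemma block_sum_const:
  assumes "finite V" "f ` V \<subseteq> {..<N::nat}"
  shows "(\<Sum>u\<in>V. \<Sum>v\<in>V. g (f u) (f v)) =
    (real (card V))\<^sup>2 * (\<Sum>i<N. \<Sum>j<N. wt V f i * wt V f j * g i j)"
  using block_sum[OF assms, of "\<lambda>_ _. 1" g] by (simp add: mass_one[OF assms(1)])

lemma mass_bounds:
  assumes "finite V" "\<And>u v. u \<in> V \<Longrightarrow> v \<in> V \<Longrightarrow> A u v \<in> {0..1}"
  shows "0 \<le> mass V A f i j" "mass V A f i j \<le> wt V f i * wt V f j"
proof -
  show "0 \<le> mass V A f i j"
    unfolding mass_def using assms by (intro divide_nonneg_nonneg sum_nonneg mult_nonneg_nonneg) auto
  show "mass V A f i j \<le> wt V f i * wt V f j"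
    unfolding mass_one[OF assms(1), symmetric] unfolding mass_def using assms
    by (intro divide_right_mono sum_mono mult_right_mono) auto
qed

text \<open>For an empty part the mass vanishes together with the weight, so the default value of
  the density does no harm.\<close>

lemma dens_mult:
  assumes "finite V" "\<And>u v. u \<in> V \<Longrightarrow> v \<in> V \<Longrightarrow> A u v \<in> {0..1}"
  shows "wt V f i * wt V f j * dens V A f i j = mass V A f i j"
  using mass_bounds[where V=V and A=A and f=f and i=i and j=j, OF assms] by (auto simp: dens_def)

lemma dens_bounds:
  assumes "finite V" "\<And>u v. u \<in> V \<Longrightarrow> v \<in> V \<Longrightarrow> A u v \<in> {0..1}"
  shows "dens V A f i j \<in> {0..1}"
proof -
  have m: "0 \<le> mass V A f i j" "mass V A f i j \<le> wt V f i * wt V f j"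
    using mass_bounds[where V=V and A=A and f=f and i=i and j=j, OF assms] by auto
  then have "mass V A f i j / (wt V f i * wt V f j) \<le> 1"
    by (intro divide_le_eq_1[THEN iffD2]) (metis order_trans order_less_le)
  moreover have "0 \<le> mass V A f i j / (wt V f i * wt V f j)"
    using m by (intro divide_nonneg_nonneg) auto
  ultimately show ?thesis by (simp add: dens_def)
qed

text \<open>\<open>blk V A f\<close> is the conditional expectation of \<open>A\<close> given the
  pair of parts, so both have the same sum against every function of the two part indices.\<close>

lemma blk_sum:
  fixes f :: "nat \<Rightarrow> nat"
  assumes "finite V" "\<And>u v. u \<in> V \<Longrightarrow> v \<in> V \<Longrightarrow> A u v \<in> {0..1}"
  shows "(\<Sum>u\<in>V. \<Sum>v\<in>V. blk V A f u v * g (f u) (f v)) = (\<Sum>u\<in>V. \<Sum>v\<in>V. A u v * g (f u) (f v))"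
proof -
  obtain N where N: "f ` V \<subseteq> {..<N}"
    using assms(1) finite_nat_bounded[of "f ` V"] by auto
  have *: "wt V f i * wt V f j * (dens V A f i j * g i j) = mass V A f i j * g i j" for i j
    using dens_mult[where V=V and A=A and f=f and i=i and j=j, OF assms] by (simp flip: mult.assoc)
  then show ?thesis
    unfolding blk_def block_sum_const[OF assms(1) N, of "\<lambda>i j. dens V A f i j * g i j"]
      block_sum[OF assms(1) N] by (simp only: *)
qed

section \<open>Energy increment\<close>

definition energy :: "nat set \<Rightarrow> (nat \<Rightarrow> nat \<Rightarrow> real) \<Rightarrow> (nat \<Rightarrow> nat) \<Rightarrow> real" where
  "energy V A f = (\<Sum>u\<in>V. \<Sum>v\<in>V. (blk V A f u v)\<^sup>2) / (real (card V))\<^sup>2"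

text \<open>The normalised cut norm of the difference between \<open>A\<close> and its block average.\<close>

definition cutdev :: "nat set \<Rightarrow> (nat \<Rightarrow> nat \<Rightarrow> real) \<Rightarrow> (nat \<Rightarrow> nat) \<Rightarrow> real" where
  "cutdev V A f = Max ((\<lambda>(S, T). \<bar>\<Sum>u\<in>S. \<Sum>v\<in>T. A u v - blk V A f u v\<bar>) ` (Pow V \<times> Pow V))
     / (real (card V))\<^sup>2"

text \<open>The last base-4 digit records membership in \<open>S\<close> and \<open>T\<close>, so that coarser partitions are
  recovered by division.\<close>

definition refine :: "(nat \<Rightarrow> nat) \<Rightarrow> nat set \<Rightarrow> nat set \<Rightarrow> nat \<Rightarrow> nat" where
  "refine f S T u = 4 * f u + (2 * of_bool (u \<in> S) + of_bool (u \<in> T))"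

lemma refine_div: "refine f S T u div 4 = f u"
  by (simp add: refine_def)

lemma refine_bits:
  "odd (refine f S T u div 2) \<longleftrightarrow> u \<in> S" "odd (refine f S T u) \<longleftrightarrow> u \<in> T"
  by (auto simp: refine_def)

lemma blk_bounds:
  assumes "finite V" "\<And>u v. u \<in> V \<Longrightarrow> v \<in> V \<Longrightarrow> A u v \<in> {0..1}"
  shows "blk V A f u v \<in> {0..1}"
  unfolding blk_def using dens_bounds[where V=V and A=A, OF assms] .

text \<open>Pythagoras: \<open>f\<close> factors through \<open>f'\<close>, so the coarse block
  average is the orthogonal projection of the fine one, and the mixed term equals the squared norm
  of the coarse average.\<close>

lemma energy_diff:
  assumes V: "finite V" and A: "\<And>u v. u \<in> V \<Longrightarrow> v \<in> V \<Longrightarrow> A u v \<in> {0..1}"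
    and f: "\<And>u. u \<in> V \<Longrightarrow> f u = k (f' u)"
  shows "(\<Sum>u\<in>V. \<Sum>v\<in>V. (blk V A f' u v - blk V A f u v)\<^sup>2) / (real (card V))\<^sup>2 =
    energy V A f' - energy V A f"
proof -
  let ?D = "\<lambda>i j. dens V A f (k i) (k j)"
  have b: "blk V A f u v = ?D (f' u) (f' v)" if "u \<in> V" "v \<in> V" for u v
    using that f by (simp add: blk_def)
  have "(\<Sum>u\<in>V. \<Sum>v\<in>V. blk V A f' u v * blk V A f u v) =
      (\<Sum>u\<in>V. \<Sum>v\<in>V. blk V A f' u v * ?D (f' u) (f' v))"
    by (intro sum.cong refl) (simp add: b)
  also have "\<dots> = (\<Sum>u\<in>V. \<Sum>v\<in>V. A u v * ?D (f' u) (f' v))"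
    by (rule blk_sum[where A=A and f=f', OF V A])
  also have "\<dots> = (\<Sum>u\<in>V. \<Sum>v\<in>V. A u v * dens V A f (f u) (f v))"
    by (intro sum.cong refl) (simp add: f)
  also have "\<dots> = (\<Sum>u\<in>V. \<Sum>v\<in>V. blk V A f u v * dens V A f (f u) (f v))"
    by (rule blk_sum[where A=A and f=f, OF V A, symmetric])
  also have "\<dots> = (\<Sum>u\<in>V. \<Sum>v\<in>V. (blk V A f u v)\<^sup>2)"
    by (simp add: blk_def power2_eq_square)
  finally have *: "(\<Sum>u\<in>V. \<Sum>v\<in>V. blk V A f' u v * blk V A f u v) = (\<Sum>u\<in>V. \<Sum>v\<in>V. (blk V A f u v)\<^sup>2)" .
  have "(\<Sum>u\<in>V. \<Sum>v\<in>V. (blk V A f' u v - blk V A f u v)\<^sup>2) =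
      (\<Sum>u\<in>V. \<Sum>v\<in>V. (blk V A f' u v)\<^sup>2) + (\<Sum>u\<in>V. \<Sum>v\<in>V. (blk V A f u v)\<^sup>2) -
      2 * (\<Sum>u\<in>V. \<Sum>v\<in>V. blk V A f' u v * blk V A f u v)"
    by (simp add: power2_diff sum.distrib sum_subtractf sum_distrib_left mult.assoc)
  also have "\<dots> = (\<Sum>u\<in>V. \<Sum>v\<in>V. (blk V A f' u v)\<^sup>2) - (\<Sum>u\<in>V. \<Sum>v\<in>V. (blk V A f u v)\<^sup>2)"
    unfolding * by simp
  finally show ?thesis by (simp add: energy_def diff_divide_distrib)
qed

lemma double_sum_le_card_sq:
  assumes "finite V" "S \<subseteq> V" "T \<subseteq> V" "\<And>u v. u \<in> V \<Longrightarrow> v \<in> V \<Longrightarrow> a u v \<le> (1::real)"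
  shows "(\<Sum>u\<in>S. \<Sum>v\<in>T. a u v) \<le> (real (card V))\<^sup>2"
proof -
  have "(\<Sum>u\<in>S. \<Sum>v\<in>T. a u v) \<le> (\<Sum>u\<in>S. \<Sum>v\<in>T. 1)"
    using assms by (intro sum_mono) auto
  also have "\<dots> = real (card S) * real (card T)" by simp
  also have "\<dots> \<le> real (card V) * real (card V)"
    using assms by (intro mult_mono) (auto intro: card_mono)
  finally show ?thesis by (simp add: power2_eq_square)
qed

lemma energy_bounds:
  assumes V: "finite V" and A: "\<And>u v. u \<in> V \<Longrightarrow> v \<in> V \<Longrightarrow> A u v \<in> {0..1}"
  shows "energy V A f \<in> {0..1}"
proof -
  have "(blk V A f u v)\<^sup>2 \<le> 1" for u v
    using blk_bounds[where A=A and f=f, OF V A] by (auto intro: power_le_one)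
  then have "(\<Sum>u\<in>V. \<Sum>v\<in>V. (blk V A f u v)\<^sup>2) \<le> (real (card V))\<^sup>2"
    using V by (intro double_sum_le_card_sq) auto
  moreover have "0 \<le> energy V A f"
    unfolding energy_def by (intro divide_nonneg_nonneg sum_nonneg) auto
  ultimately show ?thesis
    by (auto simp: energy_def divide_le_eq_1)
qed

lemma cutdev_bound:
  assumes "finite V" "S \<subseteq> V" "T \<subseteq> V"
  shows "\<bar>\<Sum>u\<in>S. \<Sum>v\<in>T. A u v - blk V A f u v\<bar> \<le> cutdev V A f * (real (card V))\<^sup>2"
proof (cases "V = {}")
  case False
  then have "card V \<noteq> 0" using assms by simp
  then show ?thesis unfolding cutdev_def using assms by (auto intro!: Max_ge)
next
  case True
  then show ?thesis using assms by simp
qed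

lemma cutdev_attained:
  assumes "finite V"
  obtains S T where "S \<subseteq> V" "T \<subseteq> V"
    "cutdev V A f = \<bar>\<Sum>u\<in>S. \<Sum>v\<in>T. A u v - blk V A f u v\<bar> / (real (card V))\<^sup>2"
proof -
  let ?h = "\<lambda>(S, T). \<bar>\<Sum>u\<in>S. \<Sum>v\<in>T. A u v - blk V A f u v\<bar>"
  have "Max (?h ` (Pow V \<times> Pow V)) \<in> ?h ` (Pow V \<times> Pow V)"
    using assms by (intro Max_in) auto
  then obtain S T where "S \<subseteq> V" "T \<subseteq> V" "Max (?h ` (Pow V \<times> Pow V)) = ?h (S, T)" by auto
  then show thesis using that[of S T] by (simp add: cutdev_def)
qed

lemma cutdev_bounds:
  assumes V: "finite V" and A: "\<And>u v. u \<in> V \<Longrightarrow> v \<in> V \<Longrightarrow> A u v \<in> {0..1}"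
  shows "cutdev V A f \<in> {0..1}"
proof -
  obtain S T where ST: "S \<subseteq> V" "T \<subseteq> V"
    "cutdev V A f = \<bar>\<Sum>u\<in>S. \<Sum>v\<in>T. A u v - blk V A f u v\<bar> / (real (card V))\<^sup>2"
    using cutdev_attained[OF V] .
  have "\<bar>\<Sum>u\<in>S. \<Sum>v\<in>T. A u v - blk V A f u v\<bar> \<le> (\<Sum>u\<in>S. \<Sum>v\<in>T. \<bar>A u v - blk V A f u v\<bar>)"
    by (intro order_trans[OF sum_abs] sum_mono) auto
  also have "\<dots> \<le> (real (card V))\<^sup>2"
    using V ST(1,2)
  proof (rule double_sum_le_card_sq)
    show "\<bar>A u v - blk V A f u v\<bar> \<le> 1" if "u \<in> V" "v \<in> V" for u v
      using A[OF that] blk_bounds[where A=A and f=f and u=u and v=v, OF V A] by auto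
  qed
  finally show ?thesis using ST(3) by (auto simp: divide_le_eq_1)
qed

text \<open>Membership in \<open>S\<close> and \<open>T\<close> can be read off the new codes, so
  \<open>A\<close> and its new block average have the same sum over \<open>S \<times> T\<close>. The
  cut deviation is therefore a sum of differences of the two block averages, which Cauchy-Schwarz
  bounds by their L2 distance, that is, by the energy gain.\<close>

lemma refine_energy_increment:
  assumes V: "finite V" and A: "\<And>u v. u \<in> V \<Longrightarrow> v \<in> V \<Longrightarrow> A u v \<in> {0..1}"
    and ST: "S \<subseteq> V" "T \<subseteq> V"
    "cutdev V A f = \<bar>\<Sum>u\<in>S. \<Sum>v\<in>T. A u v - blk V A f u v\<bar> / (real (card V))\<^sup>2"
  shows "(cutdev V A f)\<^sup>2 \<le> energy V A (refine f S T) - energy V A f"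
proof (cases "V = {}")
  case False
  let ?f' = "refine f S T"
  let ?n2 = "(real (card V))\<^sup>2"
  let ?d = "\<lambda>u v. blk V A ?f' u v - blk V A f u v"
  let ?g = "\<lambda>i j. of_bool (odd (i div 2)) * of_bool (odd j) :: real"
  have n: "?n2 > 0" using False V by (simp add: card_gt_0_iff)
  have restr: "(\<Sum>u\<in>S. \<Sum>v\<in>T. h u v) = (\<Sum>u\<in>V. \<Sum>v\<in>V. h u v * ?g (?f' u) (?f' v))"
    for h :: "nat \<Rightarrow> nat \<Rightarrow> real"
  proof -
    have "(\<Sum>u\<in>V. \<Sum>v\<in>V. h u v * ?g (?f' u) (?f' v)) =
        (\<Sum>u\<in>V. of_bool (u \<in> S) * (\<Sum>v\<in>V. h u v * of_bool (v \<in> T)))"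
      unfolding refine_bits by (simp add: sum_distrib_left mult_ac del: sum_of_bool_mult_eq sum_mult_of_bool_eq)
    also have "\<dots> = (\<Sum>u\<in>S. \<Sum>v\<in>T. h u v)"
      using V ST by (simp add: Int_absorb1)
    finally show ?thesis by simp
  qed
  have "(\<Sum>u\<in>S. \<Sum>v\<in>T. A u v) = (\<Sum>u\<in>S. \<Sum>v\<in>T. blk V A ?f' u v)"
    unfolding restr by (rule blk_sum[where A=A and f="?f'", OF V A, symmetric])
  then have "(\<Sum>u\<in>S. \<Sum>v\<in>T. A u v - blk V A f u v) = (\<Sum>u\<in>S. \<Sum>v\<in>T. ?d u v)"
    by (simp add: sum_subtractf)
  then have "(cutdev V A f)\<^sup>2 * ?n2\<^sup>2 = (\<Sum>(u, v)\<in>S \<times> T. ?d u v)\<^sup>2"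
    using n by (simp add: ST(3) power_divide sum.cartesian_product)
  also have "\<dots> \<le> (\<Sum>(u, v)\<in>V \<times> V. (?d u v)\<^sup>2) * ?n2"
  proof -
    have "(\<Sum>(u, v)\<in>S \<times> T. ?d u v)\<^sup>2 \<le> (\<Sum>(u, v)\<in>S \<times> T. (?d u v)\<^sup>2) * card (S \<times> T)"
      using sum_squared_le_sum_of_squares[of "\<lambda>(u, v). ?d u v" "S \<times> T"]
      by (simp add: case_prod_unfold)
    also have "\<dots> \<le> (\<Sum>(u, v)\<in>V \<times> V. (?d u v)\<^sup>2) * card (V \<times> V)"
      using V ST by (intro mult_mono sum_mono2 of_nat_mono card_mono)
        (auto intro: sum_nonneg)
    finally show ?thesis by (simp add: card_cartesian_product power2_eq_square)
  qed
  finally have "(cutdev V A f)\<^sup>2 * ?n2\<^sup>2 \<le> (\<Sum>u\<in>V. \<Sum>v\<in>V. (?d u v)\<^sup>2) * ?n2"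
    by (simp add: sum.cartesian_product)
  then have "(cutdev V A f)\<^sup>2 * ?n2 \<le> (\<Sum>u\<in>V. \<Sum>v\<in>V. (?d u v)\<^sup>2)"
    using n by (simp only: power2_eq_square[of ?n2] mult.assoc[symmetric] mult_le_cancel_right_pos)
  then have "(cutdev V A f)\<^sup>2 \<le> (\<Sum>u\<in>V. \<Sum>v\<in>V. (?d u v)\<^sup>2) / ?n2"
    using n by (simp add: pos_le_divide_eq)
  also have "\<dots> = energy V A ?f' - energy V A f"
    using V A by (rule energy_diff[where k="\<lambda>i. i div 4"]) (auto simp: refine_div)
  finally show ?thesis .
qed (use assms in \<open>simp add: energy_def\<close>)

text \<open>A fixed choice among the pairs attaining the maximum makes the whole chain a function of
  the graph, which allows graphs to be classified by their chains.\<close>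

definition greedy_pair :: "nat set \<Rightarrow> (nat \<Rightarrow> nat \<Rightarrow> real) \<Rightarrow> (nat \<Rightarrow> nat) \<Rightarrow> nat set \<times> nat set" where
  "greedy_pair V A f = (SOME (S, T). S \<subseteq> V \<and> T \<subseteq> V \<and>
     cutdev V A f = \<bar>\<Sum>u\<in>S. \<Sum>v\<in>T. A u v - blk V A f u v\<bar> / (real (card V))\<^sup>2)"

primrec code :: "nat set \<Rightarrow> (nat \<Rightarrow> nat \<Rightarrow> real) \<Rightarrow> nat \<Rightarrow> nat \<Rightarrow> nat" where
  "code V A 0 = (\<lambda>_. 0)"
| "code V A (Suc t) = refine (code V A t) (fst (greedy_pair V A (code V A t))) (snd (greedy_pair V A (code V A t)))"

lemma code_energy_increment:
  assumes V: "finite V" and A: "\<And>u v. u \<in> V \<Longrightarrow> v \<in> V \<Longrightarrow> A u v \<in> {0..1}"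
  shows "(cutdev V A (code V A t))\<^sup>2 \<le> energy V A (code V A (Suc t)) - energy V A (code V A t)"
proof -
  let ?f = "code V A t"
  let ?P = "\<lambda>(S, T). S \<subseteq> V \<and> T \<subseteq> V \<and>
     cutdev V A ?f = \<bar>\<Sum>u\<in>S. \<Sum>v\<in>T. A u v - blk V A ?f u v\<bar> / (real (card V))\<^sup>2"
  obtain S T where "S \<subseteq> V \<and> T \<subseteq> V \<and>
     cutdev V A ?f = \<bar>\<Sum>u\<in>S. \<Sum>v\<in>T. A u v - blk V A ?f u v\<bar> / (real (card V))\<^sup>2"
    by (rule cutdev_attained[OF V, of A ?f]) blast
  then have "\<exists>x. ?P x" by auto
  then have "?P (greedy_pair V A ?f)"
    unfolding greedy_pair_def by (rule someI_ex)
  then show ?thesis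
    using refine_energy_increment[where A=A and f="?f" and S="fst (greedy_pair V A ?f)" and T="snd (greedy_pair V A ?f)", OF V A]
    by (simp add: case_prod_unfold)
qed

lemma code_less: "code V A t u < 4 ^ t"
proof (induction t)
  case (Suc t)
  have "2 * of_bool (u \<in> fst (greedy_pair V A (code V A t))) +
      of_bool (u \<in> snd (greedy_pair V A (code V A t))) < (4::nat)" by simp
  with Suc show ?case by (simp add: refine_def)
qed simp

lemma code_div: "t \<le> s \<Longrightarrow> code V A t u = code V A s u div 4 ^ (s - t)"
proof (induction rule: dec_induct)
  case (step s)
  then show ?case
    by (simp add: Suc_diff_le refine_div div_mult2_eq)
qed simp

section \<open>The counting lemma\<close>

text \<open>A linear form on the cube [0,1]^V is extremal at a vertex of the cube: the indicator of
  the points where \<open>a\<close> is nonnegative, or of those where it is nonpositive.\<close>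

lemma weighted_sum_bound:
  assumes "finite V" "\<And>S. S \<subseteq> V \<Longrightarrow> \<bar>\<Sum>x\<in>S. a x\<bar> \<le> (c::real)"
    and f: "\<And>x. x \<in> V \<Longrightarrow> f x \<in> {0..1}"
  shows "\<bar>\<Sum>x\<in>V. a x * f x\<bar> \<le> c"
proof -
  have *: "(\<Sum>x\<in>V. b x * f x) \<le> (\<Sum>x\<in>{x\<in>V. b x \<ge> 0}. b x)" for b
  proof -
    have "(\<Sum>x\<in>V. b x * f x) \<le> (\<Sum>x\<in>V. if b x \<ge> 0 then b x else 0)"
    proof (rule sum_mono)
      fix x assume "x \<in> V"
      from f[OF this] show "b x * f x \<le> (if b x \<ge> 0 then b x else 0)"
        by (auto simp: mult_left_le mult_nonpos_nonneg)
    qed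
    also have "\<dots> = (\<Sum>x\<in>{x\<in>V. b x \<ge> 0}. b x)"
      using assms(1) by (simp add: sum.If_cases Int_def)
    finally show ?thesis .
  qed
  have "(\<Sum>x\<in>V. a x * f x) \<le> c"
    using *[of a] assms(2)[of "{x\<in>V. a x \<ge> 0}"] by auto
  moreover have "- (\<Sum>x\<in>V. a x * f x) \<le> c"
    using *[of "\<lambda>x. - a x"] assms(2)[of "{x\<in>V. - a x \<ge> 0}"] by (auto simp: sum_negf)
  ultimately show ?thesis by simp
qed

text \<open>The sets are relaxed to weights one variable at a time, the linear case being applied
  first in \<open>v\<close> and then in \<open>u\<close>.\<close>

lemma bilinear_sum_bound:
  assumes V: "finite V" and c: "\<And>S T. S \<subseteq> V \<Longrightarrow> T \<subseteq> V \<Longrightarrow> \<bar>\<Sum>u\<in>S. \<Sum>v\<in>T. d u v\<bar> \<le> (c::real)"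
    and f: "\<And>x. x \<in> V \<Longrightarrow> f x \<in> {0..1}" and g: "\<And>x. x \<in> V \<Longrightarrow> g x \<in> {0..1}"
  shows "\<bar>\<Sum>u\<in>V. \<Sum>v\<in>V. d u v * (f u * g v)\<bar> \<le> c"
proof -
  have "\<bar>\<Sum>u\<in>S. \<Sum>v\<in>V. d u v * g v\<bar> \<le> c" if S: "S \<subseteq> V" for S
  proof -
    have "(\<Sum>u\<in>S. \<Sum>v\<in>V. d u v * g v) = (\<Sum>v\<in>V. (\<Sum>u\<in>S. d u v) * g v)"
      unfolding sum_distrib_right by (rule sum.swap)
    moreover have "\<bar>\<Sum>v\<in>V. (\<Sum>u\<in>S. d u v) * g v\<bar> \<le> c"
    proof (rule weighted_sum_bound[OF V _ g])
      fix T assume "T \<subseteq> V"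
      have "(\<Sum>v\<in>T. \<Sum>u\<in>S. d u v) = (\<Sum>u\<in>S. \<Sum>v\<in>T. d u v)" by (rule sum.swap)
      then show "\<bar>\<Sum>v\<in>T. \<Sum>u\<in>S. d u v\<bar> \<le> c" using c[OF S \<open>T \<subseteq> V\<close>] by simp
    qed
    ultimately show ?thesis by simp
  qed
  from weighted_sum_bound[OF V this f]
  have "\<bar>\<Sum>u\<in>V. (\<Sum>v\<in>V. d u v * g v) * f u\<bar> \<le> c" .
  then show ?thesis by (simp add: sum_distrib_left sum_distrib_right mult_ac)
qed

lemma sum_PiE_insert:
  assumes "i \<notin> J"
  shows "(\<Sum>\<phi>\<in>insert i J \<rightarrow>\<^sub>E V. F \<phi>) = (\<Sum>\<phi>\<in>J \<rightarrow>\<^sub>E V. \<Sum>x\<in>V. F (\<phi>(i := x)))"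
proof -
  have "(\<Sum>\<phi>\<in>insert i J \<rightarrow>\<^sub>E V. F \<phi>) = (\<Sum>(x, \<phi>)\<in>V \<times> (J \<rightarrow>\<^sub>E V). F (\<phi>(i := x)))"
    using assms
    by (intro sum.reindex_bij_witness[of _ "\<lambda>(x, \<phi>). \<phi>(i := x)" "\<lambda>\<phi>. (\<phi> i, \<phi>(i := undefined))"])
       (auto simp: PiE_def extensional_def)
  also have "\<dots> = (\<Sum>x\<in>V. \<Sum>\<phi>\<in>J \<rightarrow>\<^sub>E V. F (\<phi>(i := x)))"
    by (simp add: sum.cartesian_product)
  finally show ?thesis by (simp add: sum.swap[of _ V])
qed

text \<open>Once all vertices other than \<open>a\<close> and \<open>b\<close> have been mapped,
  each remaining factor depends on the image of at most one of \<open>a\<close> and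
  \<open>b\<close>, since \<open>(a, b)\<close> itself is not in \<open>E\<close>. The product then
  splits into a function of x times a function of y, and the cut norm bound applies to each of the
  n^(|I| - 2) partial maps.\<close>

lemma swap_factor:
  fixes d :: "nat \<Rightarrow> nat \<Rightarrow> real" and M :: "nat \<times> nat \<Rightarrow> nat \<Rightarrow> nat \<Rightarrow> real"
  assumes V: "finite V" and I: "finite I"
    and c: "\<And>S T. S \<subseteq> V \<Longrightarrow> T \<subseteq> V \<Longrightarrow> \<bar>\<Sum>u\<in>S. \<Sum>v\<in>T. d u v\<bar> \<le> c * (real (card V))\<^sup>2"
    and E: "finite E" "E \<subseteq> {(u, v) \<in> I \<times> I. u < v}" "(a, b) \<notin> E" "a \<in> I" "b \<in> I" "a < b"
    and M: "\<And>p x y. p \<in> E \<Longrightarrow> x \<in> V \<Longrightarrow> y \<in> V \<Longrightarrow> M p x y \<in> {0..1}"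
  shows "\<bar>\<Sum>\<phi>\<in>I \<rightarrow>\<^sub>E V. d (\<phi> a) (\<phi> b) * (\<Prod>p\<in>E. M p (\<phi> (fst p)) (\<phi> (snd p)))\<bar> \<le> c * real (card V) ^ card I"
proof -
  define J where "J = I - {a, b}"
  have IJ: "I = insert a (insert b J)" "a \<notin> insert b J" "b \<notin> J"
    using E by (auto simp: J_def)
  have fJ: "finite J" using I by (simp add: J_def)
  \<comment> \<open>The factors touching \<open>a\<close> go to \<open>E1\<close>, all others to
    \<open>E2\<close>. No pair in \<open>E1\<close> touches \<open>b\<close>: pairs in
    \<open>E\<close> are increasing, so such a pair would be \<open>(a, b)\<close>.\<close>
  define E1 where "E1 = {p\<in>E. a = fst p \<or> a = snd p}"
  define E2 where "E2 = E - E1"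
  have E2: "b \<noteq> fst p" "b \<noteq> snd p" if "p \<in> E1" for p
    using that E unfolding E1_def by (cases p; force)+
  let ?X = "\<lambda>E \<phi>. \<Prod>p\<in>E. M p (\<phi> (fst p)) (\<phi> (snd p))"
  have X: "?X E' \<phi> \<in> {0..1}" if "\<phi> \<in> I \<rightarrow> V" "E' \<subseteq> E" for \<phi> E'
  proof -
    have "M p (\<phi> (fst p)) (\<phi> (snd p)) \<in> {0..1}" if "p \<in> E'" for p
      using M[of p "\<phi> (fst p)" "\<phi> (snd p)"] that E(2) \<open>E' \<subseteq> E\<close> \<open>\<phi> \<in> I \<rightarrow> V\<close> by fastforce
    then show ?thesis by (auto intro!: prod_nonneg prod_le_1)
  qed
  have "(\<Sum>\<phi>\<in>I \<rightarrow>\<^sub>E V. d (\<phi> a) (\<phi> b) * ?X E \<phi>) =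
      (\<Sum>\<phi>\<in>J \<rightarrow>\<^sub>E V. \<Sum>y\<in>V. \<Sum>x\<in>V. d x y * ?X E (\<phi>(b := y, a := x)))"
    unfolding IJ(1) sum_PiE_insert[OF IJ(2)] sum_PiE_insert[OF IJ(3)] using E by simp
  also have "\<dots> = (\<Sum>\<phi>\<in>J \<rightarrow>\<^sub>E V. \<Sum>x\<in>V. \<Sum>y\<in>V. d x y * (?X E1 (\<phi>(a := x)) * ?X E2 (\<phi>(b := y))))"
  proof (rule sum.cong[OF refl], subst sum.swap, intro sum.cong refl)
    fix \<phi> x y
    have "?X E (\<phi>(b := y, a := x)) = ?X E1 (\<phi>(b := y, a := x)) * ?X E2 (\<phi>(b := y, a := x))"
      using E(1) by (subst prod.union_disjoint[symmetric])
        (auto simp: E1_def E2_def intro!: prod.cong)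
    also have "?X E1 (\<phi>(b := y, a := x)) = ?X E1 (\<phi>(a := x))"
      using E2 by (intro prod.cong) (auto simp: fun_upd_def)
    also have "?X E2 (\<phi>(b := y, a := x)) = ?X E2 (\<phi>(b := y))"
      by (intro prod.cong) (auto simp: E1_def E2_def)
    finally show "d x y * ?X E (\<phi>(b := y, a := x)) = d x y * (?X E1 (\<phi>(a := x)) * ?X E2 (\<phi>(b := y)))"
      by (rule arg_cong)
  qed
  finally have "\<bar>\<Sum>\<phi>\<in>I \<rightarrow>\<^sub>E V. d (\<phi> a) (\<phi> b) * ?X E \<phi>\<bar> \<le>
      (\<Sum>\<phi>\<in>J \<rightarrow>\<^sub>E V. \<bar>\<Sum>x\<in>V. \<Sum>y\<in>V. d x y * (?X E1 (\<phi>(a := x)) * ?X E2 (\<phi>(b := y)))\<bar>)"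
    by (simp add: sum_abs)
  also have "\<dots> \<le> (\<Sum>\<phi>\<in>J \<rightarrow>\<^sub>E V. c * (real (card V))\<^sup>2)"
  proof (intro sum_mono bilinear_sum_bound[OF V c])
    fix \<phi> x assume \<phi>: "\<phi> \<in> J \<rightarrow>\<^sub>E V" and x: "x \<in> V"
    have "?X E1 (\<phi>(a := x)) = ?X E1 (\<phi>(b := x, a := x))"
      using E2 by (intro prod.cong) (auto simp: fun_upd_def)
    also have "\<dots> \<in> {0..1}"
      using \<phi> x IJ by (intro X) (auto simp: E1_def)
    finally show "?X E1 (\<phi>(a := x)) \<in> {0..1}" .
    have "?X E2 (\<phi>(b := x)) = ?X E2 (\<phi>(b := x, a := x))"
      by (intro prod.cong) (auto simp: E1_def E2_def)
    also have "\<dots> \<in> {0..1}"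
      using \<phi> x IJ by (intro X) (auto simp: E2_def)
    finally show "?X E2 (\<phi>(b := x)) \<in> {0..1}" .
  qed
  also have "\<dots> = c * real (card V) ^ card I"
    using fJ IJ by (simp add: card_PiE power2_eq_square)
  finally show ?thesis .
qed

text \<open>Telescoping: the pairs are switched from \<open>K\<close> to \<open>L\<close> one at a
  time, each switch costing c n^|I| by \<open>swap_factor\<close>. \<open>F\<close> collects the
  pairs already switched and hence has to vary in the induction. The kernels depend on the pair
  because edges and non-edges contribute different factors.\<close>

lemma counting_lemma_aux:
  fixes K L :: "nat \<times> nat \<Rightarrow> nat \<Rightarrow> nat \<Rightarrow> real"
  assumes V: "finite V" and I: "finite I"
    and E: "finite E" and F: "finite F" "E \<inter> F = {}"
    and EF: "E \<union> F \<subseteq> {(u, v) \<in> I \<times> I. u < v}"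
    and c: "\<And>p S T. p \<in> E \<Longrightarrow> S \<subseteq> V \<Longrightarrow> T \<subseteq> V \<Longrightarrow>
      \<bar>\<Sum>u\<in>S. \<Sum>v\<in>T. K p u v - L p u v\<bar> \<le> c * (real (card V))\<^sup>2"
    and K: "\<And>p x y. p \<in> E \<Longrightarrow> x \<in> V \<Longrightarrow> y \<in> V \<Longrightarrow> K p x y \<in> {0..1}"
    and L: "\<And>p x y. p \<in> E \<union> F \<Longrightarrow> x \<in> V \<Longrightarrow> y \<in> V \<Longrightarrow> L p x y \<in> {0..1}"
  shows "\<bar>\<Sum>\<phi>\<in>I \<rightarrow>\<^sub>E V. (\<Prod>p\<in>F. L p (\<phi> (fst p)) (\<phi> (snd p))) *
      ((\<Prod>p\<in>E. K p (\<phi> (fst p)) (\<phi> (snd p))) - (\<Prod>p\<in>E. L p (\<phi> (fst p)) (\<phi> (snd p))))\<bar>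
    \<le> real (card E) * c * real (card V) ^ card I"
  using E F EF c K L
proof (induction E arbitrary: F rule: finite_induct)
  case (insert p E)
  let ?X = "\<lambda>M E \<phi>. \<Prod>p\<in>E. M p (\<phi> (fst p)) (\<phi> (snd p))"
  obtain a b where p: "p = (a, b)" by (cases p)
  define M where "M q = (if q \<in> E then K q else L q)" for q
  have ab: "a \<in> I" "b \<in> I" "a < b" using insert.prems(3) p by auto
  have 1: "\<bar>\<Sum>\<phi>\<in>I \<rightarrow>\<^sub>E V. (K p (\<phi> a) (\<phi> b) - L p (\<phi> a) (\<phi> b)) * ?X M (E \<union> F) \<phi>\<bar> \<le> c * real (card V) ^ card I"
  proof (rule swap_factor[where d="\<lambda>x y. K p x y - L p x y", OF V I])
    show "\<bar>\<Sum>u\<in>S. \<Sum>v\<in>T. K p u v - L p u v\<bar> \<le> c * (real (card V))\<^sup>2" if "S \<subseteq> V" "T \<subseteq> V" for S T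
      using insert.prems(4)[of p] that by simp
    show "M q x y \<in> {0..1}" if "q \<in> E \<union> F" "x \<in> V" "y \<in> V" for q x y
      using that insert.prems(5)[of q x y] insert.prems(6)[of q x y] by (auto simp: M_def)
    show "E \<union> F \<subseteq> {(u, v) \<in> I \<times> I. u < v}" using insert.prems(3) by auto
    show "(a, b) \<notin> E \<union> F" using insert.prems(2) insert.hyps p by auto
  qed (use insert.hyps insert.prems ab in auto)
  have 2: "\<bar>\<Sum>\<phi>\<in>I \<rightarrow>\<^sub>E V. ?X L (insert p F) \<phi> * (?X K E \<phi> - ?X L E \<phi>)\<bar>
      \<le> real (card E) * c * real (card V) ^ card I"
    by (rule insert.IH) (use insert in auto)
  have M: "?X M (E \<union> F) \<phi> = ?X L F \<phi> * ?X K E \<phi>" for \<phi>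
  proof -
    have "?X M (E \<union> F) \<phi> = ?X M E \<phi> * ?X M F \<phi>"
      using insert by (intro prod.union_disjoint) auto
    also have "?X M E \<phi> = ?X K E \<phi>" by (intro prod.cong) (auto simp: M_def)
    also have "?X M F \<phi> = ?X L F \<phi>" using insert.prems(2) by (intro prod.cong) (auto simp: M_def)
    finally show ?thesis by simp
  qed
  have "?X L F \<phi> * (?X K (insert p E) \<phi> - ?X L (insert p E) \<phi>) =
      (K p (\<phi> a) (\<phi> b) - L p (\<phi> a) (\<phi> b)) * ?X M (E \<union> F) \<phi> +
      ?X L (insert p F) \<phi> * (?X K E \<phi> - ?X L E \<phi>)" for \<phi>
  proof -
    have "p \<notin> F" using insert.prems(2) by auto
    then show ?thesis
      unfolding M using insert.hyps insert.prems(1) by (simp add: p algebra_simps)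
  qed
  then have "(\<Sum>\<phi>\<in>I \<rightarrow>\<^sub>E V. ?X L F \<phi> * (?X K (insert p E) \<phi> - ?X L (insert p E) \<phi>)) =
     (\<Sum>\<phi>\<in>I \<rightarrow>\<^sub>E V. (K p (\<phi> a) (\<phi> b) - L p (\<phi> a) (\<phi> b)) * ?X M (E \<union> F) \<phi>) +
     (\<Sum>\<phi>\<in>I \<rightarrow>\<^sub>E V. ?X L (insert p F) \<phi> * (?X K E \<phi> - ?X L E \<phi>))"
    by (simp only: sum.distrib)
  then have "\<bar>\<Sum>\<phi>\<in>I \<rightarrow>\<^sub>E V. ?X L F \<phi> * (?X K (insert p E) \<phi> - ?X L (insert p E) \<phi>)\<bar> \<le>
      c * real (card V) ^ card I + real (card E) * c * real (card V) ^ card I"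
    using 1 2 by linarith
  then show ?case using insert.hyps by (simp add: algebra_simps)
qed simp

text \<open>Induced density over all maps instead of injections, with edge weights \<open>A\<close>.
  Independence of the images is what makes it computable from block data.\<close>

definition hom_density :: "nat set \<Rightarrow> (nat \<times> nat) set \<Rightarrow> (nat \<times> nat) set \<Rightarrow> nat set \<Rightarrow> (nat \<Rightarrow> nat \<Rightarrow> real) \<Rightarrow> real" where
  "hom_density I P E V A =
     (\<Sum>\<phi>\<in>I \<rightarrow>\<^sub>E V. bern P E (\<lambda>(u, v). A (\<phi> u) (\<phi> v))) / real (card V) ^ card I"

lemma counting_lemma:
  assumes V: "finite V" "V \<noteq> {}" and I: "finite I"
    and P: "P \<subseteq> {(u, v) \<in> I \<times> I. u < v}" and E: "E \<subseteq> P"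
    and c: "\<And>S T. S \<subseteq> V \<Longrightarrow> T \<subseteq> V \<Longrightarrow>
      \<bar>\<Sum>u\<in>S. \<Sum>v\<in>T. A u v - B u v\<bar> \<le> c * (real (card V))\<^sup>2"
    and A: "\<And>u v. u \<in> V \<Longrightarrow> v \<in> V \<Longrightarrow> A u v \<in> {0..1}"
    and B: "\<And>u v. u \<in> V \<Longrightarrow> v \<in> V \<Longrightarrow> B u v \<in> {0..1}"
  shows "\<bar>hom_density I P E V A - hom_density I P E V B\<bar> \<le> real (card P) * c"
proof -
  \<comment> \<open>A non-edge contributes the factor \<open>1 - M\<close>. Complementing only
    changes the sign of the difference of the two kernels, so the cut norm bound \<open>c\<close>
    persists.\<close>
  define K where "K M p = (if p \<in> E then M else (\<lambda>u v. 1 - M u v))"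
    for M :: "nat \<Rightarrow> nat \<Rightarrow> real" and p :: "nat \<times> nat"
  have fP: "finite P" by (rule finite_subset[OF P]) (use I in \<open>auto intro: finite_subset[of _ "I \<times> I"]\<close>)
  have K: "bern P E (\<lambda>(u, v). M (\<phi> u) (\<phi> v)) = (\<Prod>p\<in>P. K M p (\<phi> (fst p)) (\<phi> (snd p)))" for M \<phi>
  proof -
    have "(\<Prod>p\<in>P. K M p (\<phi> (fst p)) (\<phi> (snd p))) =
      (\<Prod>p\<in>P - E. K M p (\<phi> (fst p)) (\<phi> (snd p))) * (\<Prod>p\<in>E. K M p (\<phi> (fst p)) (\<phi> (snd p)))"
      using E fP by (rule prod.subset_diff)
    also have "\<dots> = (\<Prod>p\<in>P - E. 1 - M (\<phi> (fst p)) (\<phi> (snd p))) * (\<Prod>p\<in>E. M (\<phi> (fst p)) (\<phi> (snd p)))"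
      by (intro arg_cong2[of _ _ _ _ "(*)"] prod.cong) (auto simp: K_def)
    finally show ?thesis by (simp add: bern_def case_prod_unfold mult.commute)
  qed
  have "\<bar>\<Sum>\<phi>\<in>I \<rightarrow>\<^sub>E V. (\<Prod>p\<in>{}. K B p (\<phi> (fst p)) (\<phi> (snd p))) *
      ((\<Prod>p\<in>P. K A p (\<phi> (fst p)) (\<phi> (snd p))) - (\<Prod>p\<in>P. K B p (\<phi> (fst p)) (\<phi> (snd p))))\<bar>
    \<le> real (card P) * c * real (card V) ^ card I"
  proof (rule counting_lemma_aux[OF V(1) I fP])
    show "\<bar>\<Sum>u\<in>S. \<Sum>v\<in>T. K A p u v - K B p u v\<bar> \<le> c * (real (card V))\<^sup>2"
      if "S \<subseteq> V" "T \<subseteq> V" for p S T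
    proof -
      have "(\<Sum>u\<in>S. \<Sum>v\<in>T. K A p u v - K B p u v) =
         (if p \<in> E then 1 else -1) * (\<Sum>u\<in>S. \<Sum>v\<in>T. A u v - B u v)"
        by (auto simp: K_def sum_subtractf)
      then show ?thesis using c[OF that] by auto
    qed
    show "K A p x y \<in> {0..1}" if "x \<in> V" "y \<in> V" for p x y
      using A[OF that] by (auto simp: K_def)
    show "K B p x y \<in> {0..1}" if "x \<in> V" "y \<in> V" for p x y
      using B[OF that] by (auto simp: K_def)
  qed (use P in auto)
  then have *: "\<bar>\<Sum>\<phi>\<in>I \<rightarrow>\<^sub>E V. bern P E (\<lambda>(u, v). A (\<phi> u) (\<phi> v)) - bern P E (\<lambda>(u, v). B (\<phi> u) (\<phi> v))\<bar>
     \<le> real (card P) * c * real (card V) ^ card I"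
    unfolding K by simp
  have "hom_density I P E V A - hom_density I P E V B =
    (\<Sum>\<phi>\<in>I \<rightarrow>\<^sub>E V. bern P E (\<lambda>(u, v). A (\<phi> u) (\<phi> v)) - bern P E (\<lambda>(u, v). B (\<phi> u) (\<phi> v))) / real (card V) ^ card I"
    by (simp add: hom_density_def sum_subtractf diff_divide_distrib)
  moreover have "real (card V) ^ card I > 0" using V by (simp add: card_gt_0_iff)
  ultimately show ?thesis using * by (simp add: abs_divide pos_divide_le_eq)
qed

text \<open>Under a uniformly random map the part indices of the images are independent with law
  \<open>wt V f\<close>; a function of the indices alone is thus averaged with product
  weights.\<close>

lemma sum_PiE_codes:
  fixes f :: "nat \<Rightarrow> nat" and g :: "(nat \<Rightarrow> nat) \<Rightarrow> real"
  assumes V: "finite V" "V \<noteq> {}" and I: "finite I" and f: "f ` V \<subseteq> {..<N}"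
  shows "(\<Sum>\<phi>\<in>I \<rightarrow>\<^sub>E V. g (\<lambda>u\<in>I. f (\<phi> u))) / real (card V) ^ card I =
    (\<Sum>\<psi>\<in>I \<rightarrow>\<^sub>E {..<N}. (\<Prod>u\<in>I. wt V f (\<psi> u)) * g \<psi>)"
proof -
  have n: "real (card V) \<noteq> 0" using V by simp
  have *: "g (\<lambda>u\<in>I. f (\<phi> u)) = (\<Sum>\<psi>\<in>I \<rightarrow>\<^sub>E {..<N}. (\<Prod>u\<in>I. of_bool (f (\<phi> u) = \<psi> u)) * g \<psi>)"
    if \<phi>: "\<phi> \<in> I \<rightarrow>\<^sub>E V" for \<phi>
  proof -
    have "(\<Sum>\<psi>\<in>I \<rightarrow>\<^sub>E {..<N}. (\<Prod>u\<in>I. of_bool (f (\<phi> u) = \<psi> u)) * g \<psi>) =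
        (\<Sum>\<psi>\<in>I \<rightarrow>\<^sub>E {..<N}. if \<psi> = (\<lambda>u\<in>I. f (\<phi> u)) then g \<psi> else 0)"
    proof (intro sum.cong refl)
      fix \<psi> assume \<psi>: "\<psi> \<in> I \<rightarrow>\<^sub>E {..<N}"
      have "(\<Prod>u\<in>I. of_bool (f (\<phi> u) = \<psi> u)) = (of_bool (\<forall>u\<in>I. f (\<phi> u) = \<psi> u) :: real)"
        using I by (auto simp: of_bool_def)
      moreover have "(\<forall>u\<in>I. f (\<phi> u) = \<psi> u) \<longleftrightarrow> \<psi> = (\<lambda>u\<in>I. f (\<phi> u))"
        using \<psi> by (auto simp: fun_eq_iff PiE_def extensional_def restrict_def)
      ultimately show "(\<Prod>u\<in>I. of_bool (f (\<phi> u) = \<psi> u)) * g \<psi> = (if \<psi> = (\<lambda>u\<in>I. f (\<phi> u)) then g \<psi> else 0)"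
        by simp
    qed
    moreover have "(\<lambda>u\<in>I. f (\<phi> u)) \<in> I \<rightarrow>\<^sub>E {..<N}" using \<phi> f by auto
    ultimately show ?thesis using I by (simp add: finite_PiE)
  qed
  have "(\<Sum>\<phi>\<in>I \<rightarrow>\<^sub>E V. g (\<lambda>u\<in>I. f (\<phi> u))) =
      (\<Sum>\<phi>\<in>I \<rightarrow>\<^sub>E V. \<Sum>\<psi>\<in>I \<rightarrow>\<^sub>E {..<N}. (\<Prod>u\<in>I. of_bool (f (\<phi> u) = \<psi> u)) * g \<psi>)"
    by (intro sum.cong refl *)
  also have "\<dots> = (\<Sum>\<psi>\<in>I \<rightarrow>\<^sub>E {..<N}. (\<Sum>\<phi>\<in>I \<rightarrow>\<^sub>E V. \<Prod>u\<in>I. of_bool (f (\<phi> u) = \<psi> u)) * g \<psi>)"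
    by (subst sum.swap) (simp add: sum_distrib_right)
  also have "\<dots> = (\<Sum>\<psi>\<in>I \<rightarrow>\<^sub>E {..<N}. (\<Prod>u\<in>I. \<Sum>x\<in>V. of_bool (f x = \<psi> u)) * g \<psi>)"
    using prod_sum_PiE[where A=I and B="\<lambda>_. V" and f="\<lambda>u x. of_bool (f x = _ u) :: real"] I V(1) by simp
  also have "\<dots> = (\<Sum>\<psi>\<in>I \<rightarrow>\<^sub>E {..<N}. (\<Prod>u\<in>I. real (card V) * wt V f (\<psi> u)) * g \<psi>)"
    using n wt_altdef[OF V(1), of f] by (intro sum.cong refl arg_cong2[of _ _ _ _ "(*)"] prod.cong) (simp del: sum_of_bool_eq)
  also have "\<dots> = real (card V) ^ card I * (\<Sum>\<psi>\<in>I \<rightarrow>\<^sub>E {..<N}. (\<Prod>u\<in>I. wt V f (\<psi> u)) * g \<psi>)"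
    by (simp add: prod.distrib sum_distrib_left mult.assoc)
  finally show ?thesis using n by simp
qed

section \<open>Counting labelled graphs with given block data\<close>

definition adj :: "sgraph \<Rightarrow> nat \<Rightarrow> nat \<Rightarrow> real" where
  "adj G u v = of_bool ({u, v} \<in> edges G)"

definition pairs :: "nat set \<Rightarrow> (nat \<times> nat) set" where
  "pairs I = {(u, v) \<in> I \<times> I. u < v}"

definition epairs :: "sgraph \<Rightarrow> (nat \<times> nat) set" where
  "epairs H = {(u, v) \<in> pairs (verts H). {u, v} \<in> edges H}"

lemma finite_pairs: "finite I \<Longrightarrow> finite (pairs I)"
  unfolding pairs_def by (rule finite_subset[of _ "I \<times> I"]) auto

lemma card_pairs_le: "finite I \<Longrightarrow> card (pairs I) \<le> (card I)\<^sup>2"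
  using card_mono[of "I \<times> I" "pairs I"] by (auto simp: pairs_def power2_eq_square card_cartesian_product)

lemma epairs_subset: "epairs H \<subseteq> pairs (verts H)"
  by (auto simp: epairs_def)

lemma adj_01: "adj G u v \<in> {0..1}"
  by (simp add: adj_def)

lemma adj_sym: "adj G u v = adj G v u"
  by (simp add: adj_def insert_commute)

lemma bern_of_bool:
  assumes "finite P" "E \<subseteq> P"
  shows "bern P E (\<lambda>p. of_bool (Q p)) = of_bool (\<forall>p\<in>P. Q p \<longleftrightarrow> p \<in> E)"
proof -
  have fin: "finite E" "finite (P - E)" using assms finite_subset by auto
  have "(\<Prod>p\<in>E. of_bool (Q p)) = (of_bool (\<forall>p\<in>E. Q p) :: real)"
    using fin by (auto simp: of_bool_def)
  moreover have "(\<Prod>p\<in>P - E. 1 - of_bool (Q p)) = (of_bool (\<forall>p\<in>P - E. \<not> Q p) :: real)"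
    using fin by (auto simp: of_bool_def)
  ultimately show ?thesis using assms(2) by (auto simp: bern_def)
qed

section \<open>Densities over injections and over all maps\<close>

lemma card_PiE_eq_at:
  assumes "finite I" "finite V" "u \<in> I" "v \<in> I" "u \<noteq> v"
  shows "card {\<phi> \<in> I \<rightarrow>\<^sub>E V. \<phi> u = \<phi> v} * card V = card V ^ card I"
proof -
  define J where "J = I - {u}"
  have J: "I = insert u J" "u \<notin> J" "v \<in> J" "finite J" using assms by (auto simp: J_def)
  have "card {\<phi> \<in> I \<rightarrow>\<^sub>E V. \<phi> u = \<phi> v} = (\<Sum>\<phi>\<in>I \<rightarrow>\<^sub>E V. of_bool (\<phi> u = \<phi> v))"
    using assms by (simp add: finite_PiE Int_def)
  also have "\<dots> = (\<Sum>\<phi>\<in>J \<rightarrow>\<^sub>E V. \<Sum>x\<in>V. of_bool (x = \<phi> v))"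
    unfolding J(1) sum_PiE_insert[OF J(2)] using assms(5) by simp
  also have "\<dots> = (\<Sum>\<phi>\<in>J \<rightarrow>\<^sub>E V. 1)"
  proof (intro sum.cong refl)
    fix \<phi> assume "\<phi> \<in> J \<rightarrow>\<^sub>E V"
    then have "V \<inter> {x. x = \<phi> v} = {\<phi> v}" using J by auto
    then show "(\<Sum>x\<in>V. of_bool (x = \<phi> v)) = (1::nat)" using assms(2) by simp
  qed
  also have "\<dots> = card V ^ card J" using J by (simp add: card_PiE)
  finally show ?thesis using J by simp
qed

text \<open>Union bound: for each of the at most k^2 pairs of vertices of \<open>H\<close>, a
  proportion 1/n of all maps identifies the two vertices.\<close>

lemma card_injections:
  assumes H: "simple_graph H" and G: "simple_graph G"
  shows "real (card (injections H G)) \<ge> (1 - (real (card (verts H)))\<^sup>2 / card (verts G)) * real (card (verts G)) ^ card (verts H)"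
    and "card (injections H G) \<le> card (verts G) ^ card (verts H)"
proof -
  let ?I = "verts H" and ?V = "verts G"
  let ?n = "card ?V" and ?k = "card ?I"
  have fin: "finite ?I" "finite ?V" "?V \<noteq> {}" using H G by (auto simp: simple_graph_def)
  then have n: "?n > 0" by (simp add: card_gt_0_iff)
  have PiE: "finite (?I \<rightarrow>\<^sub>E ?V)" "card (?I \<rightarrow>\<^sub>E ?V) = ?n ^ ?k"
    using fin by (auto simp: finite_PiE card_PiE)
  have inj: "injections H G \<subseteq> ?I \<rightarrow>\<^sub>E ?V" by (auto simp: injections_def)
  show "card (injections H G) \<le> ?n ^ ?k"
    using card_mono[OF PiE(1) inj] PiE(2) by simp
  let ?B = "\<lambda>(u, v). {\<phi> \<in> ?I \<rightarrow>\<^sub>E ?V. \<phi> u = \<phi> v}"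
  have sub: "(?I \<rightarrow>\<^sub>E ?V) \<subseteq> injections H G \<union> (\<Union>p\<in>pairs ?I. ?B p)"
  proof
    fix \<phi> assume \<phi>: "\<phi> \<in> ?I \<rightarrow>\<^sub>E ?V"
    show "\<phi> \<in> injections H G \<union> (\<Union>p\<in>pairs ?I. ?B p)"
    proof (cases "inj_on \<phi> ?I")
      case False
      then obtain u v where "u \<in> ?I" "v \<in> ?I" "\<phi> u = \<phi> v" "u \<noteq> v" by (auto simp: inj_on_def)
      then have "\<exists>u\<in>?I. \<exists>v\<in>?I. u < v \<and> \<phi> u = \<phi> v" by (metis linorder_neqE_nat)
      then show ?thesis using \<phi> by (auto simp: pairs_def)
    qed (use \<phi> in \<open>simp add: injections_def\<close>)
  qed
  have finU: "finite (injections H G \<union> (\<Union>p\<in>pairs ?I. ?B p))"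
    by (rule finite_subset[OF _ PiE(1)]) (use inj in auto)
  have "?n ^ ?k \<le> card (injections H G \<union> (\<Union>p\<in>pairs ?I. ?B p))"
    using card_mono[OF finU sub] PiE(2) by simp
  also have "\<dots> \<le> card (injections H G) + card (\<Union>p\<in>pairs ?I. ?B p)" by (rule card_Un_le)
  also have "card (\<Union>p\<in>pairs ?I. ?B p) \<le> (\<Sum>p\<in>pairs ?I. card (?B p))"
    by (rule card_UN_le[OF finite_pairs[OF fin(1)]])
  finally have "?n ^ ?k * ?n \<le> (card (injections H G) + (\<Sum>p\<in>pairs ?I. card (?B p))) * ?n"
    by simp
  also have "\<dots> = card (injections H G) * ?n + (\<Sum>p\<in>pairs ?I. card (?B p) * ?n)"
    by (simp only: sum_distrib_right distrib_right)
  also have "(\<Sum>p\<in>pairs ?I. card (?B p) * ?n) = (\<Sum>p\<in>pairs ?I. ?n ^ ?k)"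
    using card_PiE_eq_at[OF fin(1,2)] by (intro sum.cong) (auto simp: pairs_def)
  also have "\<dots> \<le> ?k\<^sup>2 * ?n ^ ?k" using card_pairs_le[OF fin(1)] by simp
  finally have "?n ^ ?k * ?n \<le> card (injections H G) * ?n + ?k\<^sup>2 * ?n ^ ?k" by simp
  then have "real (?n ^ ?k * ?n) \<le> real (card (injections H G) * ?n + ?k\<^sup>2 * ?n ^ ?k)"
    by (simp only: of_nat_le_iff)
  then show "real (card (injections H G)) \<ge> (1 - (real ?k)\<^sup>2 / ?n) * real ?n ^ ?k"
    using n by (simp add: field_simps)
qed

text \<open>With j injections among N maps, and S injections that are induced embeddings, both
  densities lie between S/N and S/N + (1 - j/N): one changes the normalisation from j to N, the
  other adds at most N - j maps. The bound on the number of injections finishes the proof.\<close>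

lemma graph_density_hom_density:
  assumes H: "simple_graph H" and G: "simple_graph G" and le: "card (verts H) \<le> card (verts G)"
  shows "\<bar>graph_density H G - hom_density (verts H) (pairs (verts H)) (epairs H) (verts G) (adj G)\<bar>
    \<le> (real (card (verts H)))\<^sup>2 / card (verts G)"
proof -
  let ?I = "verts H" and ?V = "verts G"
  let ?n = "card ?V" and ?k = "card ?I"
  let ?J = "injections H G"
  let ?X = "\<lambda>\<phi>. bern (pairs ?I) (epairs H) (\<lambda>(u, v). adj G (\<phi> u) (\<phi> v))"
  have fin: "finite ?I" "finite ?V" "?V \<noteq> {}" using H G by (auto simp: simple_graph_def)
  then have n: "?n > 0" by (simp add: card_gt_0_iff)
  have PiE: "finite (?I \<rightarrow>\<^sub>E ?V)" "card (?I \<rightarrow>\<^sub>E ?V) = ?n ^ ?k"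
    using fin by (auto simp: finite_PiE card_PiE)
  have inj: "?J \<subseteq> ?I \<rightarrow>\<^sub>E ?V" by (auto simp: injections_def)
  then have fJ: "finite ?J" using PiE finite_subset by blast
  have neJ: "?J \<noteq> {}"
  proof -
    obtain h where h: "h ` ?I \<subseteq> ?V" "inj_on h ?I"
      using card_le_inj[OF fin(1) fin(2) le] by blast
    then have "restrict h ?I \<in> ?J" by (auto simp: injections_def inj_on_def)
    then show ?thesis by blast
  qed
  let ?good = "\<lambda>\<phi>. \<forall>u\<in>?I. \<forall>v\<in>?I. u \<noteq> v \<longrightarrow> ({u, v} \<in> edges H \<longleftrightarrow> {\<phi> u, \<phi> v} \<in> edges G)"
  have X: "?X \<phi> = of_bool (?good \<phi>)" for \<phi>
  proof -
    have "?X \<phi> = bern (pairs ?I) (epairs H) (\<lambda>p. of_bool ({\<phi> (fst p), \<phi> (snd p)} \<in> edges G))"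
      by (intro bern_cong epairs_subset) (auto simp: adj_def)
    also have "\<dots> = of_bool (\<forall>p\<in>pairs ?I. {\<phi> (fst p), \<phi> (snd p)} \<in> edges G \<longleftrightarrow> p \<in> epairs H)"
      by (rule bern_of_bool[OF finite_pairs[OF fin(1)] epairs_subset])
    also have "(\<forall>p\<in>pairs ?I. {\<phi> (fst p), \<phi> (snd p)} \<in> edges G \<longleftrightarrow> p \<in> epairs H) \<longleftrightarrow>
        (\<forall>u\<in>?I. \<forall>v\<in>?I. u < v \<longrightarrow> ({u, v} \<in> edges H \<longleftrightarrow> {\<phi> u, \<phi> v} \<in> edges G))"
      by (auto simp: pairs_def epairs_def)
    also have "\<dots> \<longleftrightarrow> ?good \<phi>"
    proof (rule iffI, intro ballI impI)
      fix u v
      assume *: "\<forall>u\<in>?I. \<forall>v\<in>?I. u < v \<longrightarrow> ({u, v} \<in> edges H \<longleftrightarrow> {\<phi> u, \<phi> v} \<in> edges G)"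
        and uv: "u \<in> ?I" "v \<in> ?I" "u \<noteq> v"
      consider "u < v" | "v < u" using uv(3) by linarith
      then show "{u, v} \<in> edges H \<longleftrightarrow> {\<phi> u, \<phi> v} \<in> edges G"
        using *[rule_format, of u v] *[rule_format, of v u] uv
        by cases (simp_all add: insert_commute)
    qed auto
    finally show ?thesis .
  qed
  have "graph_density H G = real (card (?J \<inter> {\<phi>. ?good \<phi>})) / real (card ?J)"
    unfolding graph_density_def using fJ neJ by (rule measure_pmf_of_set[rotated])
  also have "real (card (?J \<inter> {\<phi>. ?good \<phi>})) = (\<Sum>\<phi>\<in>?J. ?X \<phi>)"
    unfolding X using fJ by simp
  finally have gd: "graph_density H G = (\<Sum>\<phi>\<in>?J. ?X \<phi>) / real (card ?J)" .
  define S where "S = (\<Sum>\<phi>\<in>?J. ?X \<phi>)"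
  define j where "j = real (card ?J)"
  define N where "N = real ?n ^ ?k"
  define T where "T = (\<Sum>\<phi>\<in>?I \<rightarrow>\<^sub>E ?V. ?X \<phi>)"
  have hd: "hom_density ?I (pairs ?I) (epairs H) ?V (adj G) = T / N"
    by (simp add: hom_density_def T_def N_def)
  have "T = S + (\<Sum>\<phi>\<in>(?I \<rightarrow>\<^sub>E ?V) - ?J. ?X \<phi>)"
    unfolding T_def S_def using sum.subset_diff[OF inj PiE(1), of ?X] by simp
  moreover have "(\<Sum>\<phi>\<in>(?I \<rightarrow>\<^sub>E ?V) - ?J. ?X \<phi>) \<le> (\<Sum>\<phi>\<in>(?I \<rightarrow>\<^sub>E ?V) - ?J. 1)"
    unfolding X by (intro sum_mono) auto
  moreover have "(\<Sum>\<phi>\<in>(?I \<rightarrow>\<^sub>E ?V) - ?J. 1) = N - j"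
    using card_Diff_subset[OF fJ inj] PiE card_mono[OF PiE(1) inj] by (simp add: N_def j_def)
  moreover have "0 \<le> (\<Sum>\<phi>\<in>(?I \<rightarrow>\<^sub>E ?V) - ?J. ?X \<phi>)"
    unfolding X by (intro sum_nonneg) auto
  ultimately have T: "S \<le> T" "T \<le> S + (N - j)" by auto
  have S: "0 \<le> S" "S \<le> j"
    unfolding S_def j_def X using fJ by (auto intro!: card_mono)
  have N: "N > 0" using n by (simp add: N_def)
  have j: "j > 0" using fJ neJ by (simp add: j_def card_gt_0_iff)
  have jN: "j \<le> N" using card_injections(2)[OF H G] by (simp add: j_def N_def flip: of_nat_power)
  have "(1 - (real ?k)\<^sup>2 / ?n) * N \<le> j"
    using card_injections(1)[OF H G] by (simp add: j_def N_def)
  then have e: "1 - j / N \<le> (real ?k)\<^sup>2 / ?n" using N by (simp add: field_simps)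
  have 1: "S / N \<le> S / j" using S j jN N by (intro divide_left_mono) auto
  have 2: "S / j \<le> S / N + (1 - j / N)"
  proof -
    have "S / j - S / N = (S / j) * (1 - j / N)" using j N by (simp add: field_simps)
    also have "\<dots> \<le> 1 * (1 - j / N)" using S j jN N by (intro mult_right_mono) auto
    finally show ?thesis by simp
  qed
  have 3: "S / N \<le> T / N" "T / N \<le> S / N + (1 - j / N)"
    using T N by (auto simp: divide_right_mono field_simps)
  show ?thesis unfolding gd hd S_def[symmetric] j_def[symmetric]
    using 1 2 3 e by linarith
qed

section \<open>Labelled graphs with equal block masses\<close>

lemma mass_sym:
  assumes "\<And>u v. A u v = A v u"
  shows "mass V A f i j = mass V A f j i"
proof -
  have "(\<Sum>u\<in>V. \<Sum>v\<in>V. A u v * (of_bool (f u = i) * of_bool (f v = j))) =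
      (\<Sum>v\<in>V. \<Sum>u\<in>V. A u v * (of_bool (f u = i) * of_bool (f v = j)))"
    by (rule sum.swap)
  also have "\<dots> = (\<Sum>v\<in>V. \<Sum>u\<in>V. A v u * (of_bool (f v = j) * of_bool (f u = i)))"
    using assms by (intro sum.cong refl) (metis mult.commute)
  finally show ?thesis by (simp add: mass_def)
qed

lemma dens_sym: "(\<And>u v. A u v = A v u) \<Longrightarrow> dens V A f i j = dens V A f j i"
  using mass_sym[of A V f i j] by (simp add: dens_def mult.commute)

text \<open>Applied to the adjacency function and to its complement, this keeps a block density away
  from 0 where an edge is present and away from 1 where one is absent; every graph counted below
  then has positive probability.\<close>

lemma mass_pos:
  assumes V: "finite V" and A: "\<And>u v. u \<in> V \<Longrightarrow> v \<in> V \<Longrightarrow> A u v \<in> {0..1}"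
    and uv: "u \<in> V" "v \<in> V" "A u v > 0"
  shows "mass V A f (f u) (f v) > 0"
proof -
  let ?t = "\<lambda>x y. A x y * (of_bool (f x = f u) * of_bool (f y = f v))"
  have "0 < ?t u v" using uv by simp
  also have "\<dots> \<le> (\<Sum>y\<in>V. ?t u y)"
    using V uv A by (intro member_le_sum[of v V "?t u"]) auto
  also have "\<dots> \<le> (\<Sum>x\<in>V. \<Sum>y\<in>V. ?t x y)"
    using V uv A by (intro member_le_sum[of u V "\<lambda>x. \<Sum>y\<in>V. ?t x y"] sum_nonneg) auto
  finally have "0 < (\<Sum>x\<in>V. \<Sum>y\<in>V. ?t x y)" .
  moreover have "real (card V) > 0" using V uv by (auto simp: card_gt_0_iff)
  ultimately show ?thesis unfolding mass_def by (intro divide_pos_pos) auto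
qed

lemma mass_compl:
  assumes "finite V"
  shows "mass V (\<lambda>u v. 1 - A u v) f i j = wt V f i * wt V f j - mass V A f i j"
  unfolding mass_one[OF assms, symmetric]
  by (simp add: mass_def left_diff_distrib sum_subtractf diff_divide_distrib)

definition block_entropy :: "nat set \<Rightarrow> (nat \<Rightarrow> nat \<Rightarrow> real) \<Rightarrow> (nat \<Rightarrow> nat) \<Rightarrow> nat \<Rightarrow> real" where
  "block_entropy V A f N =
     (\<Sum>i<N. \<Sum>j<N. wt V f i * wt V f j * binary_entropy (dens V A f i j))"

lemma sum_pairs_sym:
  assumes V: "finite V" and L: "\<And>u v. u \<in> V \<Longrightarrow> v \<in> V \<Longrightarrow> L u v = L v u"
  shows "(\<Sum>u\<in>V. \<Sum>v\<in>V. L u v) = 2 * (\<Sum>(u, v)\<in>pairs V. L u v) + (\<Sum>u\<in>V. L u u :: real)"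
proof -
  let ?gt = "(\<lambda>(u, v). (v, u)) ` pairs V" and ?d = "(\<lambda>u. (u, u)) ` V"
  have fp: "finite (pairs V)" using V by (rule finite_pairs)
  have "V \<times> V = pairs V \<union> ?gt \<union> ?d"
    by (auto simp: pairs_def image_iff)
  then have "(\<Sum>u\<in>V. \<Sum>v\<in>V. L u v) = (\<Sum>(u, v)\<in>pairs V \<union> ?gt \<union> ?d. L u v)"
    by (simp add: sum.cartesian_product)
  also have "\<dots> = (\<Sum>(u, v)\<in>pairs V. L u v) + (\<Sum>(u, v)\<in>?gt. L u v) + (\<Sum>(u, v)\<in>?d. L u v)"
    using V fp by (subst sum.union_disjoint; (subst sum.union_disjoint)?) (auto simp: pairs_def)
  also have "(\<Sum>(u, v)\<in>?gt. L u v) = (\<Sum>(u, v)\<in>pairs V. L v u)"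
    by (subst sum.reindex) (auto simp: inj_on_def case_prod_unfold)
  also have "\<dots> = (\<Sum>(u, v)\<in>pairs V. L u v)"
    using L by (intro sum.cong) (auto simp: pairs_def)
  also have "(\<Sum>(u, v)\<in>?d. L u v) = (\<Sum>u\<in>V. L u u)"
    by (subst sum.reindex) (auto simp: inj_on_def)
  finally show ?thesis by simp
qed

lemma labelled_graph_eqI:
  assumes "G \<in> labelled_graphs n" "G' \<in> labelled_graphs n" "epairs G = epairs G'"
  shows "G = G'"
proof -
  have "edges G \<subseteq> edges G'" if "G \<in> labelled_graphs n" "G' \<in> labelled_graphs n" "epairs G = epairs G'" for G G'
  proof
    fix e assume e: "e \<in> edges G"
    then have "e \<subseteq> verts G" "card e = 2" using that by (auto simp: labelled_graphs_def simple_graph_def)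
    then obtain u v where uv: "e = {u, v}" "u < v" "u \<in> verts G" "v \<in> verts G"
      by (metis card_2_iff insert_commute insert_subset linorder_neqE_nat)
    then have "(u, v) \<in> epairs G" using e by (simp add: epairs_def pairs_def)
    then have "(u, v) \<in> epairs G'" using that by simp
    then show "e \<in> edges G'" using uv by (simp add: epairs_def)
  qed
  then have "edges G = edges G'" using assms by blast
  moreover have "verts G = verts G'" using assms by (simp add: labelled_graphs_def)
  ultimately show ?thesis by (simp add: sgraph.expand)
qed

text \<open>All the graphs counted here are equally likely, up to the contribution of the diagonal,
  under the random graph whose edge probabilities are the block densities.\<close>

lemma card_equal_masses:
  assumes G: "G \<in> labelled_graphs n" and sub: "\<G> \<subseteq> labelled_graphs n"
    and f: "f ` {1..n} \<subseteq> {..<N}"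
    and mass: "\<And>G' i j. G' \<in> \<G> \<Longrightarrow> i < N \<Longrightarrow> j < N \<Longrightarrow> mass {1..n} (adj G') f i j = mass {1..n} (adj G) f i j"
  shows "real (card \<G>) \<le> 2 powr ((real n)\<^sup>2 / 2 * block_entropy {1..n} (adj G) f N)"
proof -
  let ?V = "{1..n}"
  have V: "finite ?V" by simp
  let ?D = "dens ?V (adj G) f" and ?P = "pairs ?V"
  let ?a = "\<lambda>(u, v). ?D (f u) (f v)"
  have D: "?D i j \<in> {0..1}" for i j
    using V adj_01 by (rule dens_bounds)
  have D_sym: "?D i j = ?D j i" for i j using adj_sym by (rule dens_sym)
  have fP: "finite ?P" by (simp add: finite_pairs)
  \<comment> \<open>Each graph of the family will be shown to have probability at least
    \<open>q\<close>. As the probabilities sum to at most 1, there are at most 1/q of them.\<close>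
  define q where "q = 2 powr (- ((real n)\<^sup>2 / 2 * block_entropy ?V (adj G) f N))"
  have bern_ge: "q \<le> bern ?P (epairs G') ?a" if G': "G' \<in> \<G>" for G'
  proof -
    have fN: "f u < N" if "u \<in> ?V" for u using f that by blast
    have v: "verts G' = ?V" using G' sub by (auto simp: labelled_graphs_def)
    have sg: "simple_graph G'" using G' sub by (auto simp: labelled_graphs_def)
    have EP: "epairs G' \<subseteq> ?P" using epairs_subset[of G'] v by simp
    have pos: "0 < ?D (f u) (f v)" if "u \<in> ?V" "v \<in> ?V" "{u, v} \<in> edges G'" for u v
    proof -
      have "0 < mass ?V (adj G') f (f u) (f v)"
        using V adj_01 that by (intro mass_pos) (auto simp: adj_def)
      then have "0 < mass ?V (adj G) f (f u) (f v)"
        using mass[OF G' fN fN] that by simp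
      then have "0 < wt ?V f (f u) * wt ?V f (f v) * ?D (f u) (f v)"
        using dens_mult[where A="adj G" and V="?V" and f=f and i="f u" and j="f v", OF V adj_01] by simp
      then show ?thesis using wt_bounds[OF V, of f] D[of "f u" "f v"]
        by (metis atLeastAtMost_iff mult_eq_0_iff order_less_le)
    qed
    have lt1: "?D (f u) (f v) < 1" if "u \<in> ?V" "v \<in> ?V" "{u, v} \<notin> edges G'" for u v
    proof -
      have "0 < mass ?V (\<lambda>u v. 1 - adj G' u v) f (f u) (f v)"
        using V that by (intro mass_pos) (auto simp: adj_def)
      then have "mass ?V (adj G) f (f u) (f v) < wt ?V f (f u) * wt ?V f (f v)"
        using mass[OF G' fN fN] that by (simp add: mass_compl)
      then have "wt ?V f (f u) * wt ?V f (f v) * ?D (f u) (f v) < wt ?V f (f u) * wt ?V f (f v)"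
        using dens_mult[where A="adj G" and V="?V" and f=f and i="f u" and j="f v", OF V adj_01] by simp
      then show ?thesis using D[of "f u" "f v"]
        by (metis atLeastAtMost_iff mult.right_neutral order_less_le)
    qed
    define L where "L u v = adj G' u v * log 2 (?D (f u) (f v)) + (1 - adj G' u v) * log 2 (1 - ?D (f u) (f v))" for u v
    have bpos: "0 < bern ?P (epairs G') ?a"
      unfolding bern_def using pos lt1 v
      by (intro mult_pos_pos prod_pos) (auto simp: epairs_def pairs_def)
    have "log 2 (bern ?P (epairs G') ?a) =
       (\<Sum>p\<in>epairs G'. log 2 (?a p)) + (\<Sum>p\<in>?P - epairs G'. log 2 (1 - ?a p))"
      using bern_log[OF fP EP, of ?a] D bpos by auto
    also have "\<dots> = (\<Sum>(u, v)\<in>epairs G'. L u v) + (\<Sum>(u, v)\<in>?P - epairs G'. L u v)"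
    proof (intro arg_cong2[of _ _ _ _ "(+)"] sum.cong refl)
      fix p assume p: "p \<in> ?P - epairs G'"
      obtain u w where uw: "p = (u, w)" by (cases p)
      then have "{u, w} \<notin> edges G'" using p v by (auto simp: epairs_def)
      then show "log 2 (1 - ?a p) = (case p of (u, v) \<Rightarrow> L u v)"
        by (simp add: uw L_def adj_def)
    qed (auto simp: L_def adj_def epairs_def)
    also have "\<dots> = (\<Sum>(u, v)\<in>?P. L u v)"
      using sum.subset_diff[OF EP fP, of "\<lambda>(u, v). L u v"] by simp
    finally have log: "log 2 (bern ?P (epairs G') ?a) = (\<Sum>(u, v)\<in>?P. L u v)" .
    have Lsym: "L u v = L v u" for u v
      unfolding L_def using D_sym[of "f u" "f v"] adj_sym[of G' u v] by simp
    \<comment> \<open>The block formula sums over all ordered pairs, including the diagonal.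
      Diagonal terms are nonpositive, so half of the full sum is a lower bound for the sum over
      \<open>?P\<close>. If the density is 1, \<open>log 2 0 = 0\<close> still satisfies the
      bound.\<close>
    have Luu: "L u u \<le> 0" for u
    proof -
      have "{u} \<notin> edges G'" using sg by (auto simp: simple_graph_def)
      moreover have "log 2 (1 - ?D (f u) (f u)) \<le> 0"
        using D[of "f u" "f u"] by (cases "?D (f u) (f u) = 1") (simp_all add: log_def divide_le_0_iff)
      ultimately show ?thesis by (simp add: L_def adj_def)
    qed
    have "(\<Sum>u\<in>?V. \<Sum>v\<in>?V. L u v) = 2 * (\<Sum>(u, v)\<in>?P. L u v) + (\<Sum>u\<in>?V. L u u)"
      using Lsym by (intro sum_pairs_sym) auto
    moreover have "(\<Sum>u\<in>?V. L u u) \<le> 0" using Luu by (intro sum_nonpos)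
    ultimately have *: "(\<Sum>u\<in>?V. \<Sum>v\<in>?V. L u v) / 2 \<le> (\<Sum>(u, v)\<in>?P. L u v)" by simp
    have "(\<Sum>u\<in>?V. \<Sum>v\<in>?V. L u v) =
       (\<Sum>u\<in>?V. \<Sum>v\<in>?V. adj G' u v * log 2 (?D (f u) (f v))) +
       (\<Sum>u\<in>?V. \<Sum>v\<in>?V. (1 - adj G' u v) * log 2 (1 - ?D (f u) (f v)))"
      by (simp add: L_def sum.distrib)
    also have "\<dots> = (real (card ?V))\<^sup>2 * (\<Sum>i<N. \<Sum>j<N. mass ?V (adj G') f i j * log 2 (?D i j) +
       mass ?V (\<lambda>u v. 1 - adj G' u v) f i j * log 2 (1 - ?D i j))"
      using block_sum[OF V f, of "adj G'" "\<lambda>i j. log 2 (?D i j)"]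
        block_sum[OF V f, of "\<lambda>u v. 1 - adj G' u v" "\<lambda>i j. log 2 (1 - ?D i j)"]
      by (simp add: sum.distrib distrib_left)
    also have "\<dots> = (real (card ?V))\<^sup>2 * (\<Sum>i<N. \<Sum>j<N. - (wt ?V f i * wt ?V f j * binary_entropy (?D i j)))"
    proof (intro arg_cong2[of _ _ _ _ "(*)"] refl sum.cong)
      fix i j assume ij: "i \<in> {..<N}" "j \<in> {..<N}"
      have "mass ?V (adj G') f i j = wt ?V f i * wt ?V f j * ?D i j"
        using mass[OF G'] ij dens_mult[where A="adj G" and V="?V" and f=f and i=i and j=j, OF V adj_01] by simp
      then show "mass ?V (adj G') f i j * log 2 (?D i j) +
         mass ?V (\<lambda>u v. 1 - adj G' u v) f i j * log 2 (1 - ?D i j) =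
         - (wt ?V f i * wt ?V f j * binary_entropy (?D i j))"
        unfolding mass_compl[OF V] by (simp add: binary_entropy_def algebra_simps)
    qed
    also have "\<dots> = - ((real n)\<^sup>2 * block_entropy ?V (adj G) f N)"
      by (simp add: block_entropy_def sum_negf)
    finally have "- ((real n)\<^sup>2 / 2 * block_entropy ?V (adj G) f N) \<le> log 2 (bern ?P (epairs G') ?a)"
      using * log by simp
    then have "q \<le> 2 powr (log 2 (bern ?P (epairs G') ?a))"
      unfolding q_def by (intro powr_mono) auto
    then show ?thesis using bpos by simp
  qed
  have "real (card \<G>) * q = (\<Sum>G'\<in>\<G>. q)" by simp
  also have "\<dots> \<le> (\<Sum>G'\<in>\<G>. bern ?P (epairs G') ?a)" by (rule sum_mono) (rule bern_ge)
  also have "\<dots> = (\<Sum>E\<in>epairs ` \<G>. bern ?P E ?a)"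
    using labelled_graph_eqI sub by (subst sum.reindex) (auto simp: inj_on_def)
  also have "\<dots> \<le> (\<Sum>E\<in>Pow ?P. bern ?P E ?a)"
  proof (rule sum_mono2)
    show "epairs ` \<G> \<subseteq> Pow ?P" using epairs_subset sub by (fastforce simp: labelled_graphs_def)
  qed (use fP D in \<open>auto intro!: bern_nonneg\<close>)
  also have "\<dots> = 1" by (rule sum_bern[OF fP])
  finally have "real (card \<G>) \<le> 1 / q" by (simp add: q_def pos_le_divide_eq)
  then show ?thesis by (simp add: q_def powr_minus_divide)
qed

lemma mass_coarsen:
  assumes V: "finite V" and f: "\<And>u. u \<in> V \<Longrightarrow> f u = k (f' u)" and N: "f' ` V \<subseteq> {..<N}"
  shows "mass V A f i j = (\<Sum>i'<N. \<Sum>j'<N. mass V A f' i' j' * (of_bool (k i' = i) * of_bool (k j' = j)))"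
proof (cases "V = {}")
  case False
  then have n: "(real (card V))\<^sup>2 \<noteq> 0" using V by simp
  have "(\<Sum>u\<in>V. \<Sum>v\<in>V. A u v * (of_bool (f u = i) * of_bool (f v = j))) =
      (\<Sum>u\<in>V. \<Sum>v\<in>V. A u v * (of_bool (k (f' u) = i) * of_bool (k (f' v) = j)))"
    by (intro sum.cong refl) (simp add: f)
  also have "\<dots> = (real (card V))\<^sup>2 * (\<Sum>i'<N. \<Sum>j'<N. mass V A f' i' j' * (of_bool (k i' = i) * of_bool (k j' = j)))"
    by (rule block_sum[OF V N])
  finally show ?thesis unfolding mass_def[of V A f] using n by simp
qed (simp add: mass_def)

lemma mass_cong:
  assumes "\<And>u. u \<in> V \<Longrightarrow> f u = f' u"
  shows "mass V A f i j = mass V A f' i j"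
  using assms by (simp add: mass_def)

lemma wt_coarsen:
  assumes V: "finite V" "V \<noteq> {}" and f: "\<And>u. u \<in> V \<Longrightarrow> f u = k (f' u)" and N: "f' ` V \<subseteq> {..<N}"
  shows "wt V f i = (\<Sum>j<N. wt V f' j * of_bool (k j = i))"
proof -
  have "(\<Sum>j<N. wt V f' j * of_bool (k j = i)) =
     (\<Sum>j<N. (\<Sum>v\<in>V. of_bool (f' v = j) * of_bool (k j = i))) / card V"
    by (simp add: wt_altdef[OF V(1)] sum_divide_distrib sum_distrib_right del: sum_of_bool_eq sum_of_bool_mult_eq sum_mult_of_bool_eq)
  also have "(\<Sum>j<N. (\<Sum>v\<in>V. of_bool (f' v = j) * of_bool (k j = i))) =
     (\<Sum>v\<in>V. \<Sum>j<N. of_bool (f' v = j) * (of_bool (k j = i) :: real))" by (rule sum.swap)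
  also have "\<dots> = (\<Sum>v\<in>V. of_bool (f v = i))"
  proof (rule sum.cong[OF refl])
    fix v assume v: "v \<in> V"
    then have "{..<N} \<inter> {j. f' v = j} = {f' v}" using N by auto
    then show "(\<Sum>j<N. of_bool (f' v = j) * (of_bool (k j = i) :: real)) = of_bool (f v = i)"
      using f[OF v] by simp
  qed
  finally show ?thesis by (simp add: wt_altdef[OF V(1)] del: sum_of_bool_eq)
qed

text \<open>Masses of graphs are edge counts divided by n^2, so at a fixed level the number of
  possible mass matrices is polynomial in n.\<close>

lemma mass_adj_range:
  assumes "card V = n"
  shows "mass V (adj G) f i j \<in> (\<lambda>k. real k / (real n)\<^sup>2) ` {..n\<^sup>2}"
proof
  let ?k = "\<Sum>u\<in>V. \<Sum>v\<in>V. of_bool ({u, v} \<in> edges G) * (of_bool (f u = i) * of_bool (f v = j)) :: nat"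
  show "mass V (adj G) f i j = real ?k / (real n)\<^sup>2"
    unfolding mass_def adj_def of_nat_sum of_nat_mult of_nat_of_bool assms ..
  have "?k \<le> (\<Sum>u\<in>V. \<Sum>v\<in>V. 1)" by (intro sum_mono) auto
  then show "?k \<in> {..n\<^sup>2}" by (simp add: assms power2_eq_square)
qed

text \<open>Pigeonhole over the level-\<open>m\<close> partition together with its mass matrix.
  Since these determine the data at every lower level, one popular class, and so one graph
  \<open>G\<close>, serves all \<open>t \<le> m\<close> simultaneously. The prefactor bounds the
  number of classes.\<close>

lemma dense_code_class:
  assumes n: "n > 0" and B: "B \<subseteq> labelled_graphs n" "B \<noteq> {}"
  obtains G where "G \<in> B"
    "\<And>t. t \<le> m \<Longrightarrow> real (card B) \<le> real (4 ^ m) ^ n * ((real n)\<^sup>2 + 1) ^ (4 ^ m * 4 ^ m) *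
       2 powr ((real n)\<^sup>2 / 2 * block_entropy {1..n} (adj G) (code {1..n} (adj G) t) (4 ^ t))"
proof -
  let ?V = "{1..n}" and ?N = "4 ^ m :: nat"
  let ?f = "\<lambda>G t. code ?V (adj G) t"
  let ?M = "(\<lambda>k. real k / (real n)\<^sup>2) ` {..n\<^sup>2}"
  define R where "R = (?V \<rightarrow>\<^sub>E {..<?N}) \<times> ({..<?N} \<times> {..<?N} \<rightarrow>\<^sub>E ?M)"
  define \<kappa> where "\<kappa> G = (restrict (?f G m) ?V, \<lambda>(i, j)\<in>{..<?N} \<times> {..<?N}. mass ?V (adj G) (?f G m) i j)" for G
  have fB: "finite B" using B finite_labelled_graphs finite_subset by blast
  have fR: "finite R" unfolding R_def by (intro finite_cartesian_product finite_PiE) auto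
  have \<kappa>: "\<kappa> \<in> B \<rightarrow> R"
  proof
    fix G assume "G \<in> B"
    have "restrict (?f G m) ?V \<in> ?V \<rightarrow>\<^sub>E {..<?N}" using code_less by auto
    moreover have "(\<lambda>(i, j)\<in>{..<?N} \<times> {..<?N}. mass ?V (adj G) (?f G m) i j) \<in> {..<?N} \<times> {..<?N} \<rightarrow>\<^sub>E ?M"
      using mass_adj_range[of ?V n] by (intro restrict_PiE_iff[THEN iffD2]) (simp add: case_prod_unfold)
    ultimately show "\<kappa> G \<in> R" unfolding \<kappa>_def R_def by (rule SigmaI)
  qed
  with B have neR: "R \<noteq> {}" by auto
  obtain y where y: "card (\<kappa> -` {y} \<inter> B) * card R \<ge> card B"
    using pigeonhole_card[OF \<kappa> fB fR neR] by auto
  let ?C = "\<kappa> -` {y} \<inter> B"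
  have "card B > 0" using fB B(2) by (simp add: card_gt_0_iff)
  then have "?C \<noteq> {}" using y by (intro notI) simp
  then obtain G where G: "G \<in> B" "\<kappa> G = y" by auto
  have "card ?M \<le> n\<^sup>2 + 1" using card_image_le[of "{..n\<^sup>2}" "\<lambda>k. real k / (real n)\<^sup>2"] by simp
  then have "card R \<le> ?N ^ n * (n\<^sup>2 + 1) ^ (?N * ?N)"
    unfolding R_def by (simp add: card_cartesian_product card_PiE power_mono)
  then have "real (card R) \<le> real (?N ^ n * (n\<^sup>2 + 1) ^ (?N * ?N))"
    by (rule of_nat_mono)
  also have "\<dots> = real ?N ^ n * ((real n)\<^sup>2 + 1) ^ (?N * ?N)"
    by (simp only: of_nat_mult of_nat_power of_nat_add of_nat_1)
  finally have R: "real (card R) \<le> real ?N ^ n * ((real n)\<^sup>2 + 1) ^ (?N * ?N)" .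
  show thesis
  proof (rule that[OF G(1)])
    fix t assume t: "t \<le> m"
    let ?g = "\<lambda>i. i div 4 ^ (m - t)"
    have C: "real (card ?C) \<le> 2 powr ((real n)\<^sup>2 / 2 * block_entropy ?V (adj G) (?f G t) (4 ^ t))"
    proof (rule card_equal_masses)
      fix G' i j assume G': "G' \<in> ?C"
      then have eq: "\<kappa> G' = \<kappa> G" using G by simp
      have m: "mass ?V (adj G') (?f G' m) i j = mass ?V (adj G) (?f G m) i j" if "i < ?N" "j < ?N" for i j
        using arg_cong[OF eq, of "\<lambda>x. snd x (i, j)"] that by (simp add: \<kappa>_def)
      have f: "?f G' m u = ?f G m u" if "u \<in> ?V" for u
        using arg_cong[OF eq, of "\<lambda>x. fst x u"] that by (simp add: \<kappa>_def)
      have N: "?f G m ` ?V \<subseteq> {..<?N}" using code_less by auto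
      \<comment> \<open>Here \<open>?f G t\<close> is the partition of \<open>G\<close>, not of
        \<open>G'\<close>. Both masses at level \<open>t\<close> are sums of masses at level
        \<open>m\<close>, and these coincide because the level-\<open>m\<close> codes of the two
        graphs agree on \<open>?V\<close>.\<close>
      have "mass ?V (adj G') (?f G t) i j =
         (\<Sum>i'<?N. \<Sum>j'<?N. mass ?V (adj G') (?f G m) i' j' * (of_bool (?g i' = i) * of_bool (?g j' = j)))"
        by (rule mass_coarsen) (use N code_div[OF t] in auto)
      also have "\<dots> = (\<Sum>i'<?N. \<Sum>j'<?N. mass ?V (adj G) (?f G m) i' j' * (of_bool (?g i' = i) * of_bool (?g j' = j)))"
      proof (intro sum.cong refl arg_cong2[of _ _ _ _ "(*)"])
        fix i' j' assume ij: "i' \<in> {..<?N}" "j' \<in> {..<?N}"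
        have "mass ?V (adj G') (?f G m) i' j' = mass ?V (adj G') (?f G' m) i' j'"
          by (rule mass_cong) (rule f[symmetric])
        then show "mass ?V (adj G') (?f G m) i' j' = mass ?V (adj G) (?f G m) i' j'"
          using m ij by simp
      qed
      also have "\<dots> = mass ?V (adj G) (?f G t) i j"
        by (rule mass_coarsen[symmetric]) (use N code_div[OF t] in auto)
      finally show "mass ?V (adj G') (?f G t) i j = mass ?V (adj G) (?f G t) i j" .
    qed (use G B code_less in auto)
    have "real (card B) \<le> real (card R) * real (card ?C)"
      using y by (simp add: mult.commute flip: of_nat_mult)
    also have "\<dots> \<le> (real ?N ^ n * ((real n)\<^sup>2 + 1) ^ (?N * ?N)) *
       2 powr ((real n)\<^sup>2 / 2 * block_entropy ?V (adj G) (?f G t) (4 ^ t))"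
      using R C by (intro mult_mono) auto
    finally show "real (card B) \<le> real (4 ^ m) ^ n * ((real n)\<^sup>2 + 1) ^ (4 ^ m * 4 ^ m) *
       2 powr ((real n)\<^sup>2 / 2 * block_entropy ?V (adj G) (?f G t) (4 ^ t))" .
  qed
qed

section \<open>Limits of block data\<close>

lemma diagonal_convergent_subseq:
  fixes a :: "nat \<Rightarrow> 'i::countable \<Rightarrow> real"
  assumes "\<And>m i. a m i \<in> {0..1}"
  obtains r where "strict_mono r" "\<And>i. convergent (\<lambda>m. a (r m) i)"
proof -
  interpret subseqs "\<lambda>n s. convergent (\<lambda>m. a (s m) (from_nat n))"
  proof
    fix n and s :: "nat \<Rightarrow> nat"
    have "seq_compact {0..1::real}" by (simp add: compact_imp_seq_compact)
    then obtain l r where "strict_mono r" "((\<lambda>m. a (s m) (from_nat n)) \<circ> r) \<longlonglongrightarrow> l"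
      using assms by (metis seq_compactE)
    then show "\<exists>r'. strict_mono r' \<and> convergent (\<lambda>m. a ((s \<circ> r') m) (from_nat n))"
      by (intro exI[of _ r]) (auto simp: convergent_def o_def)
  qed
  have "convergent (\<lambda>m. a (diagseq m) i)" for i
  proof -
    have "convergent (\<lambda>m. a ((diagseq \<circ> (+) (Suc (to_nat i))) m) (from_nat (to_nat i)))"
    proof (rule diagseq_holds)
      fix r s :: "nat \<Rightarrow> nat" and n
      assume "strict_mono r" "convergent (\<lambda>m. a (s m) (from_nat n))"
      then show "convergent (\<lambda>m. a ((s \<circ> r) m) (from_nat n))"
        using convergent_subseq_convergent[of "\<lambda>m. a (s m) (from_nat n)" r] by (simp add: o_def)
    qed
    then have "convergent (\<lambda>m. a (diagseq (m + Suc (to_nat i))) i)"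
      by (simp add: add.commute)
    then show ?thesis by (simp only: convergent_ignore_initial_segment[of "\<lambda>m. a (diagseq m) i"])
  qed
  with subseq_diagseq show thesis by (rule that)
qed

text \<open>Block densities need not converge on parts whose weight tends to 0, being quotients of
  type 0/0. Boundedness suffices there, since the weight kills the term.\<close>

lemma tendsto_weighted_sum:
  fixes a g :: "nat \<Rightarrow> 'x \<Rightarrow> real"
  assumes a: "\<And>x. x \<in> X \<Longrightarrow> (\<lambda>m. a m x) \<longlonglongrightarrow> a' x"
    and g: "\<And>m x. x \<in> X \<Longrightarrow> \<bar>g m x\<bar> \<le> C"
    and conv: "\<And>x. x \<in> X \<Longrightarrow> a' x \<noteq> 0 \<Longrightarrow> (\<lambda>m. g m x) \<longlonglongrightarrow> g' x"
  shows "(\<lambda>m. \<Sum>x\<in>X. a m x * g m x) \<longlonglongrightarrow> (\<Sum>x\<in>X. a' x * g' x)"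
proof (rule tendsto_sum)
  fix x assume x: "x \<in> X"
  show "(\<lambda>m. a m x * g m x) \<longlonglongrightarrow> a' x * g' x"
  proof (cases "a' x = 0")
    case True
    have "(\<lambda>m. a m x * g m x) \<longlonglongrightarrow> 0"
    proof (rule tendsto_0_le[where K=C])
      show "(\<lambda>m. a m x) \<longlonglongrightarrow> 0" using a[OF x] True by simp
      show "\<forall>\<^sub>F m in sequentially. norm (a m x * g m x) \<le> norm (a m x) * C"
        using g[OF x] by (intro always_eventually allI) (simp add: abs_mult mult_left_mono)
    qed
    then show ?thesis using True by simp
  qed (use a[OF x] conv[OF x] in \<open>auto intro!: tendsto_mult\<close>)
qed

section \<open>Integrals of functions of finitely valued codes\<close>

lemma space_unit_leb [simp]: "space unit_leb = {0..1}"
  by (simp add: space_restrict_space)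

lemma prob_space_unit_leb: "prob_space unit_leb"
  by (rule prob_spaceI) (simp add: emeasure_restrict_space)

text \<open>The analogue of \<open>sum_PiE_codes\<close> for a probability space: codes of
  independent points are independent. The matching formulas let limits of finite block sums be
  recognised as integrals.\<close>

lemma integral_PiM_codes:
  fixes c :: "'a \<Rightarrow> nat" and g :: "('i \<Rightarrow> nat) \<Rightarrow> real"
  assumes M: "prob_space M" and I: "finite I"
    and c: "c \<in> measurable M (count_space UNIV)" "\<And>x. x \<in> space M \<Longrightarrow> c x < N"
  shows "(\<integral>x. g (\<lambda>u\<in>I. c (x u)) \<partial>(\<Pi>\<^sub>M u\<in>I. M)) =
    (\<Sum>\<psi>\<in>I \<rightarrow>\<^sub>E {..<N}. (\<Prod>u\<in>I. measure M {x\<in>space M. c x = \<psi> u}) * g \<psi>)"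
proof -
  interpret prob_space M by fact
  interpret P: product_prob_space "\<lambda>_. M" I by standard
  interpret PF: product_sigma_finite "\<lambda>_. M" by standard
  let ?ind = "\<lambda>\<psi> x. \<Prod>u\<in>I. indicator {x\<in>space M. c x = \<psi> u} (x u) :: real"
  have meas: "{x\<in>space M. c x = i} \<in> sets M" for i
    using measurable_sets[OF c(1), of "{i}"] by (simp add: vimage_def Int_def conj_commute)
  have "(\<integral>x. g (\<lambda>u\<in>I. c (x u)) \<partial>(\<Pi>\<^sub>M u\<in>I. M)) =
     (\<integral>x. (\<Sum>\<psi>\<in>I \<rightarrow>\<^sub>E {..<N}. ?ind \<psi> x * g \<psi>) \<partial>(\<Pi>\<^sub>M u\<in>I. M))"
  proof (rule Bochner_Integration.integral_cong[OF refl])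
    fix x assume "x \<in> space (\<Pi>\<^sub>M u\<in>I. M)"
    then have x: "x u \<in> space M" if "u \<in> I" for u using that by (auto simp: space_PiM)
    have "(\<Sum>\<psi>\<in>I \<rightarrow>\<^sub>E {..<N}. ?ind \<psi> x * g \<psi>) =
        (\<Sum>\<psi>\<in>I \<rightarrow>\<^sub>E {..<N}. if \<psi> = (\<lambda>u\<in>I. c (x u)) then g \<psi> else 0)"
    proof (intro sum.cong refl)
      fix \<psi> assume \<psi>: "\<psi> \<in> I \<rightarrow>\<^sub>E {..<N}"
      have "?ind \<psi> x = of_bool (\<forall>u\<in>I. c (x u) = \<psi> u)"
        using I x by (auto simp: indicator_def)
      moreover have "(\<forall>u\<in>I. c (x u) = \<psi> u) \<longleftrightarrow> \<psi> = (\<lambda>u\<in>I. c (x u))"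
        using \<psi> by (auto simp: fun_eq_iff PiE_def extensional_def restrict_def)
      ultimately show "?ind \<psi> x * g \<psi> = (if \<psi> = (\<lambda>u\<in>I. c (x u)) then g \<psi> else 0)"
        by simp
    qed
    moreover have "(\<lambda>u\<in>I. c (x u)) \<in> I \<rightarrow>\<^sub>E {..<N}" using x c(2) by auto
    ultimately show "g (\<lambda>u\<in>I. c (x u)) = (\<Sum>\<psi>\<in>I \<rightarrow>\<^sub>E {..<N}. ?ind \<psi> x * g \<psi>)"
      using I by (simp add: finite_PiE)
  qed
  also have "\<dots> = (\<Sum>\<psi>\<in>I \<rightarrow>\<^sub>E {..<N}. (\<integral>x. ?ind \<psi> x \<partial>(\<Pi>\<^sub>M u\<in>I. M)) * g \<psi>)"
  proof -
    have "integrable (\<Pi>\<^sub>M u\<in>I. M) (?ind \<psi>)" for \<psi>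
      using I meas by (intro PF.product_integrable_prod) (auto simp: integrable_indicator_iff emeasure_eq_measure)
    then show ?thesis by (subst Bochner_Integration.integral_sum) auto
  qed
  also have "\<dots> = (\<Sum>\<psi>\<in>I \<rightarrow>\<^sub>E {..<N}. (\<Prod>u\<in>I. measure M {x\<in>space M. c x = \<psi> u}) * g \<psi>)"
  proof (intro sum.cong refl arg_cong2[of _ _ _ _ "(*)"])
    fix \<psi>
    have "(\<integral>x. ?ind \<psi> x \<partial>(\<Pi>\<^sub>M u\<in>I. M)) = (\<Prod>u\<in>I. \<integral>x. indicator {x\<in>space M. c x = \<psi> u} x \<partial>M)"
      using I meas by (intro PF.product_integral_prod) (auto simp: integrable_indicator_iff emeasure_eq_measure)
    also have "\<dots> = (\<Prod>u\<in>I. measure M {x\<in>space M. c x = \<psi> u})"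
      using meas by (intro prod.cong) (auto simp: Int_absorb1)
    finally show "(\<integral>x. ?ind \<psi> x \<partial>(\<Pi>\<^sub>M u\<in>I. M)) = (\<Prod>u\<in>I. measure M {x\<in>space M. c x = \<psi> u})" .
  qed
  finally show ?thesis .
qed

lemma integral_pair_codes:
  fixes c :: "'a \<Rightarrow> nat" and g :: "nat \<Rightarrow> nat \<Rightarrow> real"
  assumes M: "prob_space M"
    and c: "c \<in> measurable M (count_space UNIV)" "\<And>x. x \<in> space M \<Longrightarrow> c x < N"
  shows "(\<integral>z. g (c (fst z)) (c (snd z)) \<partial>(M \<Otimes>\<^sub>M M)) =
    (\<Sum>i<N. \<Sum>j<N. measure M {x\<in>space M. c x = i} * measure M {x\<in>space M. c x = j} * g i j)"
proof -
  interpret prob_space M by fact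
  interpret P: pair_prob_space M M ..
  let ?A = "\<lambda>i. {x\<in>space M. c x = i}"
  have meas: "?A i \<in> sets M" for i
    using measurable_sets[OF c(1), of "{i}"] by (simp add: vimage_def Int_def conj_commute)
  have "(\<integral>z. g (c (fst z)) (c (snd z)) \<partial>(M \<Otimes>\<^sub>M M)) =
      (\<integral>z. (\<Sum>i<N. \<Sum>j<N. indicator (?A i \<times> ?A j) z * g i j) \<partial>(M \<Otimes>\<^sub>M M))"
  proof (rule Bochner_Integration.integral_cong[OF refl])
    fix z assume "z \<in> space (M \<Otimes>\<^sub>M M)"
    then have z: "fst z \<in> space M" "snd z \<in> space M" by (auto simp: space_pair_measure)
    then have N: "{..<N} \<inter> {c (fst z)} = {c (fst z)}" "{..<N} \<inter> {c (snd z)} = {c (snd z)}"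
      using c(2) by auto
    have "(\<Sum>i<N. \<Sum>j<N. indicator (?A i \<times> ?A j) z * g i j) =
       (\<Sum>i<N. of_bool (c (fst z) = i) * (\<Sum>j<N. of_bool (c (snd z) = j) * g i j))"
      unfolding sum_distrib_left
      by (intro sum.cong refl) (use z in \<open>auto simp: indicator_def mem_Times_iff\<close>)
    also have "\<dots> = g (c (fst z)) (c (snd z))" by (simp add: N)
    finally show "g (c (fst z)) (c (snd z)) = (\<Sum>i<N. \<Sum>j<N. indicator (?A i \<times> ?A j) z * g i j)"
      by (rule sym)
  qed
  also have "\<dots> = (\<Sum>i<N. \<Sum>j<N. measure (M \<Otimes>\<^sub>M M) (?A i \<times> ?A j) * g i j)"
  proof -
    have "?A i \<times> ?A j \<in> sets (M \<Otimes>\<^sub>M M)" for i j using meas by simp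
    then have int: "integrable (M \<Otimes>\<^sub>M M) (\<lambda>z. indicator (?A i \<times> ?A j) z * g i j)"
      and val: "(\<integral>z. indicator (?A i \<times> ?A j) z * g i j \<partial>(M \<Otimes>\<^sub>M M)) = measure (M \<Otimes>\<^sub>M M) (?A i \<times> ?A j) * g i j" for i j
      using sets.sets_into_space by (auto simp: integrable_indicator_iff P.emeasure_eq_measure Int_absorb1)
    have "(\<integral>z. (\<Sum>i<N. \<Sum>j<N. indicator (?A i \<times> ?A j) z * g i j) \<partial>(M \<Otimes>\<^sub>M M)) =
        (\<Sum>i<N. \<integral>z. (\<Sum>j<N. indicator (?A i \<times> ?A j) z * g i j) \<partial>(M \<Otimes>\<^sub>M M))"
      by (intro Bochner_Integration.integral_sum Bochner_Integration.integrable_sum int)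
    also have "\<dots> = (\<Sum>i<N. \<Sum>j<N. \<integral>z. indicator (?A i \<times> ?A j) z * g i j \<partial>(M \<Otimes>\<^sub>M M))"
      by (intro sum.cong refl Bochner_Integration.integral_sum int)
    finally show ?thesis unfolding val .
  qed
  also have "\<dots> = (\<Sum>i<N. \<Sum>j<N. measure M (?A i) * measure M (?A j) * g i j)"
    using meas by (intro sum.cong refl arg_cong2[of _ _ _ _ "(*)"])
      (simp add: measure_def emeasure_pair_measure_Times enn2real_mult)
  finally show ?thesis .
qed

section \<open>Nested interval partitions with prescribed lengths\<close>

locale limit_weights =
  fixes w :: "nat \<Rightarrow> nat \<Rightarrow> real"
  assumes w_nonneg: "0 \<le> w t i"
    and w_sum: "(\<Sum>i<4 ^ t. w t i) = 1"
    and w_consistent: "w t i = (\<Sum>j<4 ^ Suc t. w (Suc t) j * of_bool (j div 4 = i))"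
begin

definition cum :: "nat \<Rightarrow> nat \<Rightarrow> real" where
  "cum t i = (\<Sum>j<i. w t j)"

text \<open>Level \<open>t\<close> cuts \<open>[0, 1]\<close> into consecutive intervals of lengths \<open>w t 0, w t 1, \<dots>\<close>;
  the last one is closed on the right.\<close>

definition lcode :: "nat \<Rightarrow> real \<Rightarrow> nat" where
  "lcode t x = Max {i. i < 4 ^ t \<and> cum t i \<le> x}"

lemma cum_mono: "i \<le> j \<Longrightarrow> cum t i \<le> cum t j"
  unfolding cum_def using w_nonneg by (intro sum_mono2) auto

lemma cum_0 [simp]: "cum t 0 = 0" and cum_Suc: "cum t (Suc i) = cum t i + w t i"
  by (simp_all add: cum_def)

text \<open>Parts \<open>4 * i\<close> to \<open>4 * i + 3\<close> are the children of part
  \<open>i\<close>, and their weights add up to its weight. Hence every cut point of one level is a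
  cut point of the next, and the interval partitions are nested.\<close>

lemma cum_refine:
  assumes "i \<le> 4 ^ t"
  shows "cum (Suc t) (4 * i) = cum t i"
proof -
  have "cum t i = (\<Sum>k<i. \<Sum>j<4 ^ Suc t. w (Suc t) j * of_bool (j div 4 = k))"
    unfolding cum_def by (intro sum.cong refl w_consistent)
  also have "\<dots> = (\<Sum>j<4 ^ Suc t. \<Sum>k<i. w (Suc t) j * of_bool (j div 4 = k))" by (rule sum.swap)
  also have "\<dots> = (\<Sum>j<4 ^ Suc t. if j < 4 * i then w (Suc t) j else 0)"
  proof (intro sum.cong refl)
    fix j
    have "{..<i} \<inter> {k. j div 4 = k} = (if j < 4 * i then {j div 4} else {})" by auto
    then show "(\<Sum>k<i. w (Suc t) j * of_bool (j div 4 = k)) = (if j < 4 * i then w (Suc t) j else 0)"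
      by (simp del: Int_Collect)
  qed
  also have "\<dots> = (\<Sum>j\<in>{..<4 ^ Suc t} \<inter> {..<4 * i}. w (Suc t) j)"
    by (simp add: sum.If_cases lessThan_def)
  also have "{..<4 ^ Suc t} \<inter> {..<4 * i} = {..<4 * i}" using assms by auto
  finally show ?thesis by (simp add: cum_def)
qed

text \<open>An index whose interval is empty is never chosen unless it is the last one: its
  successor has the same left end point, and \<open>Max\<close> prefers the successor.\<close>

lemma lcode_props:
  assumes "0 \<le> x"
  shows "lcode t x < 4 ^ t" "cum t (lcode t x) \<le> x"
    and "Suc (lcode t x) < 4 ^ t \<Longrightarrow> x < cum t (Suc (lcode t x))"
proof -
  let ?S = "{i. i < 4 ^ t \<and> cum t i \<le> x}"
  have fin: "finite ?S" by (rule finite_subset[of _ "{..<4 ^ t}"]) auto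
  have "0 \<in> ?S" using assms by simp
  then have "?S \<noteq> {}" by blast
  then have in_S: "lcode t x \<in> ?S" unfolding lcode_def using fin by (intro Max_in)
  then show "lcode t x < 4 ^ t" "cum t (lcode t x) \<le> x" by auto
  show "x < cum t (Suc (lcode t x))" if "Suc (lcode t x) < 4 ^ t"
  proof (rule ccontr)
    assume "\<not> ?thesis"
    then have "Suc (lcode t x) \<in> ?S" using that by simp
    then have "Suc (lcode t x) \<le> lcode t x" unfolding lcode_def using fin by (intro Max_ge) auto
    then show False by simp
  qed
qed

lemma lcode_eqI:
  assumes "0 \<le> x" "i < 4 ^ t" "cum t i \<le> x" "Suc i < 4 ^ t \<Longrightarrow> x < cum t (Suc i)"
  shows "lcode t x = i"
proof (rule antisym)
  show "lcode t x \<le> i"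
  proof (rule ccontr)
    assume "\<not> ?thesis"
    then have "Suc i \<le> lcode t x" by simp
    moreover from this have "Suc i < 4 ^ t" using lcode_props(1)[OF assms(1), of t] by simp
    ultimately show False
      using cum_mono[of "Suc i" "lcode t x" t] lcode_props(2)[OF assms(1), of t] assms(4) by simp
  qed
  show "i \<le> lcode t x"
  proof (rule ccontr)
    assume "\<not> ?thesis"
    then have "Suc (lcode t x) \<le> i" by simp
    then show False
      using cum_mono[of "Suc (lcode t x)" i t] lcode_props(3)[OF assms(1), of t] assms(2,3) by simp
  qed
qed

lemma lcode_Suc_div:
  assumes x: "0 \<le> x"
  shows "lcode (Suc t) x div 4 = lcode t x"
proof (rule lcode_eqI[symmetric, OF x])
  let ?j = "lcode (Suc t) x"
  have j: "?j < 4 * 4 ^ t" using lcode_props(1)[OF x, of "Suc t"] by simp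
  then show i: "?j div 4 < 4 ^ t" by (simp add: less_mult_imp_div_less mult.commute)
  have "cum t (?j div 4) = cum (Suc t) (4 * (?j div 4))" using i by (simp add: cum_refine)
  also have "\<dots> \<le> cum (Suc t) ?j" by (intro cum_mono) simp
  also have "\<dots> \<le> x" by (rule lcode_props(2)[OF x])
  finally show "cum t (?j div 4) \<le> x" .
  assume l: "Suc (?j div 4) < 4 ^ t"
  have "Suc ?j \<le> 4 * Suc (?j div 4)" by simp
  also have "\<dots> < 4 * 4 ^ t" using l by simp
  finally have "x < cum (Suc t) (Suc ?j)" using lcode_props(3)[OF x, of "Suc t"] by simp
  also have "\<dots> \<le> cum (Suc t) (4 * Suc (?j div 4))" by (intro cum_mono) simp
  also have "\<dots> = cum t (Suc (?j div 4))" using l by (intro cum_refine) simp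
  finally show "x < cum t (Suc (?j div 4))" .
qed

lemma lcode_div:
  assumes x: "0 \<le> x" and "t \<le> s"
  shows "lcode t x = lcode s x div 4 ^ (s - t)"
  using assms(2)
proof (induction rule: dec_induct)
  case (step s)
  then show ?case
    by (simp add: Suc_diff_le div_mult2_eq lcode_Suc_div[OF x])
qed simp

lemma lcode_vimage:
  assumes i: "i < 4 ^ t"
  shows "{x\<in>{0..1}. lcode t x = i} = (if Suc i < 4 ^ t then {cum t i..<cum t (Suc i)} else {cum t i..1})"
proof -
  have ci: "0 \<le> cum t i" using cum_mono[of 0 i t] by simp
  have c1: "cum t (Suc i) \<le> 1" if "Suc i < 4 ^ t"
    using cum_mono[of "Suc i" "4 ^ t" t] that w_sum[of t] by (simp add: cum_def)
  have "lcode t x = i \<longleftrightarrow> cum t i \<le> x \<and> (Suc i < 4 ^ t \<longrightarrow> x < cum t (Suc i))" if "0 \<le> x" for x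
    using lcode_props[OF that, of t] lcode_eqI[OF that i] by blast
  then have "{x\<in>{0..1}. lcode t x = i} = {x\<in>{0..1}. cum t i \<le> x \<and> (Suc i < 4 ^ t \<longrightarrow> x < cum t (Suc i))}"
    by auto
  also have "\<dots> = (if Suc i < 4 ^ t then {cum t i..<cum t (Suc i)} else {cum t i..1})"
    using ci c1 by (cases "Suc i < 4 ^ t") (auto intro: order_trans less_imp_le)
  finally show ?thesis .
qed

lemma measure_lcode:
  assumes i: "i < 4 ^ t"
  shows "measure unit_leb {x\<in>{0..1}. lcode t x = i} = w t i"
proof -
  let ?A = "{x\<in>{0..1}. lcode t x = i}"
  have ci: "0 \<le> cum t i" using cum_mono[of 0 i t] by simp
  have c1: "cum t (4 ^ t) = 1" by (simp add: cum_def w_sum)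
  have "measure unit_leb ?A = measure lborel ?A"
    by (rule measure_restrict_space) (auto simp: space_restrict_space)
  also have "\<dots> = w t i"
  proof (cases "Suc i < 4 ^ t")
    case True
    then show ?thesis using cum_Suc[of t i] w_nonneg[of t i] by (subst lcode_vimage[OF i]) simp
  next
    case False
    then have "Suc i = 4 ^ t" using i by simp
    then show ?thesis using cum_Suc[of t i] w_nonneg[of t i] c1 by (subst lcode_vimage[OF i]) simp
  qed
  finally show ?thesis .
qed

lemma measurable_lcode [measurable]: "lcode t \<in> measurable unit_leb (count_space UNIV)"
proof -
  have "lcode t -` {i} \<inter> space unit_leb \<in> sets unit_leb" for i
  proof (cases "i < 4 ^ t")
    case True
    have "lcode t -` {i} \<inter> space unit_leb = {x\<in>{0..1}. lcode t x = i}" by auto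
    moreover have "{x\<in>{0..1}. lcode t x = i} \<in> sets borel"
      by (subst lcode_vimage[OF True]) simp
    ultimately show ?thesis by (auto simp: sets_restrict_space_iff)
  next
    case False
    then have "lcode t -` {i} \<inter> space unit_leb = {}" using lcode_props(1)[of _ t] by force
    then show ?thesis by simp
  qed
  then show ?thesis by (subst measurable_count_space_eq2_countable) auto
qed

end

section \<open>Sampling vertices from a graphon\<close>

lemma distr_PiM_pair:
  assumes M: "prob_space M" and I: "finite I" "u \<in> I" "v \<in> I" "u \<noteq> v"
  shows "distr (\<Pi>\<^sub>M i\<in>I. M) (M \<Otimes>\<^sub>M M) (\<lambda>x. (x u, x v)) = M \<Otimes>\<^sub>M M"
proof (rule sym, rule pair_measure_eqI)
  interpret prob_space M by fact
  interpret PF: product_sigma_finite "\<lambda>_. M" by standard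
  show "sigma_finite_measure M" "sigma_finite_measure M" by unfold_locales
  fix A B assume AB: "A \<in> sets M" "B \<in> sets M"
  let ?E = "\<lambda>i. if i = u then A else if i = v then B else space M"
  have "emeasure (distr (\<Pi>\<^sub>M i\<in>I. M) (M \<Otimes>\<^sub>M M) (\<lambda>x. (x u, x v))) (A \<times> B) =
      emeasure (\<Pi>\<^sub>M i\<in>I. M) ((\<lambda>x. (x u, x v)) -` (A \<times> B) \<inter> space (\<Pi>\<^sub>M i\<in>I. M))"
    using AB I by (intro emeasure_distr) auto
  also have "(\<lambda>x. (x u, x v)) -` (A \<times> B) \<inter> space (\<Pi>\<^sub>M i\<in>I. M) = Pi\<^sub>E I ?E"
    using I sets.sets_into_space[OF AB(1)] sets.sets_into_space[OF AB(2)]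
    by (auto simp: space_PiM PiE_iff split: if_splits) blast+
  also have "emeasure (\<Pi>\<^sub>M i\<in>I. M) (Pi\<^sub>E I ?E) = (\<Prod>i\<in>I. emeasure M (?E i))"
    using AB I by (intro PF.emeasure_PiM) auto
  also have "\<dots> = emeasure M A * emeasure M B * (\<Prod>i\<in>I - {u, v}. emeasure M (?E i))"
  proof -
    have "I = insert u (insert v (I - {u, v}))" using I by auto
    then have "(\<Prod>i\<in>I. emeasure M (?E i)) = (\<Prod>i\<in>insert u (insert v (I - {u, v})). emeasure M (?E i))"
      by simp
    also have "\<dots> = emeasure M A * (emeasure M B * (\<Prod>i\<in>I - {u, v}. emeasure M (?E i)))"
      using I by (subst prod.insert; simp)
    finally show ?thesis by (simp add: mult.assoc)
  qed
  also have "(\<Prod>i\<in>I - {u, v}. emeasure M (?E i)) = 1"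
    by (intro prod.neutral) (auto simp: emeasure_space_1)
  finally show "emeasure M A * emeasure M B =
      emeasure (distr (\<Pi>\<^sub>M i\<in>I. M) (M \<Otimes>\<^sub>M M) (\<lambda>x. (x u, x v))) (A \<times> B)" by simp
qed simp

lemma AE_PiM_pair:
  assumes M: "prob_space M" and I: "finite I" "u \<in> I" "v \<in> I" "u \<noteq> v"
    and ae: "AE z in M \<Otimes>\<^sub>M M. P z"
  shows "AE x in (\<Pi>\<^sub>M i\<in>I. M). P (x u, x v)"
proof (rule AE_distrD[where P=P])
  show "(\<lambda>x. (x u, x v)) \<in> measurable (\<Pi>\<^sub>M i\<in>I. M) (M \<Otimes>\<^sub>M M)" using I by simp
  show "AE z in distr (\<Pi>\<^sub>M i\<in>I. M) (M \<Otimes>\<^sub>M M) (\<lambda>x. (x u, x v)). P z"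
    unfolding distr_PiM_pair[OF M I] by fact
qed

abbreviation unit_square :: "(real \<times> real) measure" where
  "unit_square \<equiv> unit_leb \<Otimes>\<^sub>M unit_leb"

lemma prob_space_unit_square: "prob_space unit_square"
  using prob_space_pair[OF prob_space_unit_leb prob_space_unit_leb] .

text \<open>Probability that the graph sampled from \<open>W\<close> on the vertex set
  \<open>I\<close> has edge set \<open>E\<close>. Taking \<open>I\<close> and \<open>E\<close>
  separately makes it convenient to sum over all possible edge sets.\<close>

definition graphon_prob :: "nat set \<Rightarrow> (nat \<times> nat) set \<Rightarrow> (real \<Rightarrow> real \<Rightarrow> real) \<Rightarrow> real" where
  "graphon_prob I E W =
     (\<integral>x. bern (pairs I) E (\<lambda>(u, v). W (x u) (x v)) \<partial>(\<Pi>\<^sub>M u\<in>I. unit_leb))"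

lemma graphon_density_eq: "graphon_density H W = graphon_prob (verts H) (epairs H) W"
proof -
  have e: "{(u, v) \<in> verts H \<times> verts H. u < v \<and> {u, v} \<in> edges H} = epairs H"
    by (auto simp: epairs_def pairs_def)
  have ne: "{(u, v) \<in> verts H \<times> verts H. u < v \<and> {u, v} \<notin> edges H} = pairs (verts H) - epairs H"
    by (auto simp: epairs_def pairs_def)
  show ?thesis
    unfolding graphon_density_def graphon_prob_def bern_def e ne by (simp add: case_prod_unfold)
qed

lemma measurable_graphon_edge:
  assumes W: "case_prod W \<in> borel_measurable unit_square" and "u \<in> I" "v \<in> I"
  shows "(\<lambda>x. W (x u) (x v)) \<in> borel_measurable (\<Pi>\<^sub>M i\<in>I. unit_leb)"
proof -
  have "(\<lambda>x. case_prod W (x u, x v)) \<in> borel_measurable (\<Pi>\<^sub>M i\<in>I. unit_leb)"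
    by (rule measurable_compose[OF _ W]) (use assms in simp)
  then show ?thesis by simp
qed

lemma measurable_bern:
  assumes W: "case_prod W \<in> borel_measurable unit_square" and E: "E \<subseteq> pairs I"
  shows "(\<lambda>x. bern (pairs I) E (\<lambda>(u, v). W (x u) (x v))) \<in> borel_measurable (\<Pi>\<^sub>M i\<in>I. unit_leb)"
  unfolding bern_def case_prod_unfold
  using E by (intro borel_measurable_times borel_measurable_prod borel_measurable_diff
      borel_measurable_const measurable_graphon_edge[OF W]) (auto simp: pairs_def)

lemma space_PiM_unit_leb: "x \<in> space (\<Pi>\<^sub>M i\<in>I. unit_leb) \<Longrightarrow> i \<in> I \<Longrightarrow> x i \<in> {0..1}"
  by (auto simp: space_PiM)

text \<open>Dominated convergence. The two coordinates of a pair in \<open>pairs I\<close> are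
  distinct and therefore jointly uniform on the square, so almost surely none of the finitely many
  pairs hits the exceptional null set.\<close>

lemma graphon_prob_tendsto:
  assumes W: "\<And>k. graphon (U k)" "graphon W" and I: "finite I" and E: "E \<subseteq> pairs I"
    and lim: "AE z in unit_square. (\<lambda>k. U k (fst z) (snd z)) \<longlonglongrightarrow> W (fst z) (snd z)"
  shows "(\<lambda>k. graphon_prob I E (U k)) \<longlonglongrightarrow> graphon_prob I E W"
  unfolding graphon_prob_def
proof (rule integral_dominated_convergence[where w="\<lambda>_. 1"])
  interpret PP: prob_space "\<Pi>\<^sub>M i\<in>I. unit_leb" by (intro prob_space_PiM prob_space_unit_leb)
  show "integrable (\<Pi>\<^sub>M i\<in>I. unit_leb) (\<lambda>_. 1::real)" by simp
  have "AE x in (\<Pi>\<^sub>M i\<in>I. unit_leb). \<forall>p\<in>pairs I. (\<lambda>k. U k (x (fst p)) (x (snd p))) \<longlonglongrightarrow> W (x (fst p)) (x (snd p))"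
  proof (rule AE_finite_allI[OF finite_pairs[OF I]])
    fix p assume "p \<in> pairs I"
    then show "AE x in (\<Pi>\<^sub>M i\<in>I. unit_leb). (\<lambda>k. U k (x (fst p)) (x (snd p))) \<longlonglongrightarrow> W (x (fst p)) (x (snd p))"
      using AE_PiM_pair[OF prob_space_unit_leb I _ _ _ lim, of "fst p" "snd p"] by (auto simp: pairs_def)
  qed
  then show "AE x in (\<Pi>\<^sub>M i\<in>I. unit_leb). (\<lambda>k. bern (pairs I) E (\<lambda>(u, v). U k (x u) (x v)))
      \<longlonglongrightarrow> bern (pairs I) E (\<lambda>(u, v). W (x u) (x v))"
    unfolding bern_def case_prod_unfold
    by eventually_elim (use E in \<open>auto intro!: tendsto_intros\<close>)
  show "AE x in (\<Pi>\<^sub>M i\<in>I. unit_leb). norm (bern (pairs I) E (\<lambda>(u, v). U k (x u) (x v))) \<le> 1" for k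
  proof (rule AE_I2)
    fix x assume x: "x \<in> space (\<Pi>\<^sub>M i\<in>I. unit_leb)"
    have 01: "(case p of (u, v) \<Rightarrow> U k (x u) (x v)) \<in> {0..1}" if "p \<in> pairs I" for p
      using that space_PiM_unit_leb[OF x] W(1)[of k] by (auto simp: graphon_def pairs_def)
    show "norm (bern (pairs I) E (\<lambda>(u, v). U k (x u) (x v))) \<le> 1"
      using bern_nonneg[OF 01 E] bern_le_1[OF 01 E] by simp
  qed
qed (use W E in \<open>auto intro!: measurable_bern simp: graphon_def\<close>)

text \<open>Integrates 2 |f| d <= f^2 + d^2, which stands in for Cauchy-Schwarz.\<close>

lemma prob_space_L1_le_L2:
  assumes M: "prob_space M" and f: "f \<in> borel_measurable M" "\<And>x. x \<in> space M \<Longrightarrow> \<bar>f x\<bar> \<le> (1::real)"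
    and d: "0 < d" "(\<integral>x. (f x)\<^sup>2 \<partial>M) \<le> d\<^sup>2"
  shows "(\<integral>x. \<bar>f x\<bar> \<partial>M) \<le> d"
proof -
  interpret prob_space M by fact
  have i1: "integrable M (\<lambda>x. \<bar>f x\<bar>)"
    using f by (intro integrable_const_bound[where B=1]) auto
  have i2: "integrable M (\<lambda>x. (f x)\<^sup>2)"
    using f by (intro integrable_const_bound[where B=1]) (auto simp: abs_square_le_1)
  have "(\<integral>x. \<bar>f x\<bar> \<partial>M) \<le> (\<integral>x. ((f x)\<^sup>2 / d + d) / 2 \<partial>M)"
  proof (rule integral_mono[OF i1])
    show "integrable M (\<lambda>x. ((f x)\<^sup>2 / d + d) / 2)" using i2 by simp
    fix x
    have "0 \<le> (\<bar>f x\<bar> - d)\<^sup>2" by simp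
    then have "2 * \<bar>f x\<bar> * d \<le> (f x)\<^sup>2 + d\<^sup>2" by (simp add: power2_diff)
    then show "\<bar>f x\<bar> \<le> ((f x)\<^sup>2 / d + d) / 2" using d(1) by (simp add: field_simps power2_eq_square)
  qed
  also have "\<dots> = ((\<integral>x. (f x)\<^sup>2 \<partial>M) / d + d) / 2" using i2 by (simp add: prob_space)
  also have "\<dots> \<le> (d\<^sup>2 / d + d) / 2" using d by (intro divide_right_mono add_right_mono) auto
  also have "\<dots> = d" using d(1) by (simp add: power2_eq_square)
  finally show ?thesis .
qed

text \<open>The sum of the absolute increments has a finite integral, so it is finite almost
  everywhere, and there the telescoping series converges absolutely.\<close>

lemma AE_convergent_of_summable_L1:
  fixes f :: "nat \<Rightarrow> 'a \<Rightarrow> real"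
  assumes f: "\<And>k. integrable M (f k)"
    and b: "\<And>k. (\<integral>x. \<bar>f (Suc k) x - f k x\<bar> \<partial>M) \<le> b k" and "summable b"
  shows "AE x in M. convergent (\<lambda>k. f k x)"
proof -
  let ?d = "\<lambda>k x. \<bar>f (Suc k) x - f k x\<bar>"
  have int: "integrable M (?d k)" for k using f by auto
  have b0: "0 \<le> b k" for k using b[of k] by (intro order_trans[OF _ b[of k]]) simp
  have meas: "(\<lambda>x. ennreal (?d k x)) \<in> borel_measurable M" for k
    using borel_measurable_integrable[OF int] by simp
  have "(\<integral>\<^sup>+x. (\<Sum>k. ennreal (?d k x)) \<partial>M) = (\<Sum>k. \<integral>\<^sup>+x. ennreal (?d k x) \<partial>M)"
    by (rule nn_integral_suminf[OF meas])
  also have "\<dots> = (\<Sum>k. ennreal (\<integral>x. ?d k x \<partial>M))"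
    using int by (simp add: nn_integral_eq_integral)
  also have "\<dots> \<le> (\<Sum>k. ennreal (b k))" using b by (intro suminf_le ennreal_leI) auto
  also have "\<dots> = ennreal (suminf b)" using b0 \<open>summable b\<close> by (intro suminf_ennreal2) auto
  also have "\<dots> < \<infinity>" by simp
  finally have "(\<integral>\<^sup>+x. (\<Sum>k. ennreal (?d k x)) \<partial>M) \<noteq> \<infinity>" by simp
  moreover have "(\<lambda>x. \<Sum>k. ennreal (?d k x)) \<in> borel_measurable M"
    using meas by (rule borel_measurable_suminf_order)
  ultimately have "AE x in M. (\<Sum>k. ennreal (?d k x)) \<noteq> \<infinity>"
    by (intro nn_integral_PInf_AE)
  then show ?thesis
  proof eventually_elim
    case (elim x)
    then have "summable (\<lambda>k. ?d k x)" by (intro summable_suminf_not_top) auto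
    then have "summable (\<lambda>k. f (Suc k) x - f k x)" by (rule summable_rabs_cancel)
    then have "convergent (\<lambda>n. \<Sum>k<n. f (Suc k) x - f k x)" by (simp add: summable_iff_convergent)
    then have "convergent (\<lambda>n. f n x - f 0 x)" 
      unfolding sum_lessThan_telescope[of "\<lambda>k. f k x"] .
    then have "convergent (\<lambda>n. f n x - f 0 x + f 0 x)" by (intro convergent_add convergent_const)
    then show ?case by simp
  qed
qed

text \<open>\<open>\<epsilon>\<close> is the limiting energy; the last assumption makes the step graphons Cauchy in \<open>L\<^sup>2\<close>.\<close>

locale limit_blocks = limit_weights +
  fixes D :: "nat \<Rightarrow> nat \<Rightarrow> nat \<Rightarrow> real" and \<epsilon> :: "nat \<Rightarrow> real"
  assumes D_01: "D t i j \<in> {0..1}"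
    and D_sym: "D t i j = D t j i"
    and \<epsilon>_01: "\<epsilon> t \<in> {0..1}"
    and D_diff: "t \<le> s \<Longrightarrow> (\<Sum>i<4 ^ s. \<Sum>j<4 ^ s. w s i * w s j *
      (D s i j - D t (i div 4 ^ (s - t)) (j div 4 ^ (s - t)))\<^sup>2) = \<epsilon> s - \<epsilon> t"
begin

definition step :: "nat \<Rightarrow> real \<Rightarrow> real \<Rightarrow> real" where
  "step t x y = D t (lcode t x) (lcode t y)"

lemma measurable_step: "case_prod (step t) \<in> borel_measurable unit_square"
proof -
  have "(\<lambda>z. (\<lambda>(i, j). D t i j) (lcode t (fst z), lcode t (snd z))) \<in> borel_measurable unit_square"
    by (rule measurable_compose[where N="count_space UNIV \<Otimes>\<^sub>M count_space UNIV"])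
       (auto simp: pair_measure_countable)
  then show ?thesis by (simp add: step_def case_prod_unfold)
qed

lemma graphon_step: "graphon (step t)"
  unfolding graphon_def using measurable_step D_01 D_sym by (auto simp: step_def)

lemma step_L2:
  assumes "t \<le> s"
  shows "(\<integral>z. (step s (fst z) (snd z) - step t (fst z) (snd z))\<^sup>2 \<partial>unit_square) = \<epsilon> s - \<epsilon> t"
proof -
  let ?g = "\<lambda>i j. (D s i j - D t (i div 4 ^ (s - t)) (j div 4 ^ (s - t)))\<^sup>2"
  have "(\<integral>z. (step s (fst z) (snd z) - step t (fst z) (snd z))\<^sup>2 \<partial>unit_square) =
      (\<integral>z. ?g (lcode s (fst z)) (lcode s (snd z)) \<partial>unit_square)"
    by (rule Bochner_Integration.integral_cong[OF refl])
       (auto simp: space_pair_measure step_def lcode_div[OF _ assms])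
  also have "\<dots> = (\<Sum>i<4 ^ s. \<Sum>j<4 ^ s. measure unit_leb {x\<in>space unit_leb. lcode s x = i} *
      measure unit_leb {x\<in>space unit_leb. lcode s x = j} * ?g i j)"
    using lcode_props(1) by (intro integral_pair_codes prob_space_unit_leb measurable_lcode) auto
  also have "\<dots> = (\<Sum>i<4 ^ s. \<Sum>j<4 ^ s. w s i * w s j * ?g i j)"
    unfolding space_unit_leb by (intro sum.cong refl) (simp add: measure_lcode del: atLeastAtMost_iff)
  finally show ?thesis using D_diff[OF assms] by simp
qed

lemma graphon_prob_step:
  assumes I: "finite I" and E: "E \<subseteq> pairs I"
  shows "graphon_prob I E (step t) =
    (\<Sum>\<psi>\<in>I \<rightarrow>\<^sub>E {..<4 ^ t}. (\<Prod>u\<in>I. w t (\<psi> u)) * bern (pairs I) E (\<lambda>(u, v). D t (\<psi> u) (\<psi> v)))"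
proof -
  let ?g = "\<lambda>\<psi>. bern (pairs I) E (\<lambda>(u, v). D t (\<psi> u) (\<psi> v))"
  have "graphon_prob I E (step t) = (\<integral>x. ?g (\<lambda>u\<in>I. lcode t (x u)) \<partial>(\<Pi>\<^sub>M u\<in>I. unit_leb))"
    unfolding graphon_prob_def
    by (intro Bochner_Integration.integral_cong refl bern_cong E) (auto simp: pairs_def step_def)
  also have "\<dots> = (\<Sum>\<psi>\<in>I \<rightarrow>\<^sub>E {..<4 ^ t}. (\<Prod>u\<in>I. measure unit_leb {x\<in>space unit_leb. lcode t x = \<psi> u}) * ?g \<psi>)"
    using lcode_props(1) by (intro integral_PiM_codes prob_space_unit_leb measurable_lcode I) auto
  also have "\<dots> = (\<Sum>\<psi>\<in>I \<rightarrow>\<^sub>E {..<4 ^ t}. (\<Prod>u\<in>I. w t (\<psi> u)) * ?g \<psi>)"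
    unfolding space_unit_leb
    by (intro sum.cong refl arg_cong2[of _ _ _ _ "(*)"] prod.cong measure_lcode) auto
  finally show ?thesis .
qed

lemma \<epsilon>_mono: "t \<le> s \<Longrightarrow> \<epsilon> t \<le> \<epsilon> s"
  using step_L2[of t s] Bochner_Integration.integral_nonneg[of unit_square "\<lambda>z. (step s (fst z) (snd z) - step t (fst z) (snd z))\<^sup>2"]
  by simp

lemma \<epsilon>_convergent: "convergent \<epsilon>"
  using \<epsilon>_mono \<epsilon>_01 by (intro Bseq_monoseq_convergent BseqI'[of _ 1]) (auto simp: monoseq_def)

lemma step_subseq_limit:
  obtains \<tau> W where "strict_mono \<tau>" "graphon W"
    "AE z in unit_square. (\<lambda>k. step (\<tau> k) (fst z) (snd z)) \<longlonglongrightarrow> W (fst z) (snd z)"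
proof -
  have "Cauchy \<epsilon>" using \<epsilon>_convergent by (rule convergent_Cauchy)
  then have "\<exists>N. \<forall>m\<ge>N. \<forall>n\<ge>N. dist (\<epsilon> m) (\<epsilon> n) < (1 / 2 ^ k)\<^sup>2" for k :: nat
    unfolding Cauchy_def by simp
  then obtain N where N: "\<And>k m n. m \<ge> N k \<Longrightarrow> n \<ge> N k \<Longrightarrow> dist (\<epsilon> m) (\<epsilon> n) < (1 / 2 ^ k)\<^sup>2"
    by metis
  \<comment> \<open>Partial sums make \<open>\<tau>\<close> strictly increasing and at least as
    large as \<open>N\<close>. Energy differences are squared L2 distances, so consecutive step
    graphons along \<open>\<tau>\<close> are within 1 / 2^k in L1, a summable bound.\<close>
  define \<tau> where "\<tau> k = (\<Sum>j\<le>k. Suc (N j))" for k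
  have \<tau>: "strict_mono \<tau>" by (simp add: strict_mono_Suc_iff \<tau>_def)
  have \<tau>N: "N k \<le> \<tau> k" for k
    using member_le_sum[of k "{..k}" "\<lambda>j. Suc (N j)"] by (simp add: \<tau>_def)
  interpret prob_space unit_square by (rule prob_space_unit_square)
  let ?f = "\<lambda>k z. step (\<tau> k) (fst z) (snd z)"
  have meas: "?f k \<in> borel_measurable unit_square" for k
    using measurable_step[of "\<tau> k"] by (simp add: case_prod_unfold)
  have f01: "?f k z \<in> {0..1}" for k z using D_01 by (simp add: step_def)
  have "AE z in unit_square. convergent (\<lambda>k. ?f k z)"
  proof (rule AE_convergent_of_summable_L1[where b="\<lambda>k. 1 / 2 ^ k"])
    show "integrable unit_square (?f k)" for k
      using f01 meas by (intro integrable_const_bound[where B=1]) auto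
    show "summable (\<lambda>k. 1 / 2 ^ k :: real)" using summable_geometric[of "1/2::real"] by (simp add: power_one_over)
    show "(\<integral>z. \<bar>?f (Suc k) z - ?f k z\<bar> \<partial>unit_square) \<le> 1 / 2 ^ k" for k
    proof (rule prob_space_L1_le_L2[OF prob_space_unit_square])
      show "(\<lambda>z. ?f (Suc k) z - ?f k z) \<in> borel_measurable unit_square"
        using meas by (intro borel_measurable_diff)
      show "\<bar>?f (Suc k) z - ?f k z\<bar> \<le> 1" for z using f01[of k z] f01[of "Suc k" z] by auto
      have le: "\<tau> k \<le> \<tau> (Suc k)" using \<tau> by (simp add: strict_mono_less_eq)
      then have "N k \<le> \<tau> (Suc k)" using \<tau>N[of k] by simp
      then have "dist (\<epsilon> (\<tau> (Suc k))) (\<epsilon> (\<tau> k)) < (1 / 2 ^ k)\<^sup>2" using N \<tau>N by blast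
      then show "(\<integral>z. (?f (Suc k) z - ?f k z)\<^sup>2 \<partial>unit_square) \<le> (1 / 2 ^ k)\<^sup>2"
        unfolding step_L2[OF le] by (simp add: dist_real_def)
    qed simp
  qed
  note conv = this
  \<comment> \<open>\<open>lim\<close> is arbitrary where the sequence diverges. Clipping makes
    \<open>W\<close> a graphon at every point, and symmetry holds everywhere because each step
    graphon is symmetric.\<close>
  define W where "W x y = max 0 (min 1 (lim (\<lambda>k. step (\<tau> k) x y)))" for x y
  have "graphon W"
    unfolding graphon_def
  proof (intro conjI ballI)
    have "(\<lambda>z. lim (\<lambda>k. ?f k z)) \<in> borel_measurable unit_square"
      using meas by (rule borel_measurable_lim_metric)
    then show "case_prod W \<in> borel_measurable unit_square"
      unfolding W_def case_prod_unfold by (intro borel_measurable_max borel_measurable_min) auto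
    show "W x y = W y x" for x y using D_sym by (simp add: W_def step_def)
  qed (simp add: W_def)
  moreover have "AE z in unit_square. (\<lambda>k. ?f k z) \<longlonglongrightarrow> W (fst z) (snd z)"
    using conv
  proof eventually_elim
    case (elim z)
    then have L: "(\<lambda>k. ?f k z) \<longlonglongrightarrow> lim (\<lambda>k. ?f k z)" by (simp add: convergent_LIMSEQ_iff)
    have "0 \<le> lim (\<lambda>k. ?f k z)" "lim (\<lambda>k. ?f k z) \<le> 1"
      using f01 by (auto intro: LIMSEQ_le_const[OF L] LIMSEQ_le_const2[OF L])
    with L show ?case by (simp add: W_def)
  qed
  ultimately show thesis using \<tau> that by blast
qed

end

section \<open>The entropy of sampled graphs\<close>

text \<open>Only the point 0 needs an argument: ln t <= t - 1 at t = 1 / sqrt y gives |y ln y| <= 2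
  sqrt y for 0 < y < 1.\<close>

lemma continuous_on_xlog: "continuous_on {0..} (\<lambda>x::real. x * log 2 x)"
proof (rule continuous_on_eq_continuous_within[THEN iffD2], rule ballI)
  fix x :: real assume x: "x \<in> {0..}"
  show "continuous (at x within {0..}) (\<lambda>x. x * log 2 x)"
  proof (cases "x = 0")
    case True
    have "((\<lambda>x. x * log 2 x) \<longlongrightarrow> 0) (at_right (0::real))"
    proof (rule Lim_null_comparison[where g="\<lambda>x. 2 * sqrt x / ln 2"])
      show "\<forall>\<^sub>F x in at_right (0::real). norm (x * log 2 x) \<le> 2 * sqrt x / ln 2"
        unfolding eventually_at_right_field
      proof (intro exI[of _ 1] conjI allI impI)
        fix y :: real assume y: "0 < y" "y < 1"
        have s: "0 < sqrt y" using y by simp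
        have "ln (1 / sqrt y) \<le> 1 / sqrt y - 1" using s by (intro ln_le_minus_one) simp
        then have "- ln y \<le> 2 * (1 / sqrt y)" using y by (simp add: ln_div ln_sqrt)
        then have "y * - ln y \<le> y * (2 * (1 / sqrt y))" using y by (intro mult_left_mono) auto
        also have "\<dots> = 2 * (y / sqrt y)" by simp
        also have "\<dots> = 2 * sqrt y" using y by (simp only: real_div_sqrt less_imp_le)
        finally have "- (y * ln y) / ln 2 \<le> 2 * sqrt y / ln 2" by (intro divide_right_mono) auto
        moreover have "norm (y * log 2 y) = - (y * ln y) / ln 2"
          using y by (simp add: log_def abs_mult abs_of_neg)
        ultimately show "norm (y * log 2 y) \<le> 2 * sqrt y / ln 2" by simp
      qed simp
      have "((\<lambda>x. 2 * sqrt x / ln 2) \<longlongrightarrow> 2 * sqrt 0 / ln 2) (at_right 0)"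
        by (intro tendsto_intros) auto
      then show "((\<lambda>x. 2 * sqrt x / ln 2) \<longlongrightarrow> 0) (at_right 0)" by simp
    qed
    then show ?thesis using True
      by (simp add: continuous_within at_within_Ici_at_right)
  next
    case False
    then have "isCont (\<lambda>x. x * log 2 x) x" using x by (auto intro!: continuous_intros)
    then show ?thesis by (rule continuous_at_imp_continuous_at_within)
  qed
qed

lemma tendsto_xlog:
  assumes f: "(f \<longlongrightarrow> l) F" and pos: "\<And>m. 0 \<le> f m" and F: "F \<noteq> bot"
  shows "((\<lambda>m. f m * log 2 (f m)) \<longlongrightarrow> l * log 2 (l::real)) F"
proof -
  have "0 \<le> l" using f pos F by (intro tendsto_lowerbound[OF f]) auto
  then show ?thesis
    using continuous_on_tendsto_compose[OF continuous_on_xlog f] pos by simp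
qed

lemma binary_entropy_bounds:
  assumes "x \<in> {0..1}"
  shows "binary_entropy x \<in> {0..1}"
proof -
  have "0 \<le> - (x * log 2 x)" "0 \<le> - ((1 - x) * log 2 (1 - x))"
    using assms by (cases "x = 0"; simp add: mult_le_0_iff)
      (cases "x = 1"; use assms in \<open>simp add: mult_le_0_iff\<close>)
  then have "0 \<le> binary_entropy x" by (simp add: binary_entropy_def)
  moreover have "binary_entropy x \<le> 1"
  proof -
    \<comment> \<open>Gibbs' inequality against the uniform law on two points.\<close>
    have "(\<Sum>b\<in>UNIV. (if b then x else 1 - x) * log 2 (1 / 2)) \<le>
        (\<Sum>b\<in>UNIV. (if b then x else 1 - x) * log 2 (if b then x else 1 - x))"
      using assms by (intro gibbs_inequality) (auto simp: UNIV_bool)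
    then show ?thesis by (simp add: UNIV_bool binary_entropy_def log_divide)
  qed
  ultimately show ?thesis by simp
qed

lemma tendsto_binary_entropy:
  assumes f: "(f \<longlongrightarrow> l) F" and "\<And>m. f m \<in> {0..1}" "F \<noteq> bot"
  shows "((\<lambda>m. binary_entropy (f m)) \<longlongrightarrow> binary_entropy l) F"
proof -
  have "((\<lambda>m. (1 - f m) * log 2 (1 - f m)) \<longlongrightarrow> (1 - l) * log 2 (1 - l)) F"
    using assms by (intro tendsto_xlog tendsto_diff tendsto_const) auto
  moreover have "((\<lambda>m. f m * log 2 (f m)) \<longlongrightarrow> l * log 2 l) F"
    using assms by (intro tendsto_xlog) auto
  ultimately have "((\<lambda>m. - (f m * log 2 (f m)) - (1 - f m) * log 2 (1 - f m)) \<longlongrightarrow>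
      - (l * log 2 l) - (1 - l) * log 2 (1 - l)) F"
    by (intro tendsto_diff tendsto_minus)
  then show ?thesis by (simp add: binary_entropy_def)
qed

text \<open>This depends only on the densities of \<open>W\<close>, hence transfers entropy bounds between equivalent
  graphons.\<close>

definition sample_entropy :: "nat set \<Rightarrow> (real \<Rightarrow> real \<Rightarrow> real) \<Rightarrow> real" where
  "sample_entropy I W = - (\<Sum>E\<in>Pow (pairs I). graphon_prob I E W * log 2 (graphon_prob I E W))"

lemma bern_graphon_01:
  assumes "graphon W" "x \<in> space (\<Pi>\<^sub>M i\<in>I. unit_leb)" "p \<in> pairs I"
  shows "(case p of (u, v) \<Rightarrow> W (x u) (x v)) \<in> {0..1}"
  using space_PiM_unit_leb[OF assms(2)] assms by (auto simp: graphon_def pairs_def)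

lemma integrable_bern_graphon:
  assumes W: "graphon W" and I: "finite I" and E: "E \<subseteq> pairs I"
  shows "integrable (\<Pi>\<^sub>M i\<in>I. unit_leb) (\<lambda>x. bern (pairs I) E (\<lambda>(u, v). W (x u) (x v)))"
proof -
  interpret PP: prob_space "\<Pi>\<^sub>M i\<in>I. unit_leb" by (intro prob_space_PiM prob_space_unit_leb)
  show ?thesis
    using W E bern_nonneg[OF bern_graphon_01[OF W] E] bern_le_1[OF bern_graphon_01[OF W] E]
    by (intro PP.integrable_const_bound[where B=1] measurable_bern) (auto simp: graphon_def)
qed

lemma graphon_prob_nonneg:
  assumes W: "graphon W" and E: "E \<subseteq> pairs I"
  shows "0 \<le> graphon_prob I E W"
  unfolding graphon_prob_def
  using bern_nonneg[OF bern_graphon_01[OF W] E] by (rule Bochner_Integration.integral_nonneg)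

lemma sum_graphon_prob:
  assumes W: "graphon W" and I: "finite I"
  shows "(\<Sum>E\<in>Pow (pairs I). graphon_prob I E W) = 1"
proof -
  interpret PP: prob_space "\<Pi>\<^sub>M i\<in>I. unit_leb" by (intro prob_space_PiM prob_space_unit_leb)
  have "(\<Sum>E\<in>Pow (pairs I). graphon_prob I E W) =
      (\<integral>x. (\<Sum>E\<in>Pow (pairs I). bern (pairs I) E (\<lambda>(u, v). W (x u) (x v))) \<partial>(\<Pi>\<^sub>M u\<in>I. unit_leb))"
    unfolding graphon_prob_def
    by (rule Bochner_Integration.integral_sum[symmetric]) (use W I integrable_bern_graphon in auto)
  also have "\<dots> = 1" by (simp add: sum_bern[OF finite_pairs[OF I]] PP.prob_space)
  finally show ?thesis .
qed

lemma sample_entropy_tendsto: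
  assumes W: "\<And>k. graphon (U k)"
    and lim: "\<And>E. E \<subseteq> pairs I \<Longrightarrow> (\<lambda>k. graphon_prob I E (U k)) \<longlonglongrightarrow> graphon_prob I E W"
  shows "(\<lambda>k. sample_entropy I (U k)) \<longlonglongrightarrow> sample_entropy I W"
  unfolding sample_entropy_def
  using lim graphon_prob_nonneg[OF W]
  by (intro tendsto_minus tendsto_sum tendsto_xlog) auto

context limit_blocks
begin

definition entropy :: "nat \<Rightarrow> real" where
  "entropy t = (\<Sum>i<4 ^ t. \<Sum>j<4 ^ t. w t i * w t j * binary_entropy (D t i j))"

text \<open>The product weights make the indices of distinct vertices independent, and the vertices
  other than \<open>a\<close> and \<open>b\<close> sum out to 1.\<close>

lemma sum_PiE_marginal:
  assumes I: "finite I" "a \<in> I" "b \<in> I" "a \<noteq> b"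
  shows "(\<Sum>\<psi>\<in>I \<rightarrow>\<^sub>E {..<4 ^ t}. (\<Prod>u\<in>I. w t (\<psi> u)) * g (\<psi> a) (\<psi> b)) =
    (\<Sum>i<4 ^ t. \<Sum>j<4 ^ t. w t i * w t j * (g i j :: real))"
proof -
  let ?J = "I - {a, b}"
  have J: "I = insert a (insert b ?J)" "a \<notin> insert b ?J" "b \<notin> ?J" "finite ?J" using I by auto
  have "(\<Sum>\<psi>\<in>I \<rightarrow>\<^sub>E {..<4 ^ t}. (\<Prod>u\<in>I. w t (\<psi> u)) * g (\<psi> a) (\<psi> b)) =
     (\<Sum>\<psi>\<in>insert a (insert b ?J) \<rightarrow>\<^sub>E {..<4 ^ t}. (\<Prod>u\<in>insert a (insert b ?J). w t (\<psi> u)) * g (\<psi> a) (\<psi> b))"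
    using J(1) by simp
  also have "\<dots> = (\<Sum>\<psi>\<in>?J \<rightarrow>\<^sub>E {..<4 ^ t}. \<Sum>j<4 ^ t. \<Sum>i<4 ^ t.
      (\<Prod>u\<in>insert a (insert b ?J). w t ((\<psi>(b := j, a := i)) u)) * g i j)"
    unfolding sum_PiE_insert[OF J(2)] sum_PiE_insert[OF J(3)] using I by simp
  also have "\<dots> = (\<Sum>\<psi>\<in>?J \<rightarrow>\<^sub>E {..<4 ^ t}. \<Sum>j<4 ^ t. \<Sum>i<4 ^ t. (\<Prod>u\<in>?J. w t (\<psi> u)) * (w t i * w t j * g i j))"
  proof (intro sum.cong refl)
    fix \<psi> i j
    have "(\<Prod>u\<in>?J. w t ((\<psi>(b := j, a := i)) u)) = (\<Prod>u\<in>?J. w t (\<psi> u))"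
      by (intro prod.cong) auto
    then show "(\<Prod>u\<in>insert a (insert b ?J). w t ((\<psi>(b := j, a := i)) u)) * g i j =
        (\<Prod>u\<in>?J. w t (\<psi> u)) * (w t i * w t j * g i j)"
      using J(2-4) I by (simp add: prod.insert)
  qed
  also have "\<dots> = (\<Sum>\<psi>\<in>?J \<rightarrow>\<^sub>E {..<4 ^ t}. \<Prod>u\<in>?J. w t (\<psi> u)) * (\<Sum>j<4 ^ t. \<Sum>i<4 ^ t. w t i * w t j * g i j)"
    by (simp only: sum_distrib_right) (simp only: sum_distrib_left)
  also have "(\<Sum>\<psi>\<in>?J \<rightarrow>\<^sub>E {..<4 ^ t}. \<Prod>u\<in>?J. w t (\<psi> u)) = (\<Prod>u\<in>?J. \<Sum>i<4 ^ t. w t i)"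
    using J(4) by (intro prod_sum_PiE[symmetric]) auto
  also have "\<dots> = 1" by (simp add: w_sum)
  also have "(\<Sum>j<4 ^ t. \<Sum>i<4 ^ t. w t i * w t j * g i j) = (\<Sum>i<4 ^ t. \<Sum>j<4 ^ t. w t i * w t j * g i j)"
    by (rule sum.swap)
  finally show ?thesis by simp
qed

text \<open>Given the parts \<open>\<psi>\<close> of its vertices, the sampled graph has independent
  edges, and its entropy is a sum over pairs. The sampled law is the mixture over
  \<open>\<psi>\<close>, and a mixture has at least the average entropy of its components: this is
  Gibbs' inequality of each component against the mixture.\<close>

lemma sample_entropy_step:
  assumes I: "finite I"
  shows "real (card (pairs I)) * entropy t \<le> sample_entropy I (step t)"
proof -
  let ?P = "pairs I" and ?X = "I \<rightarrow>\<^sub>E {..<4 ^ t :: nat}"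
  let ?\<omega> = "\<lambda>\<psi>. \<Prod>u\<in>I. w t (\<psi> u)"
  let ?a = "\<lambda>\<psi> (u, v). D t (\<psi> u) (\<psi> v)"
  let ?\<mu> = "\<lambda>E. graphon_prob I E (step t)"
  have \<omega>: "0 \<le> ?\<omega> \<psi>" for \<psi> by (intro prod_nonneg) (simp add: w_nonneg)
  have fP: "finite ?P" using I by (rule finite_pairs)
  have fX: "finite ?X" using I by (simp add: finite_PiE)
  have a: "?a \<psi> p \<in> {0..1}" for \<psi> p using D_01 by (cases p) auto
  have \<mu>: "?\<mu> E = (\<Sum>\<psi>\<in>?X. ?\<omega> \<psi> * bern ?P E (?a \<psi>))" if "E \<in> Pow ?P" for E
    using graphon_prob_step[OF I] that by simp
  have main: "?\<omega> \<psi> * (\<Sum>E\<in>Pow ?P. bern ?P E (?a \<psi>) * log 2 (?\<mu> E)) \<le>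
      ?\<omega> \<psi> * - (\<Sum>p\<in>?P. binary_entropy (?a \<psi> p))" if \<psi>: "\<psi> \<in> ?X" for \<psi>
  \<comment> \<open>Only a component of positive weight is dominated by the mixture, as Gibbs'
    inequality demands.\<close>
  proof (cases "?\<omega> \<psi> = 0")
    case False
    then have pos: "0 < ?\<omega> \<psi>" using \<omega>[of \<psi>] by simp
    have "(\<Sum>E\<in>Pow ?P. bern ?P E (?a \<psi>) * log 2 (?\<mu> E)) \<le>
        (\<Sum>E\<in>Pow ?P. bern ?P E (?a \<psi>) * log 2 (bern ?P E (?a \<psi>)))"
    proof (rule gibbs_inequality)
      fix E assume E: "E \<in> Pow ?P"
      have b: "0 \<le> bern ?P E (?a \<psi>)" for \<psi> using E by (intro bern_nonneg a) auto
      then show "0 \<le> bern ?P E (?a \<psi>)" .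
      show "0 \<le> ?\<mu> E" using E by (intro graphon_prob_nonneg graphon_step) auto
      assume "0 < bern ?P E (?a \<psi>)"
      then have "0 < ?\<omega> \<psi> * bern ?P E (?a \<psi>)" using pos by simp
      also have "\<dots> \<le> ?\<mu> E"
        unfolding \<mu>[OF E] using fX \<psi> \<omega> b
        by (intro member_le_sum[of \<psi> ?X "\<lambda>\<psi>. ?\<omega> \<psi> * bern ?P E (?a \<psi>)"] mult_nonneg_nonneg)
      finally show "0 < ?\<mu> E" .
    next
      show "(\<Sum>E\<in>Pow ?P. ?\<mu> E) \<le> (\<Sum>E\<in>Pow ?P. bern ?P E (?a \<psi>))"
        using sum_graphon_prob[OF graphon_step I] sum_bern[OF fP] by simp
    qed (use fP in auto)
    also have "\<dots> = - (\<Sum>p\<in>?P. binary_entropy (?a \<psi> p))"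
      using a by (intro bern_entropy fP)
    finally show ?thesis using pos by (intro mult_left_mono) auto
  qed simp
  have "- sample_entropy I (step t) = (\<Sum>E\<in>Pow ?P. (\<Sum>\<psi>\<in>?X. ?\<omega> \<psi> * bern ?P E (?a \<psi>)) * log 2 (?\<mu> E))"
    unfolding sample_entropy_def minus_minus by (intro sum.cong refl) (simp only: \<mu>)
  also have "\<dots> = (\<Sum>E\<in>Pow ?P. \<Sum>\<psi>\<in>?X. ?\<omega> \<psi> * (bern ?P E (?a \<psi>) * log 2 (?\<mu> E)))"
    by (simp add: sum_distrib_right mult.assoc)
  also have "\<dots> = (\<Sum>\<psi>\<in>?X. ?\<omega> \<psi> * (\<Sum>E\<in>Pow ?P. bern ?P E (?a \<psi>) * log 2 (?\<mu> E)))"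
    by (subst sum.swap) (simp add: sum_distrib_left)
  also have "\<dots> \<le> (\<Sum>\<psi>\<in>?X. ?\<omega> \<psi> * - (\<Sum>p\<in>?P. binary_entropy (?a \<psi> p)))"
    by (rule sum_mono) (rule main)
  also have "\<dots> = - (\<Sum>\<psi>\<in>?X. \<Sum>p\<in>?P. ?\<omega> \<psi> * binary_entropy (?a \<psi> p))"
    by (simp add: sum_negf sum_distrib_left)
  also have "(\<Sum>\<psi>\<in>?X. \<Sum>p\<in>?P. ?\<omega> \<psi> * binary_entropy (?a \<psi> p)) = (\<Sum>p\<in>?P. \<Sum>\<psi>\<in>?X. ?\<omega> \<psi> * binary_entropy (?a \<psi> p))"
    by (rule sum.swap)
  also have "\<dots> = (\<Sum>p\<in>?P. entropy t)"
  proof (intro sum.cong refl)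
    fix p assume "p \<in> ?P"
    then show "(\<Sum>\<psi>\<in>?X. ?\<omega> \<psi> * binary_entropy (?a \<psi> p)) = entropy t"
      using sum_PiE_marginal[OF I, of "fst p" "snd p" t "\<lambda>i j. binary_entropy (D t i j)"]
      by (auto simp: entropy_def pairs_def case_prod_unfold)
  qed
  finally show ?thesis by simp
qed

end

section \<open>Limits of dense sequences of graphs\<close>

lemma wt_sum:
  assumes V: "finite V" "V \<noteq> {}" and N: "f ` V \<subseteq> {..<N}"
  shows "(\<Sum>i<N. wt V f i) = 1"
proof -
  have "wt V (\<lambda>_. 0) 0 = (\<Sum>j<N. wt V f j * of_bool ((0::nat) = 0))"
    using V N by (intro wt_coarsen[where k="\<lambda>_. 0"]) auto
  then show ?thesis using V by (simp add: wt_def)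
qed

text \<open>The same finite formula as in \<open>graphon_prob_step\<close>, with the block data of a
  graph in place of their limits. Convergence at a fixed level is thus convergence of a finite
  sum.\<close>

lemma hom_density_blk:
  assumes V: "finite V" "V \<noteq> {}" and I: "finite I" and E: "E \<subseteq> pairs I" and f: "f ` V \<subseteq> {..<N}"
  shows "hom_density I (pairs I) E V (blk V A f) =
    (\<Sum>\<psi>\<in>I \<rightarrow>\<^sub>E {..<N}. (\<Prod>u\<in>I. wt V f (\<psi> u)) * bern (pairs I) E (\<lambda>(u, v). dens V A f (\<psi> u) (\<psi> v)))"
proof -
  have "hom_density I (pairs I) E V (blk V A f) =
      (\<Sum>\<phi>\<in>I \<rightarrow>\<^sub>E V. bern (pairs I) E (\<lambda>(u, v). dens V A f ((\<lambda>u\<in>I. f (\<phi> u)) u) ((\<lambda>u\<in>I. f (\<phi> u)) v))) / real (card V) ^ card I"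
    unfolding hom_density_def
    by (intro arg_cong2[of _ _ _ _ "(/)"] sum.cong refl bern_cong E) (auto simp: blk_def pairs_def)
  also have "\<dots> = (\<Sum>\<psi>\<in>I \<rightarrow>\<^sub>E {..<N}. (\<Prod>u\<in>I. wt V f (\<psi> u)) * bern (pairs I) E (\<lambda>(u, v). dens V A f (\<psi> u) (\<psi> v)))"
    by (rule sum_PiE_codes[OF V I f])
  finally show ?thesis .
qed

text \<open>For a fixed level \<open>t\<close>, \<open>ent\<close> applies to all graphs from index
  \<open>t\<close> on, so the limiting step graphon of each level has entropy at least
  \<open>c\<close>. The bound passes to \<open>W\<close> in the form of sampled entropies, since
  these depend continuously on the densities.\<close>

lemma graph_sequence_limit:
  fixes n :: "nat \<Rightarrow> nat" and G :: "nat \<Rightarrow> sgraph"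
  assumes G: "\<And>m. G m \<in> labelled_graphs (n m)" and n: "filterlim n at_top sequentially"
    and ent: "\<And>t m. t \<le> m \<Longrightarrow>
      c - 2 / real (Suc m) \<le> block_entropy {1..n m} (adj (G m)) (code {1..n m} (adj (G m)) t) (4 ^ t)"
  obtains r W where "strict_mono r" "graphon W"
    "\<And>H. simple_graph H \<Longrightarrow> (\<lambda>m. graph_density H (G (r m))) \<longlonglongrightarrow> graphon_density H W"
    "\<And>I. finite I \<Longrightarrow> real (card (pairs I)) * c \<le> sample_entropy I W"
proof -
  define V where "V m = {1..n m}" for m
  define A where "A m = adj (G m)" for m
  define f where "f m t = code (V m) (A m) t" for m t
  \<comment> \<open>All numerical data with values in [0,1] are packed into one countable family,
    tagged by \<open>b\<close>, so that a single diagonal subsequence makes everything converge;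
    indices irrelevant to a tag are ignored.\<close>
  define data where "data m = (\<lambda>(b::nat, t::nat, i::nat, j::nat).
     if b = 0 then wt (V m) (f m t) i else if b = 1 then mass (V m) (A m) (f m t) i j
     else if b = 2 then cutdev (V m) (A m) (f m t) else energy (V m) (A m) (f m t))" for m
  have fV: "finite (V m)" for m by (simp add: V_def)
  have sg: "simple_graph (G m)" "verts (G m) = V m" for m
    using G[of m] by (auto simp: labelled_graphs_def V_def)
  have neV: "V m \<noteq> {}" for m using sg[of m] by (simp add: simple_graph_def)
  have A: "A m u v \<in> {0..1}" for m u v using adj_01 by (simp add: A_def)
  have A_sym: "A m u v = A m v u" for m u v unfolding A_def by (rule adj_sym)
  have fN: "f m t ` V m \<subseteq> {..<4 ^ t}" for m t using code_less by (auto simp: f_def)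
  have f_div: "f m t u = f m s u div 4 ^ (s - t)" if "t \<le> s" for m t s u
    unfolding f_def by (rule code_div[OF that])
  have wt01: "wt (V m) (f m t) i \<in> {0..1}" for m t i using wt_bounds[OF fV] .
  have mass0: "0 \<le> mass (V m) (A m) (f m t) i j" for m t i j
    using mass_bounds(1)[where A="A m", OF fV A] .
  have massw: "mass (V m) (A m) (f m t) i j \<le> wt (V m) (f m t) i * wt (V m) (f m t) j" for m t i j
    using mass_bounds(2)[where A="A m", OF fV A] .
  have dens01: "dens (V m) (A m) (f m t) i j \<in> {0..1}" for m t i j
    using dens_bounds[where A="A m", OF fV A] .
  have energy01: "energy (V m) (A m) (f m t) \<in> {0..1}" for m t
    by (rule energy_bounds[where A="A m", OF fV A])
  have cut01: "cutdev (V m) (A m) (f m t) \<in> {0..1}" for m t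
    by (rule cutdev_bounds[where A="A m", OF fV A])
  have data01: "data m x \<in> {0..1}" for m x
  proof -
    have "mass (V m) (A m) (f m t) i j \<in> {0..1}" for t i j
      using mass0[of m t i j] massw[of m t i j] wt01[of m t i] wt01[of m t j]
      by (auto intro: order_trans mult_le_one)
    then show ?thesis using wt01[of m] energy01[of m] cut01[of m] by (cases x) (simp add: data_def)
  qed
  obtain r where r: "strict_mono r" "\<And>x. convergent (\<lambda>m. data (r m) x)"
    using diagonal_convergent_subseq[of data, OF data01] by blast
  define l where "l x = lim (\<lambda>m. data (r m) x)" for x
  have l: "(\<lambda>m. data (r m) x) \<longlonglongrightarrow> l x" for x
    using r(2)[of x] by (simp add: l_def convergent_LIMSEQ_iff)
  define w where "w t i = l (0, t, i, 0)" for t i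
  define M where "M t i j = l (1, t, i, j)" for t i j
  define q where "q t = l (2, t, 0, 0)" for t
  define \<epsilon> where "\<epsilon> t = l (3, t, 0, 0)" for t
  define D where "D t i j = M t i j / (w t i * w t j)" for t i j
  have w_lim: "(\<lambda>m. wt (V (r m)) (f (r m) t) i) \<longlonglongrightarrow> w t i" for t i
    using l[of "(0, t, i, 0)"] by (simp add: data_def w_def)
  have M_lim: "(\<lambda>m. mass (V (r m)) (A (r m)) (f (r m) t) i j) \<longlonglongrightarrow> M t i j" for t i j
    using l[of "(1, t, i, j)"] by (simp add: data_def M_def)
  have q_lim: "(\<lambda>m. cutdev (V (r m)) (A (r m)) (f (r m) t)) \<longlonglongrightarrow> q t" for t
    using l[of "(2, t, 0, 0)"] by (simp add: data_def q_def)
  have \<epsilon>_lim: "(\<lambda>m. energy (V (r m)) (A (r m)) (f (r m) t)) \<longlonglongrightarrow> \<epsilon> t" for t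
    using l[of "(3, t, 0, 0)"] by (simp add: data_def \<epsilon>_def)
  have D_lim: "(\<lambda>m. dens (V (r m)) (A (r m)) (f (r m) t) i j) \<longlonglongrightarrow> D t i j"
    if "w t i \<noteq> 0" "w t j \<noteq> 0" for t i j
    unfolding dens_def D_def using that by (intro tendsto_intros M_lim w_lim) auto
  have w0: "0 \<le> w t i" for t i
    using wt01 by (intro LIMSEQ_le_const[OF w_lim]) auto
  have wsum: "(\<Sum>i<4 ^ t. w t i) = 1" for t
  proof (rule LIMSEQ_unique)
    show "(\<lambda>m. \<Sum>i<4 ^ t. wt (V (r m)) (f (r m) t) i) \<longlonglongrightarrow> (\<Sum>i<4 ^ t. w t i)"
      by (intro tendsto_sum w_lim)
    show "(\<lambda>m. \<Sum>i<4 ^ t. wt (V (r m)) (f (r m) t) i) \<longlonglongrightarrow> 1"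
      by (simp add: wt_sum[OF fV neV fN])
  qed
  have wcons: "w t i = (\<Sum>j<4 ^ Suc t. w (Suc t) j * of_bool (j div 4 = i))" for t i
  proof (rule LIMSEQ_unique[OF w_lim])
    have "(\<lambda>m. \<Sum>j<4 ^ Suc t. wt (V (r m)) (f (r m) (Suc t)) j * of_bool (j div 4 = i)) \<longlonglongrightarrow>
        (\<Sum>j<4 ^ Suc t. w (Suc t) j * of_bool (j div 4 = i))"
      by (intro tendsto_sum tendsto_mult w_lim tendsto_const)
    moreover have "wt (V m) (f m t) i = (\<Sum>j<4 ^ Suc t. wt (V m) (f m (Suc t)) j * of_bool (j div 4 = i))" for m
      by (rule wt_coarsen[OF fV neV _ fN]) (use f_div[of t "Suc t"] in simp)
    ultimately show "(\<lambda>m. wt (V (r m)) (f (r m) t) i) \<longlonglongrightarrow> (\<Sum>j<4 ^ Suc t. w (Suc t) j * of_bool (j div 4 = i))"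
      by simp
  qed
  interpret limit_weights w
    using w0 wsum wcons by unfold_locales
  \<comment> \<open>A part of positive limiting weight lies in coarser parts of positive limiting
    weight, so wherever the fine density converges the coarse density does as well.\<close>
  have w_div: "w t (i div 4 ^ (s - t)) \<noteq> 0" if "w s i \<noteq> 0" "t \<le> s" "i < 4 ^ s" for t s i
  proof -
    have "wt (V m) (f m s) i \<le> wt (V m) (f m t) (i div 4 ^ (s - t))" for m
      unfolding wt_def
      by (intro divide_right_mono of_nat_mono card_mono) (use fV f_div[OF that(2)] in auto)
    then have "w s i \<le> w t (i div 4 ^ (s - t))"
      by (intro LIMSEQ_le[OF w_lim w_lim]) auto
    then show ?thesis using that(1) w0[of s i] by linarith
  qed
  have M0: "0 \<le> M t i j" for t i j
    using mass0 by (intro LIMSEQ_le_const[OF M_lim]) auto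
  have Mw: "M t i j \<le> w t i * w t j" for t i j
    using massw by (intro LIMSEQ_le[OF M_lim tendsto_mult[OF w_lim w_lim]]) auto
  have D01: "D t i j \<in> {0..1}" for t i j
  proof -
    have "D t i j \<le> 1" unfolding D_def using M0[of t i j] Mw[of t i j]
      by (intro divide_le_eq_1[THEN iffD2]) (metis order_trans order_less_le)
    moreover have "0 \<le> D t i j"
      unfolding D_def using M0 w0 by (intro divide_nonneg_nonneg mult_nonneg_nonneg)
    ultimately show ?thesis by simp
  qed
  have Dsym: "D t i j = D t j i" for t i j
  proof -
    have "mass (V m) (A m) (f m t) i j = mass (V m) (A m) (f m t) j i" for m
      by (rule mass_sym) (rule A_sym)
    then have "M t i j = M t j i" using M_lim[of t i j] M_lim[of t j i] LIMSEQ_unique by simp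
    then show ?thesis by (simp add: D_def mult.commute)
  qed
  have \<epsilon>01: "\<epsilon> t \<in> {0..1}" for t
    using energy01 by (auto intro: LIMSEQ_le_const[OF \<epsilon>_lim] LIMSEQ_le_const2[OF \<epsilon>_lim])
  have Ddiff: "(\<Sum>i<4 ^ s. \<Sum>j<4 ^ s. w s i * w s j *
      (D s i j - D t (i div 4 ^ (s - t)) (j div 4 ^ (s - t)))\<^sup>2) = \<epsilon> s - \<epsilon> t" if ts: "t \<le> s" for s t
  proof -
    let ?X = "{..<4 ^ s} \<times> {..<4 ^ s} :: (nat \<times> nat) set"
    let ?k = "\<lambda>i. i div 4 ^ (s - t)"
    let ?d = "\<lambda>m t. dens (V (r m)) (A (r m)) (f (r m) t)"
    let ?g = "\<lambda>m (i, j). (?d m s i j - ?d m t (?k i) (?k j))\<^sup>2"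
    let ?ww = "\<lambda>m (i, j). wt (V (r m)) (f (r m) s) i * wt (V (r m)) (f (r m) s) j"
    have "(\<Sum>x\<in>?X. ?ww m x * ?g m x) = energy (V (r m)) (A (r m)) (f (r m) s) - energy (V (r m)) (A (r m)) (f (r m) t)" for m
    proof -
      have n0: "(real (card (V (r m))))\<^sup>2 \<noteq> 0" using fV neV by simp
      have "energy (V (r m)) (A (r m)) (f (r m) s) - energy (V (r m)) (A (r m)) (f (r m) t) =
        (\<Sum>u\<in>V (r m). \<Sum>v\<in>V (r m). (blk (V (r m)) (A (r m)) (f (r m) s) u v - blk (V (r m)) (A (r m)) (f (r m) t) u v)\<^sup>2) / (real (card (V (r m))))\<^sup>2"
        by (rule energy_diff[where A="A (r m)" and k="?k", OF fV A f_div[OF ts], symmetric])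
      also have "(\<Sum>u\<in>V (r m). \<Sum>v\<in>V (r m). (blk (V (r m)) (A (r m)) (f (r m) s) u v - blk (V (r m)) (A (r m)) (f (r m) t) u v)\<^sup>2) =
        (\<Sum>u\<in>V (r m). \<Sum>v\<in>V (r m). ?g m (f (r m) s u, f (r m) s v))"
        by (simp add: blk_def f_div[OF ts])
      also have "\<dots> = (real (card (V (r m))))\<^sup>2 * (\<Sum>i<4 ^ s. \<Sum>j<4 ^ s. ?ww m (i, j) * ?g m (i, j))"
        using block_sum_const[OF fV fN, of "\<lambda>i j. ?g m (i, j)"] by simp
      finally show ?thesis using n0 by (simp add: sum.cartesian_product case_prod_unfold)
    qed
    moreover have "(\<lambda>m. \<Sum>x\<in>?X. ?ww m x * ?g m x) \<longlonglongrightarrow>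
      (\<Sum>x\<in>?X. (case x of (i, j) \<Rightarrow> w s i * w s j) * (case x of (i, j) \<Rightarrow> (D s i j - D t (?k i) (?k j))\<^sup>2))"
    proof (rule tendsto_weighted_sum[where C=1])
      fix x assume x: "x \<in> ?X"
      obtain i j where ij: "x = (i, j)" by (cases x)
      show "(\<lambda>m. ?ww m x) \<longlonglongrightarrow> (case x of (i, j) \<Rightarrow> w s i * w s j)"
        by (simp add: ij tendsto_mult w_lim)
      show "\<bar>?g m x\<bar> \<le> 1" for m
      proof -
        have "\<bar>?d m s i j - ?d m t (?k i) (?k j)\<bar> \<le> 1"
          using dens01[of "r m" s i j] dens01[of "r m" t "?k i" "?k j"] by auto
        then show ?thesis by (simp add: ij abs_square_le_1)
      qed
      assume "(case x of (i, j) \<Rightarrow> w s i * w s j) \<noteq> 0"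
      then have "w s i \<noteq> 0" "w s j \<noteq> 0" by (auto simp: ij)
      moreover have "i < 4 ^ s" "j < 4 ^ s" using x ij by auto
      ultimately have "(\<lambda>m. (?d m s i j - ?d m t (?k i) (?k j))\<^sup>2) \<longlonglongrightarrow> (D s i j - D t (?k i) (?k j))\<^sup>2"
        by (intro tendsto_power tendsto_diff D_lim w_div ts)
      then show "(\<lambda>m. ?g m x) \<longlonglongrightarrow> (case x of (i, j) \<Rightarrow> (D s i j - D t (?k i) (?k j))\<^sup>2)"
        by (simp add: ij)
    qed
    moreover have "(\<lambda>m. energy (V (r m)) (A (r m)) (f (r m) s) - energy (V (r m)) (A (r m)) (f (r m) t)) \<longlonglongrightarrow> \<epsilon> s - \<epsilon> t"
      by (intro tendsto_diff \<epsilon>_lim)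
    ultimately have "(\<Sum>x\<in>?X. (case x of (i, j) \<Rightarrow> w s i * w s j) * (case x of (i, j) \<Rightarrow> (D s i j - D t (?k i) (?k j))\<^sup>2)) = \<epsilon> s - \<epsilon> t"
      by (simp add: LIMSEQ_unique)
    then show ?thesis by (simp add: sum.cartesian_product case_prod_unfold)
  qed
  interpret limit_blocks w D \<epsilon>
    using D01 Dsym \<epsilon>01 Ddiff by unfold_locales
  have q0: "0 \<le> q t" for t
    using cut01 by (auto intro: LIMSEQ_le_const[OF q_lim])
  \<comment> \<open>The energy increment survives the limit along the graphs. The limiting energies
    \<open>\<epsilon>\<close> increase and are bounded, so their increments, and with them
    \<open>q\<close>, tend to 0.\<close>
  have q_le: "(q t)\<^sup>2 \<le> \<epsilon> (Suc t) - \<epsilon> t" for t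
  proof (rule LIMSEQ_le)
    show "(\<lambda>m. (cutdev (V (r m)) (A (r m)) (f (r m) t))\<^sup>2) \<longlonglongrightarrow> (q t)\<^sup>2"
      by (intro tendsto_power q_lim)
    show "(\<lambda>m. energy (V (r m)) (A (r m)) (f (r m) (Suc t)) - energy (V (r m)) (A (r m)) (f (r m) t)) \<longlonglongrightarrow> \<epsilon> (Suc t) - \<epsilon> t"
      by (intro tendsto_diff \<epsilon>_lim)
    show "\<exists>N. \<forall>m\<ge>N. (cutdev (V (r m)) (A (r m)) (f (r m) t))\<^sup>2 \<le>
        energy (V (r m)) (A (r m)) (f (r m) (Suc t)) - energy (V (r m)) (A (r m)) (f (r m) t)"
      unfolding f_def using code_energy_increment[where V="V (r _)" and A="A (r _)", OF fV A] by blast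
  qed
  have \<epsilon>_null: "(\<lambda>t. \<epsilon> (Suc t) - \<epsilon> t) \<longlonglongrightarrow> 0"
  proof -
    obtain e where e: "\<epsilon> \<longlonglongrightarrow> e" using \<epsilon>_convergent by (auto simp: convergent_def)
    have "(\<lambda>t. \<epsilon> (Suc t) - \<epsilon> t) \<longlonglongrightarrow> e - e"
      by (intro tendsto_diff e LIMSEQ_Suc)
    then show ?thesis by simp
  qed
  have "(\<lambda>t. (q t)\<^sup>2) \<longlonglongrightarrow> 0"
    by (rule real_tendsto_sandwich[OF _ _ tendsto_const \<epsilon>_null]) (simp_all add: q_le)
  then have "(\<lambda>t. sqrt ((q t)\<^sup>2)) \<longlonglongrightarrow> sqrt 0" by (intro tendsto_real_sqrt)
  then have q_null: "q \<longlonglongrightarrow> 0" using q0 by simp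
  have ww_lim: "(\<lambda>m. \<Prod>u\<in>I. wt (V (r m)) (f (r m) t) (\<psi> u)) \<longlonglongrightarrow> (\<Prod>u\<in>I. w t (\<psi> u))" for I t and \<psi> :: "nat \<Rightarrow> nat"
    by (intro tendsto_prod w_lim)
  have blk_lim: "(\<lambda>m. hom_density I (pairs I) E (V (r m)) (blk (V (r m)) (A (r m)) (f (r m) t))) \<longlonglongrightarrow>
      graphon_prob I E (step t)" if I: "finite I" and E: "E \<subseteq> pairs I" for I E t
    unfolding hom_density_blk[OF fV neV I E fN] graphon_prob_step[OF I E]
  proof (rule tendsto_weighted_sum[where C=1, OF ww_lim])
    fix \<psi> :: "nat \<Rightarrow> nat" and m
    have d: "(case p of (u, v) \<Rightarrow> dens (V (r m)) (A (r m)) (f (r m) t) (\<psi> u) (\<psi> v)) \<in> {0..1}" for p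
      using dens01 by (cases p) auto
    show "\<bar>bern (pairs I) E (\<lambda>(u, v). dens (V (r m)) (A (r m)) (f (r m) t) (\<psi> u) (\<psi> v))\<bar> \<le> 1"
      using bern_nonneg[OF d E] bern_le_1[OF d E] by simp
  next
    fix \<psi> :: "nat \<Rightarrow> nat" assume "(\<Prod>u\<in>I. w t (\<psi> u)) \<noteq> 0"
    then have nz: "w t (\<psi> u) \<noteq> 0" if "u \<in> I" for u using that I by auto
    show "(\<lambda>m. bern (pairs I) E (\<lambda>(u, v). dens (V (r m)) (A (r m)) (f (r m) t) (\<psi> u) (\<psi> v))) \<longlonglongrightarrow>
        bern (pairs I) E (\<lambda>(u, v). D t (\<psi> u) (\<psi> v))"
      unfolding bern_def case_prod_unfold
      by (intro tendsto_mult tendsto_prod tendsto_diff tendsto_const D_lim nz) (use E in \<open>auto simp: pairs_def\<close>)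
  qed
  obtain \<tau> W where \<tau>: "strict_mono \<tau>" and W: "graphon W"
    and lim: "AE z in unit_square. (\<lambda>k. step (\<tau> k) (fst z) (snd z)) \<longlonglongrightarrow> W (fst z) (snd z)"
    by (rule step_subseq_limit)
  have prob_lim: "(\<lambda>k. graphon_prob I E (step (\<tau> k))) \<longlonglongrightarrow> graphon_prob I E W"
    if "finite I" "E \<subseteq> pairs I" for I E
    using that by (intro graphon_prob_tendsto graphon_step W lim)
  have ent_t: "c \<le> entropy t" for t
  proof -
    let ?X = "{..<4 ^ t} \<times> {..<4 ^ t} :: (nat \<times> nat) set"
    have "(\<lambda>m. \<Sum>x\<in>?X. (case x of (i, j) \<Rightarrow> wt (V (r m)) (f (r m) t) i * wt (V (r m)) (f (r m) t) j) *
          (case x of (i, j) \<Rightarrow> binary_entropy (dens (V (r m)) (A (r m)) (f (r m) t) i j))) \<longlonglongrightarrow>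
        (\<Sum>x\<in>?X. (case x of (i, j) \<Rightarrow> w t i * w t j) * (case x of (i, j) \<Rightarrow> binary_entropy (D t i j)))"
    proof (rule tendsto_weighted_sum[where C=1])
      fix x :: "nat \<times> nat"
      obtain i j where ij: "x = (i, j)" by (cases x)
      show "(\<lambda>m. case x of (i, j) \<Rightarrow> wt (V (r m)) (f (r m) t) i * wt (V (r m)) (f (r m) t) j) \<longlonglongrightarrow> (case x of (i, j) \<Rightarrow> w t i * w t j)"
        by (simp add: ij tendsto_mult w_lim)
      show "\<bar>case x of (i, j) \<Rightarrow> binary_entropy (dens (V (r m)) (A (r m)) (f (r m) t) i j)\<bar> \<le> 1" for m
        using binary_entropy_bounds[OF dens01[of "r m" t i j]] by (simp add: ij)
      assume "(case x of (i, j) \<Rightarrow> w t i * w t j) \<noteq> 0"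
      then show "(\<lambda>m. case x of (i, j) \<Rightarrow> binary_entropy (dens (V (r m)) (A (r m)) (f (r m) t) i j)) \<longlonglongrightarrow>
          (case x of (i, j) \<Rightarrow> binary_entropy (D t i j))"
        using tendsto_binary_entropy[OF D_lim, of t i j] dens01 by (simp add: ij)
    qed
    then have "(\<lambda>m. block_entropy (V (r m)) (A (r m)) (f (r m) t) (4 ^ t)) \<longlonglongrightarrow> entropy t"
      by (simp add: block_entropy_def entropy_def sum.cartesian_product case_prod_unfold)
    moreover have "(\<lambda>m. c - 2 * inverse (real (Suc (r m)))) \<longlonglongrightarrow> c - 2 * 0"
      using LIMSEQ_subseq_LIMSEQ[OF LIMSEQ_inverse_real_of_nat r(1)]
      by (intro tendsto_diff tendsto_mult tendsto_const) (simp add: o_def)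
    moreover have "c - 2 * inverse (real (Suc (r m))) \<le> block_entropy (V (r m)) (A (r m)) (f (r m) t) (4 ^ t)" if "m \<ge> t" for m
      using ent[of t "r m"] that seq_suble[OF r(1), of m]
      by (simp add: V_def A_def f_def divide_inverse)
    ultimately show ?thesis by (intro LIMSEQ_le) auto
  qed
  have "real (card (pairs I)) * c \<le> sample_entropy I W" if I: "finite I" for I
  proof (rule LIMSEQ_le_const)
    show "(\<lambda>k. sample_entropy I (step (\<tau> k))) \<longlonglongrightarrow> sample_entropy I W"
      by (intro sample_entropy_tendsto graphon_step prob_lim I)
    have "real (card (pairs I)) * c \<le> sample_entropy I (step (\<tau> k))" for k
      using mult_left_mono[OF ent_t[of "\<tau> k"], of "real (card (pairs I))"] sample_entropy_step[OF I, of "\<tau> k"]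
      by simp
    then show "\<exists>N. \<forall>k\<ge>N. real (card (pairs I)) * c \<le> sample_entropy I (step (\<tau> k))" by blast
  qed
  moreover have "(\<lambda>m. graph_density H (G (r m))) \<longlonglongrightarrow> graphon_density H W" if H: "simple_graph H" for H
  proof (rule LIMSEQ_I)
    fix e :: real assume e: "0 < e"
    let ?I = "verts H" and ?E = "epairs H"
    let ?P = "pairs ?I"
    have I: "finite ?I" using H by (simp add: simple_graph_def)
    have E: "?E \<subseteq> ?P" by (rule epairs_subset)
    have "(\<lambda>k. real (card ?P) * q (\<tau> k)) \<longlonglongrightarrow> real (card ?P) * 0"
      using LIMSEQ_subseq_LIMSEQ[OF q_null \<tau>] by (intro tendsto_mult tendsto_const) (simp add: o_def)
    then have "\<forall>\<^sub>F k in sequentially. real (card ?P) * q (\<tau> k) < e / 4"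
      using e by (intro order_tendstoD(2)) auto
    moreover have "\<forall>\<^sub>F k in sequentially. dist (graphon_prob ?I ?E (step (\<tau> k))) (graphon_prob ?I ?E W) < e / 4"
      using e by (intro tendstoD prob_lim I E) auto
    ultimately have "\<forall>\<^sub>F k in sequentially. real (card ?P) * q (\<tau> k) < e / 4 \<and>
        dist (graphon_prob ?I ?E (step (\<tau> k))) (graphon_prob ?I ?E W) < e / 4"
      by (rule eventually_conj)
    \<comment> \<open>The level is fixed before the graph index grows. Four errors of e / 4 add up:
      injections against all maps, the graph against its block average, the block average against
      its limiting step graphon, and the step graphon against \<open>W\<close>.\<close>
    then obtain k where k: "real (card ?P) * q (\<tau> k) < e / 4"
      "dist (graphon_prob ?I ?E (step (\<tau> k))) (graphon_prob ?I ?E W) < e / 4"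
      by (auto simp: eventually_sequentially)
    let ?t = "\<tau> k"
    let ?b = "\<lambda>m. hom_density ?I ?P ?E (V (r m)) (blk (V (r m)) (A (r m)) (f (r m) ?t))"
    have "(\<lambda>m. real (card ?P) * cutdev (V (r m)) (A (r m)) (f (r m) ?t)) \<longlonglongrightarrow> real (card ?P) * q ?t"
      by (intro tendsto_mult tendsto_const q_lim)
    then have 1: "\<forall>\<^sub>F m in sequentially. real (card ?P) * cutdev (V (r m)) (A (r m)) (f (r m) ?t) < e / 4"
      using k(1) by (rule order_tendstoD(2))
    have 2: "\<forall>\<^sub>F m in sequentially. dist (?b m) (graphon_prob ?I ?E (step ?t)) < e / 4"
      using e by (intro tendstoD blk_lim I E) auto
    have nr: "filterlim (\<lambda>m. n (r m)) at_top sequentially"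
      using filterlim_compose[OF n filterlim_subseq[OF r(1)]] .
    have "(\<lambda>m. (real (card ?I))\<^sup>2 / real (n (r m))) \<longlonglongrightarrow> 0"
      using nr by (intro tendsto_divide_0[OF tendsto_const] filterlim_at_top_imp_at_infinity
        filterlim_compose[OF filterlim_real_sequentially])
    then have 3: "\<forall>\<^sub>F m in sequentially. (real (card ?I))\<^sup>2 / real (n (r m)) < e / 4"
      using e by (intro order_tendstoD(2)) auto
    have 4: "\<forall>\<^sub>F m in sequentially. card ?I \<le> n (r m)"
      using nr by (simp add: filterlim_at_top)
    from 1 2 3 4 have "\<forall>\<^sub>F m in sequentially. norm (graph_density H (G (r m)) - graphon_density H W) < e"
    proof eventually_elim
      case (elim m)
      have cV: "card (verts (G (r m))) = n (r m)" by (simp add: sg(2) V_def)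
      have a: "\<bar>graph_density H (G (r m)) - hom_density ?I ?P ?E (V (r m)) (A (r m))\<bar> < e / 4"
      proof (rule order_le_less_trans[OF _ elim(3)])
        show "\<bar>graph_density H (G (r m)) - hom_density ?I ?P ?E (V (r m)) (A (r m))\<bar> \<le> (real (card ?I))\<^sup>2 / real (n (r m))"
          using graph_density_hom_density[OF H sg(1)[of "r m"]] elim(4) cV by (simp add: sg(2) A_def)
      qed
      have b: "\<bar>hom_density ?I ?P ?E (V (r m)) (A (r m)) - ?b m\<bar> < e / 4"
      proof -
        have "\<bar>hom_density ?I ?P ?E (V (r m)) (A (r m)) - ?b m\<bar> \<le>
            real (card ?P) * cutdev (V (r m)) (A (r m)) (f (r m) ?t)"
          using A blk_bounds[where A="A (r m)", OF fV A]
          by (intro counting_lemma fV neV I E cutdev_bound) (auto simp: pairs_def)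
        then show ?thesis using elim(1) by simp
      qed
      show ?case using a b elim(2) k(2) unfolding graphon_density_eq dist_real_def by (simp add: abs_if split: if_splits)
    qed
    then show "\<exists>N. \<forall>m\<ge>N. norm (graph_density H (G (r m)) - graphon_density H W) < e"
      by (simp add: eventually_sequentially)
  qed
  ultimately show thesis using r(1) W that by blast
qed

text \<open>The number of partitions and mass matrices is absorbed by taking \<open>n\<close> large
  in terms of the level \<open>m\<close>. One graph is chosen for each \<open>m\<close>, good at all
  levels up to \<open>m\<close>, as \<open>graph_sequence_limit\<close> expects.\<close>

lemma dense_sets_limit:
  assumes B: "\<And>n. B n \<subseteq> labelled_graphs n"
    and dense: "\<And>e N. 0 < e \<Longrightarrow> \<exists>n\<ge>N. B n \<noteq> {} \<and> 2 powr ((c - e) * (real n)\<^sup>2 / 2) \<le> real (card (B n))"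
  obtains n G W where "filterlim n at_top sequentially" "\<And>m. G m \<in> B (n m)" "graphon W"
    "\<And>H. simple_graph H \<Longrightarrow> (\<lambda>m. graph_density H (G m)) \<longlonglongrightarrow> graphon_density H W"
    "\<And>I. finite I \<Longrightarrow> real (card (pairs I)) * c \<le> sample_entropy I W"
proof -
  have "\<exists>n G. m < n \<and> G \<in> B n \<and> (\<forall>t\<le>m. c - 2 / real (Suc m) \<le>
     block_entropy {1..n} (adj G) (code {1..n} (adj G) t) (4 ^ t))" for m
  proof -
    define K where "K = (4 ^ m * 4 ^ m :: nat)"
    \<comment> \<open>The prefactor has binary logarithm at most (2 m + 4 K) n, where log (n^2 + 1)
      is bounded crudely by 4 n. The choice of \<open>n\<close> makes this at most n^2 / (2 (m +
      1)); together with the loss 1 / (m + 1) in the density this produces the 2 / (m + 1) of the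
      claim.\<close>
    obtain n where n: "n \<ge> Suc m + 2 * Suc m * (2 * m + 4 * K)" and ne: "B n \<noteq> {}"
      and big: "2 powr ((c - 1 / real (Suc m)) * (real n)\<^sup>2 / 2) \<le> real (card (B n))"
      using dense[of "1 / real (Suc m)" "Suc m + 2 * Suc m * (2 * m + 4 * K)"] by auto
    have n0: "n > 0" using n by simp
    obtain G where G: "G \<in> B n" and le: "\<And>t. t \<le> m \<Longrightarrow> real (card (B n)) \<le>
        real (4 ^ m) ^ n * ((real n)\<^sup>2 + 1) ^ (4 ^ m * 4 ^ m) *
        2 powr ((real n)\<^sup>2 / 2 * block_entropy {1..n} (adj G) (code {1..n} (adj G) t) (4 ^ t))"
      using dense_code_class[OF n0 B ne, of m] by blast
    have "c - 2 / real (Suc m) \<le> block_entropy {1..n} (adj G) (code {1..n} (adj G) t) (4 ^ t)"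
      if t: "t \<le> m" for t
    proof -
      let ?S = "block_entropy {1..n} (adj G) (code {1..n} (adj G) t) (4 ^ t)"
      have "log 2 (2 powr ((c - 1 / real (Suc m)) * (real n)\<^sup>2 / 2)) \<le>
          log 2 (real (4 ^ m) ^ n * ((real n)\<^sup>2 + 1) ^ K * 2 powr ((real n)\<^sup>2 / 2 * ?S))"
        using order_trans[OF big le[OF t]] by (intro log_mono) (auto simp: K_def)
      also have "\<dots> = log 2 (real (4 ^ m) ^ n) + log 2 (((real n)\<^sup>2 + 1) ^ K) + (real n)\<^sup>2 / 2 * ?S"
      proof -
        have "0 < (real n)\<^sup>2 + 1" by (simp add: add_nonneg_pos)
        then show ?thesis by (simp add: log_mult_pos)
      qed
      also have "log 2 (real (4 ^ m) ^ n) = 2 * real m * real n"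
      proof -
        have "real (4 ^ m) ^ n = 2 powr (2 * real m * real n)"
        proof -
          have "real (4 ^ m) ^ n = (2 ^ 2) ^ (m * n)" by (simp add: power_mult)
          also have "\<dots> = 2 ^ (2 * (m * n))" by (simp only: power_mult)
          also have "\<dots> = 2 powr (2 * real m * real n)" by (simp add: powr_realpow[symmetric] mult.assoc)
          finally show ?thesis .
        qed
        then show ?thesis by simp
      qed
      also have "log 2 (((real n)\<^sup>2 + 1) ^ K) \<le> 4 * real K * real n"
      proof -
        have "(real n)\<^sup>2 + 1 \<le> (1 + real n)\<^sup>2" by (simp add: power2_sum)
        moreover have p: "0 < (real n)\<^sup>2 + 1" by (simp add: add_nonneg_pos)
        ultimately have "ln ((real n)\<^sup>2 + 1) \<le> ln ((1 + real n)\<^sup>2)" by (intro ln_mono) auto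
        also have "\<dots> = 2 * ln (1 + real n)" by (simp add: ln_realpow)
        also have "\<dots> \<le> 2 * real n" by (simp add: ln_add_one_self_le_self)
        finally have "log 2 ((real n)\<^sup>2 + 1) \<le> 2 * real n / ln 2"
          unfolding log_def by (intro divide_right_mono) auto
        also have "\<dots> \<le> 2 * real n / (1 / 2)"
          using ln2_ge_two_thirds by (intro divide_left_mono) auto
        finally have "real K * log 2 ((real n)\<^sup>2 + 1) \<le> real K * (4 * real n)"
          by (intro mult_left_mono) auto
        then show ?thesis using p by (simp add: log_nat_power)
      qed
      finally have "(c - 1 / real (Suc m)) * (real n)\<^sup>2 / 2 \<le> (2 * real m + 4 * real K) * real n + (real n)\<^sup>2 / 2 * ?S"
        by (simp add: algebra_simps)
      also have "(2 * real m + 4 * real K) * real n \<le> (1 / real (Suc m)) * (real n)\<^sup>2 / 2"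
      proof -
        have "real (2 * Suc m * (2 * m + 4 * K)) \<le> real n" using n by (simp only: of_nat_le_iff)
        then have "2 * real (Suc m) * (2 * real m + 4 * real K) \<le> real n"
          by (simp only: of_nat_mult of_nat_add of_nat_numeral)
        then have "2 * real (Suc m) * (2 * real m + 4 * real K) * real n \<le> real n * real n"
          by (rule mult_right_mono) simp
        then show ?thesis by (simp add: field_simps power2_eq_square)
      qed
      finally have fin: "(c - 1 / real (Suc m)) * (real n)\<^sup>2 / 2 \<le>
        (1 / real (Suc m)) * (real n)\<^sup>2 / 2 + (real n)\<^sup>2 / 2 * ?S" by simp
      have "(c - 2 * x) * N \<le> ?S * N" if "(c - x) * N / 2 \<le> x * N / 2 + N / 2 * ?S" for x N
        using that by (simp add: algebra_simps)
      from this[OF fin] have "(c - 2 / real (Suc m)) * (real n)\<^sup>2 \<le> ?S * (real n)\<^sup>2" by simp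
      then show ?thesis using n0 by (simp only: mult_le_cancel_right_pos zero_less_power of_nat_0_less_iff)
    qed
    moreover have "m < n" using n by simp
    ultimately show ?thesis using G by blast
  qed
  then obtain n G where nG: "\<And>m. m < n m" "\<And>m. G m \<in> B (n m)"
    "\<And>t m. t \<le> m \<Longrightarrow> c - 2 / real (Suc m) \<le>
       block_entropy {1..n m} (adj (G m)) (code {1..n m} (adj (G m)) t) (4 ^ t)"
    by metis
  have lim_n: "filterlim n at_top sequentially"
    by (rule filterlim_at_top_mono[OF filterlim_ident])
       (use nG(1) in \<open>auto intro!: always_eventually less_imp_le\<close>)
  have GL: "G m \<in> labelled_graphs (n m)" for m using nG(2)[of m] B[of "n m"] by auto
  obtain r W where r: "strict_mono r" "graphon W"
    "\<And>H. simple_graph H \<Longrightarrow> (\<lambda>m. graph_density H (G (r m))) \<longlonglongrightarrow> graphon_density H W"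
    "\<And>I. finite I \<Longrightarrow> real (card (pairs I)) * c \<le> sample_entropy I W"
    using graph_sequence_limit[OF GL lim_n nG(3)] by metis
  show thesis
  proof (rule that[of "\<lambda>m. n (r m)" "\<lambda>m. G (r m)" W])
    show "filterlim (\<lambda>m. n (r m)) at_top sequentially"
      using filterlim_compose[OF lim_n filterlim_subseq[OF r(1)]] .
  qed (use r nG(2) in auto)
qed

section \<open>Approximation by step graphons and the upper bound\<close>

lemma measurable_ident_unit_square: "(\<lambda>z. z) \<in> measurable unit_square borel"
proof -
  have id: "(\<lambda>x. x) \<in> measurable unit_leb borel" by (simp add: measurable_restrict_space1)
  have "(\<lambda>z. (fst z, snd z)) \<in> measurable unit_square (borel \<Otimes>\<^sub>M borel)"
    by (intro measurable_Pair measurable_compose[OF measurable_fst id] measurable_compose[OF measurable_snd id])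
  then show ?thesis by (simp add: borel_prod)
qed

text \<open>\<open>unit_square\<close> is a product of restricted measures and not literally a
  restriction of Lebesgue measure on the plane, so the null set is transferred through its
  sections.\<close>

lemma AE_unit_square:
  fixes P :: "real \<times> real \<Rightarrow> bool"
  assumes "AE z in lborel. P z"
  shows "AE z in unit_square. P z"
proof -
  have "AE z in lborel \<Otimes>\<^sub>M lborel. P z" using assms unfolding lborel_prod .
  then obtain N where N: "\<And>z. z \<in> space (lborel \<Otimes>\<^sub>M lborel) - N \<Longrightarrow> P z" "N \<in> null_sets (lborel \<Otimes>\<^sub>M lborel :: (real \<times> real) measure)"
    by (rule AE_E3) blast
  have NB: "N \<in> sets (borel \<Otimes>\<^sub>M borel)" using N(2) by (simp add: null_sets_def)
  interpret S: prob_space unit_leb by (rule prob_space_unit_leb)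
  interpret SS: pair_prob_space unit_leb unit_leb ..
  have "AE z in lborel \<Otimes>\<^sub>M lborel. z \<notin> N" using N(2) by (rule AE_not_in)
  then have "AE x in lborel. AE y in lborel. (x, y) \<notin> N" by (rule lborel_pair.AE_pair)
  then have *: "AE x in unit_leb. AE y in unit_leb. (x, y) \<notin> N"
    by (auto simp: AE_restrict_space_iff elim!: eventually_mono)
  have "(\<lambda>z. z) \<in> measurable unit_square (borel \<Otimes>\<^sub>M borel)"
    using measurable_ident_unit_square by (simp add: borel_prod)
  then have "(\<lambda>z. z) -` N \<inter> space unit_square \<in> sets unit_square" using NB by (rule measurable_sets)
  then have "space unit_square - N \<in> sets unit_square"
    using sets.Diff[OF sets.top, of _ unit_square] by (metis Diff_Int2 Int_absorb Int_commute vimage_ident)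
  moreover have "{z \<in> space unit_square. z \<notin> N} = space unit_square - N" by auto
  ultimately have "AE z in unit_square. z \<notin> N"
    using * by (intro SS.AE_pair_measure) auto
  then show ?thesis
    by eventually_elim (use N(1) in \<open>simp add: space_pair_measure\<close>)
qed

text \<open>Clamping the coordinates extends \<open>W\<close> to the plane. A Lebesgue measurable
  function is an almost everywhere limit of continuous ones; clamping their values to [0,1] keeps
  them continuous and gives the bound for dominated convergence.\<close>

lemma graphon_approx_continuous:
  assumes W: "graphon W" and d: "0 < d"
  obtains g :: "real \<times> real \<Rightarrow> real" where "continuous_on UNIV g" "\<And>z. g z \<in> {0..1}"
    "(\<integral>z. \<bar>W (fst z) (snd z) - g z\<bar> \<partial>unit_square) < d"
proof -
  define cl where "cl x = max 0 (min 1 x)" for x :: real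
  have cl: "cl x \<in> {0..1}" and cl_id: "x \<in> {0..1} \<Longrightarrow> cl x = x" for x by (auto simp: cl_def)
  define U where "U z = W (cl (fst z)) (cl (snd z))" for z
  have WM: "case_prod W \<in> borel_measurable unit_square" using W by (simp add: graphon_def)
  have clm: "cl \<in> measurable borel unit_leb"
    by (rule measurable_restrict_space2) (auto simp: cl_def[abs_def])
  have "(\<lambda>z::real\<times>real. (cl (fst z), cl (snd z))) \<in> measurable borel unit_square"
    by (rule measurable_Pair; rule measurable_compose[OF _ clm];
        intro borel_measurable_continuous_onI continuous_intros)
  from measurable_compose[OF this WM] have "U \<in> borel_measurable borel" by (simp add: U_def[abs_def])
  then have "U \<in> borel_measurable lborel" by simp
  then have "U \<in> borel_measurable lebesgue" by (rule measurable_completion)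
  then have "U measurable_on UNIV" by (intro lebesgue_measurable_imp_measurable_on) auto
  then obtain N g where N: "negligible N" and g: "\<And>n. continuous_on UNIV (g n)"
    and lim: "\<And>z. z \<notin> N \<Longrightarrow> (\<lambda>n. g n z) \<longlonglongrightarrow> U z"
    unfolding measurable_on_def by auto
  define g' where "g' n z = cl (g n z)" for n :: nat and z
  have g': "continuous_on UNIV (g' n)" for n
    unfolding g'_def cl_def by (intro continuous_intros g)
  have "AE z in lebesgue. z \<notin> N" using N by (intro AE_not_in) (simp add: negligible_iff_null_sets)
  then have "AE z in lborel. z \<notin> N" by (simp add: AE_completion_iff)
  then have ae: "AE z in unit_square. z \<notin> N" by (rule AE_unit_square)
  interpret prob_space unit_square by (rule prob_space_unit_square)
  have gm: "g' n \<in> borel_measurable unit_square" for n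
    using measurable_compose[OF measurable_ident_unit_square borel_measurable_continuous_onI[OF g']] .
  have Wm: "(\<lambda>z. W (fst z) (snd z)) \<in> borel_measurable unit_square"
    using WM by (simp add: case_prod_unfold)
  have "(\<lambda>n. \<integral>z. \<bar>W (fst z) (snd z) - g' n z\<bar> \<partial>unit_square) \<longlonglongrightarrow> (\<integral>z. 0 \<partial>unit_square)"
  proof (rule integral_dominated_convergence[where w="\<lambda>_. 1"])
    show "AE z in unit_square. (\<lambda>n. \<bar>W (fst z) (snd z) - g' n z\<bar>) \<longlonglongrightarrow> 0"
      using ae AE_space
    proof eventually_elim
      case (elim z)
      then have z: "fst z \<in> {0..1}" "snd z \<in> {0..1}" by (auto simp: space_pair_measure)
      then have UW: "U z = W (fst z) (snd z)" by (simp add: U_def cl_id del: atLeastAtMost_iff)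
      have W01: "W (fst z) (snd z) \<in> {0..1}" using W z by (simp add: graphon_def del: atLeastAtMost_iff)
      have "(\<lambda>n. g' n z) \<longlonglongrightarrow> cl (U z)"
        unfolding g'_def cl_def by (intro tendsto_intros lim elim(1))
      then have "(\<lambda>n. g' n z) \<longlonglongrightarrow> W (fst z) (snd z)" using UW cl_id[OF W01] by simp
      then have "(\<lambda>n. \<bar>W (fst z) (snd z) - g' n z\<bar>) \<longlonglongrightarrow> \<bar>W (fst z) (snd z) - W (fst z) (snd z)\<bar>"
        by (intro tendsto_intros)
      then show ?case by simp
    qed
    show "AE z in unit_square. norm \<bar>W (fst z) (snd z) - g' n z\<bar> \<le> 1" for n
    proof (rule AE_I2)
      fix z assume "z \<in> space unit_square"
      then have "W (fst z) (snd z) \<in> {0..1}" using W by (auto simp: graphon_def space_pair_measure)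
      moreover have "g' n z \<in> {0..1}" unfolding g'_def by (rule cl)
      ultimately show "norm \<bar>W (fst z) (snd z) - g' n z\<bar> \<le> 1" by auto
    qed
  qed (use gm Wm in auto)
  then have "(\<lambda>n. \<integral>z. \<bar>W (fst z) (snd z) - g' n z\<bar> \<partial>unit_square) \<longlonglongrightarrow> 0" by simp
  then have "\<forall>\<^sub>F n in sequentially. (\<integral>z. \<bar>W (fst z) (snd z) - g' n z\<bar> \<partial>unit_square) < d"
    using d by (rule order_tendstoD(2))
  then obtain n where "(\<integral>z. \<bar>W (fst z) (snd z) - g' n z\<bar> \<partial>unit_square) < d"
    by (auto simp: eventually_sequentially)
  then show thesis using that[of "g' n"] g' cl by (simp add: g'_def)
qed

definition grid :: "nat \<Rightarrow> real \<Rightarrow> nat" where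
  "grid N x = nat \<lfloor>real N * x\<rfloor>"

lemma measurable_grid: "grid N \<in> measurable unit_leb (count_space UNIV)"
  unfolding grid_def[abs_def] by (rule measurable_restrict_space1) simp

text \<open>The right end point x = 1 receives the extra index \<open>N\<close>, hence
  \<open>Suc N\<close> cells.\<close>

lemma grid_less: "x \<in> {0..1} \<Longrightarrow> grid N x < Suc N"
proof -
  assume "x \<in> {0..1}"
  then have "real N * x \<le> real N" by (simp add: mult_left_le)
  then have "\<lfloor>real N * x\<rfloor> \<le> int N" by (simp add: floor_le_iff)
  then show ?thesis by (simp add: grid_def)
qed

lemma measurable_grid_pair:
  "(\<lambda>z. D (grid N (fst z)) (grid N (snd z)) :: real) \<in> borel_measurable unit_square"
proof -
  have "(\<lambda>z. (grid N (fst z), grid N (snd z))) \<in> measurable unit_square (count_space UNIV \<Otimes>\<^sub>M count_space UNIV)"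
    by (intro measurable_Pair measurable_compose[OF measurable_fst measurable_grid]
        measurable_compose[OF measurable_snd measurable_grid])
  then have "(\<lambda>z. (\<lambda>(i, j). D i j) (grid N (fst z), grid N (snd z))) \<in> borel_measurable unit_square"
    by (rule measurable_compose) (simp add: pair_measure_countable)
  then show ?thesis by simp
qed

lemma graphon_approx_step:
  assumes W: "graphon W" and d: "0 < d"
  obtains N D where "\<And>i j. D i j \<in> {0..1::real}"
    "(\<integral>z. \<bar>W (fst z) (snd z) - D (grid N (fst z)) (grid N (snd z))\<bar> \<partial>unit_square) \<le> d"
proof -
  obtain g where g: "continuous_on UNIV g" "\<And>z. g z \<in> {0..1}"
    "(\<integral>z. \<bar>W (fst z) (snd z) - g z\<bar> \<partial>unit_square) < d / 2"
    using graphon_approx_continuous[OF W, of "d / 2"] d by auto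
  have "uniformly_continuous_on ({0..1} \<times> {0..1}) g"
    by (intro compact_uniformly_continuous continuous_on_subset[OF g(1)] compact_Times) auto
  then obtain \<delta> where \<delta>: "\<delta> > 0"
    "\<And>z z'. z \<in> {0..1} \<times> {0..1} \<Longrightarrow> z' \<in> {0..1} \<times> {0..1} \<Longrightarrow> dist z' z < \<delta> \<Longrightarrow> dist (g z') (g z) < d / 2"
    unfolding uniformly_continuous_on_def using d by (metis half_gt_zero)
  \<comment> \<open>Rounding down to a multiple of 1 / N moves each coordinate by at most 1 / N <
    \<delta> / 2, and so the point by less than \<delta>.\<close>
  obtain N where N: "2 / \<delta> < real N" using reals_Archimedean2 by blast
  then have N0: "real N > 0" using \<delta>(1) by (metis divide_pos_pos order_less_trans zero_less_numeral)
  have N1: "1 / real N < \<delta> / 2" using N N0 \<delta>(1) by (simp add: field_simps)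
  define D where "D i j = g (real i / real N, real j / real N)" for i j
  have gr: "real (grid N x) / real N \<in> {0..1}" "\<bar>real (grid N x) / real N - x\<bar> < \<delta> / 2" if "x \<in> {0..1}" for x
  proof -
    have "grid N x \<le> N" using grid_less[OF that, of N] by simp
    then show "real (grid N x) / real N \<in> {0..1}" using N0 by simp
    have "real (grid N x) = of_int \<lfloor>real N * x\<rfloor>" using that N0 by (simp add: grid_def)
    then have "real (grid N x) \<le> real N * x" "real N * x < real (grid N x) + 1" by linarith+
    then have "\<bar>real (grid N x) - real N * x\<bar> / real N \<le> 1 / real N"
      using N0 by (intro divide_right_mono) auto
    moreover have "real (grid N x) / real N - x = (real (grid N x) - real N * x) / real N"
      using N0 by (simp add: field_simps)
    ultimately have "\<bar>real (grid N x) / real N - x\<bar> \<le> 1 / real N"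
      using N0 by (simp add: abs_divide)
    then show "\<bar>real (grid N x) / real N - x\<bar> < \<delta> / 2" using N1 by simp
  qed
  have close: "\<bar>g z - D (grid N (fst z)) (grid N (snd z))\<bar> \<le> d / 2" if "z \<in> space unit_square" for z
  proof -
    have z: "fst z \<in> {0..1}" "snd z \<in> {0..1}" using that by (auto simp: space_pair_measure)
    let ?z = "(real (grid N (fst z)) / real N, real (grid N (snd z)) / real N)"
    have "dist ?z z \<le> dist (fst ?z) (fst z) + dist (snd ?z) (snd z)"
      by (simp add: dist_prod_def sqrt_sum_squares_le_sum)
    also have "\<dots> < \<delta>" using gr(2)[OF z(1)] gr(2)[OF z(2)] by (simp add: dist_real_def)
    finally have "dist (g ?z) (g z) < d / 2"
      using \<delta>(2)[of z ?z] z gr(1)[OF z(1)] gr(1)[OF z(2)] by (simp add: mem_Times_iff del: atLeastAtMost_iff)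
    then show ?thesis by (simp add: D_def dist_real_def abs_minus_commute)
  qed
  interpret prob_space unit_square by (rule prob_space_unit_square)
  have W01: "W (fst z) (snd z) \<in> {0..1}" if "z \<in> space unit_square" for z
    using W that by (auto simp: graphon_def space_pair_measure)
  have D01: "D i j \<in> {0..1}" for i j unfolding D_def by (rule g(2))
  have Wm: "(\<lambda>z. W (fst z) (snd z)) \<in> borel_measurable unit_square"
    using W by (simp add: graphon_def case_prod_unfold)
  have gm: "g \<in> borel_measurable unit_square"
    using measurable_compose[OF measurable_ident_unit_square borel_measurable_continuous_onI[OF g(1)]] .
  have i1: "integrable unit_square (\<lambda>z. \<bar>W (fst z) (snd z) - g z\<bar>)"
  proof (rule integrable_const_bound[where B=1])
    show "AE z in unit_square. norm \<bar>W (fst z) (snd z) - g z\<bar> \<le> 1"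
    proof (rule AE_I2)
      fix z assume "z \<in> space unit_square"
      then show "norm \<bar>W (fst z) (snd z) - g z\<bar> \<le> 1" using W01[of z] g(2)[of z] by auto
    qed
  qed (use Wm gm in measurable)
  have i2: "integrable unit_square (\<lambda>z. \<bar>W (fst z) (snd z) - D (grid N (fst z)) (grid N (snd z))\<bar>)"
  proof (rule integrable_const_bound[where B=1])
    show "AE z in unit_square. norm \<bar>W (fst z) (snd z) - D (grid N (fst z)) (grid N (snd z))\<bar> \<le> 1"
    proof (rule AE_I2)
      fix z assume "z \<in> space unit_square"
      then show "norm \<bar>W (fst z) (snd z) - D (grid N (fst z)) (grid N (snd z))\<bar> \<le> 1"
        using W01[of z] D01[of "grid N (fst z)" "grid N (snd z)"] by auto
    qed
  qed (use Wm measurable_grid_pair[of D N] in measurable)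
  have "(\<integral>z. \<bar>W (fst z) (snd z) - D (grid N (fst z)) (grid N (snd z))\<bar> \<partial>unit_square) \<le>
      (\<integral>z. \<bar>W (fst z) (snd z) - g z\<bar> + d / 2 \<partial>unit_square)"
  proof (rule integral_mono[OF i2])
    show "integrable unit_square (\<lambda>z. \<bar>W (fst z) (snd z) - g z\<bar> + d / 2)" using i1 by simp
    fix z assume "z \<in> space unit_square"
    from close[OF this] show "\<bar>W (fst z) (snd z) - D (grid N (fst z)) (grid N (snd z))\<bar> \<le> \<bar>W (fst z) (snd z) - g z\<bar> + d / 2"
      by linarith
  qed
  also have "\<dots> = (\<integral>z. \<bar>W (fst z) (snd z) - g z\<bar> \<partial>unit_square) + d / 2" using i1 by (simp add: prob_space)
  also have "\<dots> \<le> d" using g(3) by simp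
  finally show thesis by (rule that[OF D01])
qed

text \<open>Expected negative log-likelihood of a bit that is 1 with probability \<open>w\<close>
  under a model with probability \<open>d\<close>; for \<open>d = w\<close> it is
  \<open>binary_entropy w\<close>.\<close>

definition cross_entropy :: "real \<Rightarrow> real \<Rightarrow> real" where
  "cross_entropy w d = - w * log 2 d - (1 - w) * log 2 (1 - d)"

text \<open>Moves densities into [\<delta>, 1 - \<delta>], where both logarithms are bounded. The
  map is symmetric about 1/2, so it commutes with complementation and one estimate serves edges and
  non-edges.\<close>

definition shrink :: "real \<Rightarrow> real \<Rightarrow> real" where
  "shrink \<delta> x = \<delta> + (1 - 2 * \<delta>) * x"

lemma shrink_bounds:
  assumes "0 < \<delta>" "\<delta> < 1 / 2" "x \<in> {0..1}"
  shows "shrink \<delta> x \<in> {\<delta>..1 - \<delta>}"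
proof -
  have "0 \<le> (1 - 2 * \<delta>) * x" "(1 - 2 * \<delta>) * x \<le> 1 - 2 * \<delta>"
    using assms by (auto simp: mult_left_le)
  then show ?thesis by (simp add: shrink_def)
qed

text \<open>Two replacements. Changing \<open>shrink \<delta> d\<close> to
  \<open>shrink \<delta> w\<close> costs |w - d| / (\<delta> ln 2), because both logarithms have
  derivative at most 1 / (\<delta> ln 2) above \<delta>. Changing \<open>shrink \<delta> w\<close>
  to \<open>w\<close> costs -log 2 (1 - 2 \<delta>), because the shrunk value is at least (1 - 2
  \<delta>) w.\<close>

lemma cross_entropy_shrink:
  assumes \<delta>: "0 < \<delta>" "\<delta> < 1 / 2" and w: "w \<in> {0..1}" and d: "d \<in> {0..1}"
  shows "cross_entropy w (shrink \<delta> d) \<le> binary_entropy w - log 2 (1 - 2 * \<delta>) + \<bar>w - d\<bar> / (\<delta> * ln 2)"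
proof -
  have log_diff: "- log 2 a \<le> - log 2 b + \<bar>b - a\<bar> / (\<delta> * ln 2)" if "\<delta> \<le> a" "0 < b" for a b
  proof -
    have a: "0 < a" using that \<delta> by simp
    have "ln b - ln a = ln (b / a)" using a that by (simp add: ln_div)
    also have "\<dots> \<le> b / a - 1" using a that by (intro ln_le_minus_one) auto
    also have "\<dots> = (b - a) / a" using a by (simp add: field_simps)
    also have "\<dots> \<le> \<bar>b - a\<bar> / a" using a by (intro divide_right_mono) auto
    also have "\<dots> \<le> \<bar>b - a\<bar> / \<delta>" using a that \<delta> by (intro divide_left_mono) auto
    finally have "(ln b - ln a) / ln 2 \<le> \<bar>b - a\<bar> / \<delta> / ln 2" by (rule divide_right_mono) simp
    then show ?thesis by (simp add: log_def diff_divide_distrib)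
  qed
  have log_scale: "- x * log 2 (shrink \<delta> x) \<le> - x * log 2 x - x * log 2 (1 - 2 * \<delta>)" if "x \<in> {0..1}" for x
  proof (cases "x = 0")
    case False
    then have x: "x > 0" using that by simp
    have "log 2 (x * (1 - 2 * \<delta>)) \<le> log 2 (shrink \<delta> x)"
      using x \<delta> by (intro log_mono) (auto simp: shrink_def)
    then have "log 2 x + log 2 (1 - 2 * \<delta>) \<le> log 2 (shrink \<delta> x)" using x \<delta> by (simp add: log_mult_pos)
    then have "x * (log 2 x + log 2 (1 - 2 * \<delta>)) \<le> x * log 2 (shrink \<delta> x)" using x by (intro mult_left_mono) auto
    then show ?thesis by (simp add: distrib_left)
  qed simp
  have compl: "1 - shrink \<delta> x = shrink \<delta> (1 - x)" for x by (simp add: shrink_def algebra_simps)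
  have diff: "\<bar>shrink \<delta> w - shrink \<delta> d\<bar> \<le> \<bar>w - d\<bar>"
  proof -
    have "shrink \<delta> w - shrink \<delta> d = (1 - 2 * \<delta>) * (w - d)" by (simp add: shrink_def algebra_simps)
    then have "\<bar>shrink \<delta> w - shrink \<delta> d\<bar> = (1 - 2 * \<delta>) * \<bar>w - d\<bar>" using \<delta> by (simp add: abs_mult)
    also have "\<dots> \<le> 1 * \<bar>w - d\<bar>" using \<delta> by (intro mult_right_mono) auto
    finally show ?thesis by simp
  qed
  define C where "C = \<bar>w - d\<bar> / (\<delta> * ln 2)"
  have le_C: "\<bar>shrink \<delta> w - shrink \<delta> d\<bar> / (\<delta> * ln 2) \<le> C"
    unfolding C_def using diff \<delta> by (intro divide_right_mono) auto
  have 1: "- log 2 (shrink \<delta> d) \<le> - log 2 (shrink \<delta> w) + C"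
    using log_diff[of "shrink \<delta> d" "shrink \<delta> w"] shrink_bounds[OF \<delta> d] shrink_bounds[OF \<delta> w] \<delta> le_C by auto
  have 2: "- log 2 (1 - shrink \<delta> d) \<le> - log 2 (1 - shrink \<delta> w) + C"
    using log_diff[of "1 - shrink \<delta> d" "1 - shrink \<delta> w"] shrink_bounds[OF \<delta> d] shrink_bounds[OF \<delta> w] \<delta> le_C
    by (auto simp: abs_minus_commute)
  have "w * - log 2 (shrink \<delta> d) \<le> w * (- log 2 (shrink \<delta> w) + C)"
    using w by (intro mult_left_mono 1) auto
  moreover have "(1 - w) * - log 2 (1 - shrink \<delta> d) \<le> (1 - w) * (- log 2 (1 - shrink \<delta> w) + C)"
    using w by (intro mult_left_mono 2) auto
  moreover have "- w * log 2 (shrink \<delta> w) \<le> - w * log 2 w - w * log 2 (1 - 2 * \<delta>)"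
    using w by (rule log_scale)
  moreover have "- (1 - w) * log 2 (1 - shrink \<delta> w) \<le> - (1 - w) * log 2 (1 - w) - (1 - w) * log 2 (1 - 2 * \<delta>)"
    unfolding compl using w by (intro log_scale) auto
  ultimately have "cross_entropy w (shrink \<delta> d) \<le> binary_entropy w - log 2 (1 - 2 * \<delta>) + C"
    unfolding cross_entropy_def binary_entropy_def by (simp add: algebra_simps)
  then show ?thesis by (simp add: C_def)
qed

lemma integral_PiM_pair:
  assumes M: "prob_space M" and I: "finite I" "u \<in> I" "v \<in> I" "u \<noteq> v"
    and F: "F \<in> borel_measurable (M \<Otimes>\<^sub>M M)"
  shows "(\<integral>x. F (x u, x v) \<partial>(\<Pi>\<^sub>M i\<in>I. M)) = (\<integral>z. F z \<partial>(M \<Otimes>\<^sub>M M) :: real)"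
proof -
  have "(\<lambda>x. (x u, x v)) \<in> measurable (\<Pi>\<^sub>M i\<in>I. M) (M \<Otimes>\<^sub>M M)" using I by simp
  from integral_distr[OF this F] show ?thesis unfolding distr_PiM_pair[OF M I] by simp
qed

text \<open>The mixture \<open>\<nu>\<close> of all the step models is within a factor \<open>Suc N ^ card I\<close> of each of them,
  so Gibbs' inequality against \<open>\<nu>\<close> costs only \<open>O(card I)\<close> while the main term is of order
  \<open>(card I)\<^sup>2\<close>.\<close>

lemma sample_entropy_le:
  fixes D :: "nat \<Rightarrow> nat \<Rightarrow> real"
  assumes W: "graphon W" and I: "finite I" and \<delta>: "0 < \<delta>" and D: "\<And>i j. D i j \<in> {\<delta>..1 - \<delta>}"
  shows "sample_entropy I W \<le> real (card I) * log 2 (real (Suc N)) + real (card (pairs I)) *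
    (\<integral>z. cross_entropy (W (fst z) (snd z)) (D (grid N (fst z)) (grid N (snd z))) \<partial>unit_square)"
proof -
  let ?P = "pairs I" and ?X = "I \<rightarrow>\<^sub>E {..<Suc N}" and ?M = "\<Pi>\<^sub>M i\<in>I. unit_leb"
  let ?b = "\<lambda>x E. bern ?P E (\<lambda>(u, v). W (x u) (x v))"
  let ?q = "\<lambda>\<psi> E. bern ?P E (\<lambda>(u, v). D (\<psi> u) (\<psi> v))"
  let ?K = "real (Suc N) ^ card I"
  let ?\<mu> = "\<lambda>E. graphon_prob I E W"
  let ?ce = "\<lambda>z. cross_entropy (W (fst z) (snd z)) (D (grid N (fst z)) (grid N (snd z)))"
  define \<nu> where "\<nu> E = (\<Sum>\<psi>\<in>?X. ?q \<psi> E) / ?K" for E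
  interpret PP: prob_space ?M by (intro prob_space_PiM prob_space_unit_leb)
  interpret SQ: prob_space unit_square by (rule prob_space_unit_square)
  have Wm: "(\<lambda>z. W (fst z) (snd z)) \<in> borel_measurable unit_square"
    using W by (simp add: graphon_def case_prod_unfold)
  have ce_meas: "?ce \<in> borel_measurable unit_square"
    unfolding cross_entropy_def
    by (intro borel_measurable_diff borel_measurable_times borel_measurable_uminus borel_measurable_log
        borel_measurable_const Wm measurable_grid_pair[of D N])
  have ce_bound: "\<bar>?ce z\<bar> \<le> - log 2 \<delta>" if z: "z \<in> space unit_square" for z
  proof -
    let ?w = "W (fst z) (snd z)" and ?d = "D (grid N (fst z)) (grid N (snd z))"
    have w: "0 \<le> ?w" "?w \<le> 1" using W z by (auto simp: graphon_def space_pair_measure)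
    have d: "\<delta> \<le> ?d" "?d \<le> 1 - \<delta>" using D by auto
    have "log 2 \<delta> \<le> log 2 ?d" "log 2 ?d \<le> 0" "log 2 \<delta> \<le> log 2 (1 - ?d)" "log 2 (1 - ?d) \<le> 0"
      using d \<delta> by (auto simp: log_le_zero_cancel_iff)
    then have "?w * log 2 \<delta> \<le> ?w * log 2 ?d" "?w * log 2 ?d \<le> 0"
      "(1 - ?w) * log 2 \<delta> \<le> (1 - ?w) * log 2 (1 - ?d)" "(1 - ?w) * log 2 (1 - ?d) \<le> 0"
      using w by (auto intro: mult_left_mono mult_nonneg_nonpos)
    then show ?thesis unfolding cross_entropy_def by (simp add: abs_le_iff algebra_simps)
  qed
  have ce_int: "integrable ?M (\<lambda>x. ?ce (x (fst p), x (snd p)))" if "p \<in> pairs I" for p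
  proof (rule PP.integrable_const_bound)
    have p: "fst p \<in> I" "snd p \<in> I" using that by (auto simp: pairs_def)
    have m: "(\<lambda>x. (x (fst p), x (snd p))) \<in> measurable ?M unit_square" using p by simp
    show "(\<lambda>x. ?ce (x (fst p), x (snd p))) \<in> borel_measurable ?M"
      by (rule measurable_compose[OF m ce_meas])
    show "AE x in ?M. norm (?ce (x (fst p), x (snd p))) \<le> - log 2 \<delta>"
      using ce_bound[OF measurable_space[OF m]] by (intro AE_I2) simp
  qed
  have fP: "finite ?P" using I by (rule finite_pairs)
  have fX: "finite ?X" and cX: "card ?X = Suc N ^ card I" using I by (simp_all add: finite_PiE card_PiE)
  have K: "?K > 0" by simp
  have D01: "(case p of (u, v) \<Rightarrow> D (\<psi> u) (\<psi> v)) \<in> {0..1}" for p :: "nat \<times> nat" and \<psi>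
    using D[of "\<psi> (fst p)" "\<psi> (snd p)"] \<delta> by (cases p) auto
  have Dpos: "0 < D i j" "0 < 1 - D i j" for i j using D[of i j] \<delta> by auto
  have qpos: "0 < ?q \<psi> E" for \<psi> E
    unfolding bern_def using Dpos by (intro mult_pos_pos prod_pos) auto
  have \<nu>_ge: "?q (\<lambda>u\<in>I. grid N (x u)) E / ?K \<le> \<nu> E" if "x \<in> space ?M" for x E
    unfolding \<nu>_def
  proof (intro divide_right_mono)
    have "(\<lambda>u\<in>I. grid N (x u)) \<in> ?X" using grid_less space_PiM_unit_leb[OF that] by auto
    then show "?q (\<lambda>u\<in>I. grid N (x u)) E \<le> (\<Sum>\<psi>\<in>?X. ?q \<psi> E)"
      using fX qpos by (intro member_le_sum[of _ ?X "\<lambda>\<psi>. ?q \<psi> E"]) (auto intro: less_imp_le)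
  qed simp
  have "\<exists>x. x \<in> space ?M" using PP.not_empty by blast
  then have \<nu>_pos: "0 < \<nu> E" for E
    using order_less_le_trans[OF divide_pos_pos[OF qpos K] \<nu>_ge] by blast
  have \<nu>_sum: "(\<Sum>E\<in>Pow ?P. \<nu> E) = 1"
  proof -
    have "(\<Sum>E\<in>Pow ?P. \<nu> E) = (\<Sum>\<psi>\<in>?X. \<Sum>E\<in>Pow ?P. ?q \<psi> E) / ?K"
      unfolding \<nu>_def sum_divide_distrib[symmetric] by (subst sum.swap) simp
    also have "\<dots> = 1" unfolding sum_bern[OF fP] using cX by simp
    finally show ?thesis .
  qed
  have "(\<Sum>E\<in>Pow ?P. ?\<mu> E * log 2 (\<nu> E)) \<le> (\<Sum>E\<in>Pow ?P. ?\<mu> E * log 2 (?\<mu> E))"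
  proof (rule gibbs_inequality)
    show "(\<Sum>E\<in>Pow ?P. \<nu> E) \<le> (\<Sum>E\<in>Pow ?P. ?\<mu> E)"
      unfolding \<nu>_sum sum_graphon_prob[OF W I] by simp
  qed (use fP \<nu>_pos graphon_prob_nonneg[OF W] in \<open>auto intro: less_imp_le\<close>)
  then have "sample_entropy I W \<le> (\<Sum>E\<in>Pow ?P. ?\<mu> E * - log 2 (\<nu> E))"
    by (simp add: sample_entropy_def sum_negf)
  also have "\<dots> = (\<integral>x. (\<Sum>E\<in>Pow ?P. ?b x E * - log 2 (\<nu> E)) \<partial>?M)"
    unfolding graphon_prob_def
    by (subst Bochner_Integration.integral_sum) (use integrable_bern_graphon[OF W I] in auto)
  \<comment> \<open>For each fixed \<open>x\<close>, \<open>\<nu>\<close> is bounded below by the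
    component belonging to the grid cells of \<open>x\<close>. The sum over \<open>E\<close> is then
    an expected log-likelihood under independent edges with probabilities W(x_u, x_v), which splits
    into one cross entropy per pair.\<close>
  also have "\<dots> \<le> (\<integral>x. real (card I) * log 2 (real (Suc N)) + (\<Sum>p\<in>?P. ?ce (x (fst p), x (snd p))) \<partial>?M)"
  proof (rule integral_mono)
    show "integrable ?M (\<lambda>x. \<Sum>E\<in>Pow ?P. ?b x E * - log 2 (\<nu> E))"
      using integrable_bern_graphon[OF W I] by (intro Bochner_Integration.integrable_sum integrable_mult_left) auto
    show "integrable ?M (\<lambda>x. real (card I) * log 2 (real (Suc N)) + (\<Sum>p\<in>?P. ?ce (x (fst p), x (snd p))))"
      using ce_int by (intro Bochner_Integration.integrable_add Bochner_Integration.integrable_sum) auto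
    fix x assume x: "x \<in> space ?M"
    let ?\<psi> = "\<lambda>u\<in>I. grid N (x u)"
    have W01: "(case p of (u, v) \<Rightarrow> W (x u) (x v)) \<in> {0..1}" if "p \<in> ?P" for p
      using bern_graphon_01[OF W x that] .
    have "(\<Sum>E\<in>Pow ?P. ?b x E * - log 2 (\<nu> E)) \<le>
      (\<Sum>E\<in>Pow ?P. ?b x E * (real (card I) * log 2 (real (Suc N)) +
        ((\<Sum>p\<in>E. - log 2 (case p of (u, v) \<Rightarrow> D (?\<psi> u) (?\<psi> v))) +
         (\<Sum>p\<in>?P - E. - log 2 (1 - (case p of (u, v) \<Rightarrow> D (?\<psi> u) (?\<psi> v)))))))"
    proof (intro sum_mono mult_left_mono)
      fix E assume E: "E \<in> Pow ?P"
      show "0 \<le> ?b x E" using bern_nonneg[OF W01] E by auto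
      have "log 2 (?q ?\<psi> E / ?K) \<le> log 2 (\<nu> E)"
        using \<nu>_ge[OF x] qpos K by (intro log_mono divide_pos_pos) auto
      moreover have "log 2 (?q ?\<psi> E / ?K) = log 2 (?q ?\<psi> E) - real (card I) * log 2 (real (Suc N))"
        using qpos[of E ?\<psi>] by (simp add: log_divide_pos log_nat_power del: of_nat_Suc)
      moreover have "log 2 (?q ?\<psi> E) =
        (\<Sum>p\<in>E. log 2 (case p of (u, v) \<Rightarrow> D (?\<psi> u) (?\<psi> v))) +
        (\<Sum>p\<in>?P - E. log 2 (1 - (case p of (u, v) \<Rightarrow> D (?\<psi> u) (?\<psi> v))))"
        using bern_log[OF fP, of E "\<lambda>(u, v). D (?\<psi> u) (?\<psi> v)"] D01 E qpos[of E ?\<psi>] by auto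
      ultimately show "- log 2 (\<nu> E) \<le> real (card I) * log 2 (real (Suc N)) +
        ((\<Sum>p\<in>E. - log 2 (case p of (u, v) \<Rightarrow> D (?\<psi> u) (?\<psi> v))) +
         (\<Sum>p\<in>?P - E. - log 2 (1 - (case p of (u, v) \<Rightarrow> D (?\<psi> u) (?\<psi> v)))))"
        by (simp add: sum_negf)
    qed
    also have "\<dots> = real (card I) * log 2 (real (Suc N)) * (\<Sum>E\<in>Pow ?P. ?b x E) +
      (\<Sum>E\<in>Pow ?P. ?b x E * ((\<Sum>p\<in>E. - log 2 (case p of (u, v) \<Rightarrow> D (?\<psi> u) (?\<psi> v))) +
         (\<Sum>p\<in>?P - E. - log 2 (1 - (case p of (u, v) \<Rightarrow> D (?\<psi> u) (?\<psi> v))))))"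
      by (simp only: distrib_left[of "?b x _"] sum.distrib sum_distrib_left mult.commute)
    also have "\<dots> = real (card I) * log 2 (real (Suc N)) + (\<Sum>p\<in>?P. ?ce (x (fst p), x (snd p)))"
      unfolding sum_bern[OF fP] sum_bern_linear[OF fP]
      by (intro arg_cong2[of _ _ _ _ "(+)"] sum.cong) (auto simp: cross_entropy_def pairs_def)
    finally show "(\<Sum>E\<in>Pow ?P. ?b x E * - log 2 (\<nu> E)) \<le>
      real (card I) * log 2 (real (Suc N)) + (\<Sum>p\<in>?P. ?ce (x (fst p), x (snd p)))" .
  qed
  also have "\<dots> = real (card I) * log 2 (real (Suc N)) + real (card ?P) * (\<integral>z. ?ce z \<partial>unit_square)"
  proof -
    have "(\<integral>x. real (card I) * log 2 (real (Suc N)) + (\<Sum>p\<in>?P. ?ce (x (fst p), x (snd p))) \<partial>?M) =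
        real (card I) * log 2 (real (Suc N)) + (\<Sum>p\<in>?P. \<integral>x. ?ce (x (fst p), x (snd p)) \<partial>?M)"
      using ce_int by (subst Bochner_Integration.integral_add)
        (auto simp: PP.prob_space Bochner_Integration.integral_sum intro!: Bochner_Integration.integrable_sum)
    also have "(\<Sum>p\<in>?P. \<integral>x. ?ce (x (fst p), x (snd p)) \<partial>?M) = (\<Sum>p\<in>?P. \<integral>z. ?ce z \<partial>unit_square)"
      by (intro sum.cong refl integral_PiM_pair[OF prob_space_unit_leb I _ _ _ ce_meas]) (auto simp: pairs_def)
    finally show ?thesis by simp
  qed
  finally show ?thesis .
qed

lemma graphon_entropy_eq:
  assumes W: "graphon W"
  shows "graphon_entropy W = (\<integral>z. binary_entropy (W (fst z) (snd z)) \<partial>unit_square)"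
    and "integrable unit_square (\<lambda>z. binary_entropy (W (fst z) (snd z)))"
proof -
  interpret S: prob_space unit_leb by (rule prob_space_unit_leb)
  interpret SS: pair_prob_space unit_leb unit_leb ..
  have Wm: "(\<lambda>z. W (fst z) (snd z)) \<in> borel_measurable unit_square"
    using W by (simp add: graphon_def case_prod_unfold)
  show int: "integrable unit_square (\<lambda>z. binary_entropy (W (fst z) (snd z)))"
  proof (rule SS.integrable_const_bound[where B=1])
    show "(\<lambda>z. binary_entropy (W (fst z) (snd z))) \<in> borel_measurable unit_square"
      unfolding binary_entropy_def
      by (intro borel_measurable_diff borel_measurable_times borel_measurable_uminus borel_measurable_log
          borel_measurable_const Wm)
    show "AE z in unit_square. norm (binary_entropy (W (fst z) (snd z))) \<le> 1"
    proof (rule AE_I2)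
      fix z assume "z \<in> space unit_square"
      then have "W (fst z) (snd z) \<in> {0..1}" using W by (auto simp: graphon_def space_pair_measure)
      from binary_entropy_bounds[OF this] show "norm (binary_entropy (W (fst z) (snd z))) \<le> 1" by simp
    qed
  qed
  then have "integrable unit_square (\<lambda>(x, y). binary_entropy (W x y))" by (simp add: case_prod_unfold)
  from SS.integral_snd[OF this]
  show "graphon_entropy W = (\<integral>z. binary_entropy (W (fst z) (snd z)) \<partial>unit_square)"
    by (simp add: graphon_entropy_def case_prod_unfold)
qed

text \<open>\<open>C\<close> is the logarithm of the number of grid cells of an approximation
  depending on \<open>W\<close> and \<open>e\<close> alone; its independence of \<open>I\<close>
  makes the first term negligible against the number of pairs.\<close>

lemma sample_entropy_le_graphon_entropy:
  assumes W: "graphon W" and e: "0 < e"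
  obtains C where "\<And>I. finite I \<Longrightarrow> sample_entropy I W \<le> real (card I) * C + real (card (pairs I)) * (graphon_entropy W + e)"
proof -
  \<comment> \<open>The allowance \<open>e\<close> is split evenly: \<open>\<delta>\<close> is
    chosen so that shrinking costs exactly e / 2, and \<open>d\<close> below so that an L1 error of
    \<open>d\<close> costs e / 2.\<close>
  define \<delta> where "\<delta> = (1 - 2 powr (- (e / 2))) / 2"
  have "2 powr (- (e / 2)) < 2 powr (0::real)" using e by (intro powr_less_mono) auto
  then have \<delta>: "0 < \<delta>" "\<delta> < 1 / 2" by (simp_all add: \<delta>_def)
  have log\<delta>: "- log 2 (1 - 2 * \<delta>) = e / 2" proof -
    have "2 * \<delta> = 1 - 2 powr (- (e / 2))" by (simp add: \<delta>_def)
    then have "1 - 2 * \<delta> = 2 powr (- (e / 2))" by simp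
    then show ?thesis by simp
  qed
  define d where "d = e / 2 * (\<delta> * ln 2)"
  have d: "0 < d" using e \<delta> by (simp add: d_def)
  obtain D N where D: "\<And>i j. D i j \<in> {0..1::real}"
    "(\<integral>z. \<bar>W (fst z) (snd z) - D (grid N (fst z)) (grid N (snd z))\<bar> \<partial>unit_square) \<le> d"
    by (rule graphon_approx_step[OF W d]) (rule that)
  let ?D = "\<lambda>z. D (grid N (fst z)) (grid N (snd z))"
  interpret SQ: prob_space unit_square by (rule prob_space_unit_square)
  have W01: "W (fst z) (snd z) \<in> {0..1}" if "z \<in> space unit_square" for z
    using W that by (auto simp: graphon_def space_pair_measure)
  have Wm: "(\<lambda>z. W (fst z) (snd z)) \<in> borel_measurable unit_square"
    using W by (simp add: graphon_def case_prod_unfold)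
  have Dm: "?D \<in> borel_measurable unit_square" by (rule measurable_grid_pair)
  have i1: "integrable unit_square (\<lambda>z. \<bar>W (fst z) (snd z) - ?D z\<bar>)"
  proof (rule SQ.integrable_const_bound[where B=1])
    show "AE z in unit_square. norm \<bar>W (fst z) (snd z) - ?D z\<bar> \<le> 1"
    proof (rule AE_I2)
      fix z assume "z \<in> space unit_square"
      then show "norm \<bar>W (fst z) (snd z) - ?D z\<bar> \<le> 1"
        using W01[of z] D(1)[of "grid N (fst z)" "grid N (snd z)"] by auto
    qed
  qed (use Wm Dm in measurable)
  have "(\<integral>z. cross_entropy (W (fst z) (snd z)) (shrink \<delta> (?D z)) \<partial>unit_square) \<le>
      (\<integral>z. binary_entropy (W (fst z) (snd z)) + e / 2 + \<bar>W (fst z) (snd z) - ?D z\<bar> / (\<delta> * ln 2) \<partial>unit_square)"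
  proof (rule integral_mono_AE')
    show "integrable unit_square (\<lambda>z. binary_entropy (W (fst z) (snd z)) + e / 2 + \<bar>W (fst z) (snd z) - ?D z\<bar> / (\<delta> * ln 2))"
      using graphon_entropy_eq(2)[OF W] i1 by simp
    show "AE z in unit_square. cross_entropy (W (fst z) (snd z)) (shrink \<delta> (?D z)) \<le>
        binary_entropy (W (fst z) (snd z)) + e / 2 + \<bar>W (fst z) (snd z) - ?D z\<bar> / (\<delta> * ln 2)"
      using cross_entropy_shrink[OF \<delta> W01 D(1)] log\<delta> by (intro AE_I2) force
    show "AE z in unit_square. 0 \<le> binary_entropy (W (fst z) (snd z)) + e / 2 + \<bar>W (fst z) (snd z) - ?D z\<bar> / (\<delta> * ln 2)"
      using binary_entropy_bounds[OF W01] e \<delta> by (intro AE_I2 add_nonneg_nonneg divide_nonneg_nonneg) auto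
  qed
  also have "\<dots> = graphon_entropy W + e / 2 + (\<integral>z. \<bar>W (fst z) (snd z) - ?D z\<bar> \<partial>unit_square) / (\<delta> * ln 2)"
    using graphon_entropy_eq[OF W] i1 by (simp add: SQ.prob_space)
  also have "\<dots> \<le> graphon_entropy W + e / 2 + d / (\<delta> * ln 2)"
    using D(2) \<delta> by (intro add_left_mono divide_right_mono) auto
  also have "d / (\<delta> * ln 2) = e / 2" using \<delta> by (simp add: d_def)
  finally have ce: "(\<integral>z. cross_entropy (W (fst z) (snd z)) (shrink \<delta> (?D z)) \<partial>unit_square) \<le> graphon_entropy W + e"
    by simp
  show thesis
  proof (rule that)
    fix I :: "nat set" assume I: "finite I"
    have "sample_entropy I W \<le> real (card I) * log 2 (real (Suc N)) + real (card (pairs I)) *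
        (\<integral>z. cross_entropy (W (fst z) (snd z)) (shrink \<delta> (?D z)) \<partial>unit_square)"
      using sample_entropy_le[OF W I \<delta>(1), of "\<lambda>i j. shrink \<delta> (D i j)" N] shrink_bounds[OF \<delta> D(1)] by blast
    also have "\<dots> \<le> real (card I) * log 2 (real (Suc N)) + real (card (pairs I)) * (graphon_entropy W + e)"
      by (intro add_left_mono mult_left_mono ce) simp
    finally show "sample_entropy I W \<le> real (card I) * log 2 (real (Suc N)) + real (card (pairs I)) * (graphon_entropy W + e)" .
  qed
qed

text \<open>On k vertices both bounds on the sampled entropy are of order k^2 up to a term linear in
  k; dividing by the number of pairs and letting k grow leaves
  \<open>c \<le> graphon_entropy W + e\<close>.\<close>

lemma graphon_entropy_ge:
  assumes W: "graphon W" and c: "\<And>I. finite I \<Longrightarrow> real (card (pairs I)) * c \<le> sample_entropy I W"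
  shows "c \<le> graphon_entropy W"
proof (rule field_le_epsilon)
  fix e :: real assume e: "0 < e"
  obtain C where C: "\<And>I. finite I \<Longrightarrow> sample_entropy I W \<le> real (card I) * C + real (card (pairs I)) * (graphon_entropy W + e)"
    using sample_entropy_le_graphon_entropy[OF W e] by blast
  have card_pairs: "2 * real (card (pairs {..<k})) = real k * (real k - 1)" for k
  proof -
    have "(\<Sum>u<k. \<Sum>v<k. 1) = 2 * (\<Sum>(u, v)\<in>pairs {..<k}. 1) + (\<Sum>u<k. 1 :: real)"
      by (rule sum_pairs_sym) auto
    then show ?thesis by (simp add: algebra_simps)
  qed
  have bound: "(real k - 1) * (c - (graphon_entropy W + e)) \<le> 2 * C" if k: "k > 0" for k
  proof -
    have "2 * real (card (pairs {..<k})) * c \<le> 2 * real k * C + 2 * real (card (pairs {..<k})) * (graphon_entropy W + e)"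
      using order_trans[OF c C, of "{..<k}"] by (simp add: algebra_simps)
    then have "real k * ((real k - 1) * (c - (graphon_entropy W + e))) \<le> real k * (2 * C)"
      unfolding card_pairs by (simp add: algebra_simps)
    then show ?thesis using k by simp
  qed
  show "c \<le> graphon_entropy W + e"
  proof (rule ccontr)
    assume "\<not> ?thesis"
    then have x: "0 < c - (graphon_entropy W + e)" by simp
    obtain k :: nat where "2 * C / (c - (graphon_entropy W + e)) < real k" using reals_Archimedean2 by blast
    then have "2 * C < real k * (c - (graphon_entropy W + e))" using x by (simp add: pos_divide_less_eq)
    then show False using bound[of "Suc k"] by simp
  qed
qed

section \<open>Limits of graph classes\<close>

lemma unlabelled_graph_labelled_rep:
  assumes C: "C \<in> unlabelled_graphs_n n"
  obtains G where "G \<in> labelled_graphs n" "C = iso_class G"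
proof -
  obtain G where G: "simple_graph G" "C = iso_class G"
    using C by (auto simp: unlabelled_graphs_n_def unlabelled_graphs_def elim: quotientE)
  then have "G \<in> C" by (simp add: iso_rel_def graph_iso_refl)
  with C have n: "card (verts G) = n" by (auto simp: unlabelled_graphs_n_def)
  have fin: "finite (verts G)" "verts G \<noteq> {}" using G by (simp_all add: simple_graph_def)
  with n obtain f where f: "bij_betw f (verts G) {1..n}"
    using finite_same_card_bij[of "verts G" "{1..n}"] by auto
  then have inj: "inj_on f (verts G)" and im: "f ` verts G = {1..n}" by (auto simp: bij_betw_def)
  define K where "K = SGraph {1..n} ((`) f ` edges G)"
  have E: "e \<subseteq> verts G \<and> card e = 2" if "e \<in> edges G" for e
    using G(1) that by (auto simp: simple_graph_def)
  have "f ` e \<subseteq> {1..n} \<and> card (f ` e) = 2" if "e \<in> edges G" for e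
    using E[OF that] im card_image[OF inj_on_subset[OF inj], of e] by auto
  moreover have "{1..n} \<noteq> {}" using im fin(2) by (metis image_is_empty)
  ultimately have K: "simple_graph K" by (auto simp: simple_graph_def K_def)
  have "{u, v} \<in> edges G \<longleftrightarrow> {f u, f v} \<in> edges K" if uv: "u \<in> verts G" "v \<in> verts G" for u v
  proof
    assume "{u, v} \<in> edges G"
    then have "f ` {u, v} \<in> edges K" unfolding K_def by (simp only: sgraph.sel) (rule imageI)
    then show "{f u, f v} \<in> edges K" by simp
  next
    assume "{f u, f v} \<in> edges K"
    then obtain e where e: "e \<in> edges G" "f ` e = f ` {u, v}" by (auto simp: K_def)
    then have "e = {u, v}" using inj_on_image_eq_iff[OF inj, of e "{u, v}"] E uv by simp
    then show "{u, v} \<in> edges G" using e(1) by simp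
  qed
  then have "graph_iso G K" using f by (auto simp: graph_iso_def K_def)
  then have "C = iso_class K"
    using G K equiv_class_eq[OF equiv_iso_rel, of G K] by (simp add: iso_rel_def)
  moreover have "K \<in> labelled_graphs n" using K by (simp add: labelled_graphs_def K_def)
  ultimately show thesis using that by blast
qed

lemma class_n_labelled_rep:
  assumes "C \<in> class_n Q n"
  obtains G where "G \<in> class_labelled_n Q n" "C = iso_class G"
  using assms unlabelled_graph_labelled_rep[of C n] by (auto simp: class_n_def class_labelled_n_def)

lemma finite_class_n: "finite (class_n Q n)"
  by (simp add: class_n_def finite_unlabelled_graphs_n)

lemma finite_class_labelled_n: "finite (class_labelled_n Q n)"
  by (simp add: class_labelled_n_def finite_labelled_graphs)

lemma card_class_n_le: "card (class_n Q n) \<le> card (class_labelled_n Q n)"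
proof -
  have "class_n Q n \<subseteq> iso_class ` class_labelled_n Q n" by (auto elim: class_n_labelled_rep)
  then show ?thesis by (rule surj_card_le[OF finite_class_labelled_n])
qed

text \<open>Every set of increasing pairs on \<open>I\<close> is the edge set of a graph on
  \<open>I\<close>, so equality of all densities gives equality of all sampling
  probabilities.\<close>

lemma sample_entropy_cong:
  assumes WW: "(W, W') \<in> graphon_rel" and I: "finite I"
  shows "sample_entropy I W = sample_entropy I W'"
proof -
  have W: "graphon W" "graphon W'" using WW by (auto simp: graphon_rel_def)
  have "graphon_prob I E W = graphon_prob I E W'" if E: "E \<subseteq> pairs I" for E
  \<comment> \<open>Graphs have at least one vertex, so for empty \<open>I\<close> no density is at
    hand; the only outcome then has probability 1.\<close>
  proof (cases "I = {}")
    case True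
    then have "pairs I = {}" by (simp add: pairs_def)
    then show ?thesis using sum_graphon_prob[OF W(1) I] sum_graphon_prob[OF W(2) I] E by simp
  next
    case False
    define H where "H = SGraph I ((\<lambda>(u, v). {u, v}) ` E)"
    have H: "simple_graph H" "verts H = I" using False I E by (auto simp: simple_graph_def H_def pairs_def)
    have "epairs H = E"
    proof
      show "epairs H \<subseteq> E"
      proof
        fix p assume "p \<in> epairs H"
        then obtain u v where uv: "p = (u, v)" "u < v" "{u, v} \<in> edges H" by (auto simp: epairs_def pairs_def)
        then obtain a b where ab: "(a, b) \<in> E" "{u, v} = {a, b}" by (auto simp: H_def)
        then have "a < b" using E by (auto simp: pairs_def)
        with ab uv have "(a, b) = (u, v)" by (auto simp: doubleton_eq_iff)
        with ab uv show "p \<in> E" by simp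
      qed
      show "E \<subseteq> epairs H" using E by (auto simp: epairs_def H_def)
    qed
    then show ?thesis
      using WW H graphon_density_eq[of H W] graphon_density_eq[of H W'] by (auto simp: graphon_rel_def)
  qed
  then show ?thesis unfolding sample_entropy_def by (intro arg_cong[of _ _ uminus] sum.cong refl) auto
qed

lemma dense_sets_class_limit:
  assumes B: "\<And>n. B n \<subseteq> class_labelled_n Q n"
    and dense: "\<And>e N. 0 < e \<Longrightarrow> \<exists>n\<ge>N. B n \<noteq> {} \<and> 2 powr ((c - e) * (real n)\<^sup>2 / 2) \<le> real (card (B n))"
  obtains n G \<Gamma> where "\<Gamma> \<in> class_limits Q" "c \<le> limit_entropy \<Gamma>" "\<And>m. G m \<in> B (n m)"
    "\<And>H. simple_graph H \<Longrightarrow> (\<lambda>m. graph_density H (G m)) \<longlonglongrightarrow> limit_density H \<Gamma>"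
proof -
  have BL: "B n \<subseteq> labelled_graphs n" for n using B[of n] by (auto simp: class_labelled_n_def)
  obtain n G W where n: "filterlim n at_top sequentially" and G: "\<And>m. G m \<in> B (n m)" and W: "graphon W"
    and lim: "\<And>H. simple_graph H \<Longrightarrow> (\<lambda>m. graph_density H (G m)) \<longlonglongrightarrow> graphon_density H W"
    and ent: "\<And>I. finite I \<Longrightarrow> real (card (pairs I)) * c \<le> sample_entropy I W"
    using dense_sets_limit[OF BL dense] by metis
  define \<Gamma> where "\<Gamma> = graphon_rel `` {W}"
  \<comment> \<open>\<open>limit_entropy\<close> and \<open>limit_density\<close> are evaluated at
    this representative, of which only the equivalence with \<open>W\<close> is known. The sampled
    entropies carry the bound from \<open>W\<close> to it.\<close>
  define W' where "W' = (SOME W. W \<in> \<Gamma>)"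
  have "W \<in> \<Gamma>" using equiv_class_self[OF equiv_graphon_rel, of W] W by (simp add: \<Gamma>_def)
  then have "W' \<in> \<Gamma>" unfolding W'_def by (rule someI[of "\<lambda>W. W \<in> \<Gamma>"])
  then have WW: "(W, W') \<in> graphon_rel" by (simp add: \<Gamma>_def)
  then have W': "graphon W'" by (auto simp: graphon_rel_def)
  have ld: "limit_density H \<Gamma> = graphon_density H W" if "simple_graph H" for H
    using WW that by (simp add: limit_density_def W'_def[symmetric] graphon_rel_def)
  have lim': "(\<lambda>m. graph_density H (G m)) \<longlonglongrightarrow> limit_density H \<Gamma>" if "simple_graph H" for H
    using lim[OF that] ld[OF that] by simp
  have "c \<le> graphon_entropy W'"
    by (rule graphon_entropy_ge[OF W']) (use ent sample_entropy_cong[OF WW] in auto)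
  then have le: "c \<le> limit_entropy \<Gamma>" by (simp add: limit_entropy_def W'_def)
  have GQ: "simple_graph (G m) \<and> iso_class (G m) \<in> Q \<and> card (verts (G m)) = n m" for m
    using G[of m] B[of "n m"] by (auto simp: class_labelled_n_def labelled_graphs_def)
  then have "graphs_converge G \<Gamma>" using n lim' by (simp add: graphs_converge_def)
  moreover have "\<Gamma> \<in> graph_limits" using W by (auto simp: graph_limits_def \<Gamma>_def intro: quotientI)
  ultimately have "\<Gamma> \<in> class_limits Q" using GQ by (auto simp: class_limits_def)
  then show thesis using that le G lim' by blast
qed

section \<open>From cardinalities to rare bad graphs\<close>

lemma log2_card_limit_lower:
  assumes lim: "(\<lambda>n. log2_card (A n) / ereal (real (n choose 2))) \<longlonglongrightarrow> ereal c" and e: "0 < e"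
  shows "\<forall>\<^sub>F n in sequentially. A n \<noteq> {} \<and> (c - e) * real (n choose 2) \<le> log 2 (real (card (A n)))"
proof -
  have "\<forall>\<^sub>F n in sequentially. ereal (c - e) < log2_card (A n) / ereal (real (n choose 2))"
    using lim e by (intro order_tendstoD(1)) auto
  then show ?thesis using eventually_ge_at_top[of 2]
  proof eventually_elim
    case (elim n)
    then have C: "0 < real (n choose 2)" by (simp add: zero_less_binomial)
    \<comment> \<open>With a positive binomial coefficient, an empty set would give the quotient
      -\<infinity>, below the finite bound.\<close>
    have ne: "A n \<noteq> {}"
    proof
      assume "A n = {}"
      then have "log2_card (A n) / ereal (real (n choose 2)) = - \<infinity>" using C by (simp add: log2_card_def)
      with elim show False by simp
    qed
    then have "c - e < log 2 (real (card (A n))) / real (n choose 2)"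
      using elim C by (simp add: log2_card_def)
    then show ?case using ne C by (simp add: pos_less_divide_eq)
  qed
qed

text \<open>Passing from n choose 2 to n^2 / 2 changes the exponent by a term linear in n, which for
  large n is smaller than e n^2 / 4. The constant \<open>b\<close> will be
  \<open>log 2 \<eta>\<close>, the price of keeping only a proportion of the class.\<close>

lemma quadratic_absorbs_linear:
  assumes "0 < e"
  shows "\<forall>\<^sub>F n in sequentially. (c - e) * (real n)\<^sup>2 / 2 \<le> (c - e / 2) * real (n choose 2) + b"
proof -
  define s where "s = c - e / 2"
  obtain N :: nat where N: "4 / e * (\<bar>s\<bar> / 2 + \<bar>b\<bar>) < real N" using reals_Archimedean2 by blast
  have "(c - e) * (real n)\<^sup>2 / 2 \<le> (c - e / 2) * real (n choose 2) + b" if n: "n \<ge> N" "n \<ge> 1" for n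
  proof -
    have ch: "real (n choose 2) = ((real n)\<^sup>2 - real n) / 2"
      by (simp add: choose_two power2_eq_square real_of_nat_div algebra_simps of_nat_diff)
    have "4 / e * (\<bar>s\<bar> / 2 + \<bar>b\<bar>) \<le> real n" using N n by linarith
    then have "\<bar>s\<bar> / 2 + \<bar>b\<bar> \<le> e / 4 * real n" using assms by (simp add: field_simps)
    then have "(\<bar>s\<bar> / 2 + \<bar>b\<bar>) * real n \<le> e / 4 * real n * real n" by (rule mult_right_mono) simp
    then have 1: "\<bar>s\<bar> * real n / 2 + \<bar>b\<bar> * real n \<le> e * (real n)\<^sup>2 / 4"
      by (simp add: power2_eq_square algebra_simps)
    have 2: "\<bar>b\<bar> \<le> \<bar>b\<bar> * real n" using n mult_left_mono[of 1 "real n" "\<bar>b\<bar>"] by simp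
    have 3: "s * real n \<le> \<bar>s\<bar> * real n" by (intro mult_right_mono) auto
    have "(c - e) * (real n)\<^sup>2 / 2 = s * (real n)\<^sup>2 / 2 - e * (real n)\<^sup>2 / 4"
      by (simp add: s_def field_simps)
    also have "\<dots> \<le> s * (real n)\<^sup>2 / 2 - s * real n / 2 + b" using 1 2 3 by linarith
    also have "\<dots> = (c - e / 2) * real (n choose 2) + b" unfolding ch s_def by (simp add: field_simps)
    finally show ?thesis .
  qed
  then show ?thesis unfolding eventually_sequentially by (intro exI[of _ "max N 1"]) auto
qed

text \<open>Labelled bad graphs are measured against the unlabelled class, whose size is the one
  controlled by \<open>lim\<close>. If the bound failed infinitely often, the bad labelled graphs
  would themselves be a dense family, and so would have a limit of maximal entropy.\<close>

lemma bad_graphs_rare: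
  fixes Q :: "sgraph set set"
  assumes max: "is_arg_max limit_entropy (\<lambda>\<Gamma>. \<Gamma> \<in> class_limits Q) \<Gamma>Q"
    and unique: "\<And>\<Gamma>. is_arg_max limit_entropy (\<lambda>\<Gamma>. \<Gamma> \<in> class_limits Q) \<Gamma> \<Longrightarrow> \<Gamma> = \<Gamma>Q"
    and lim: "(\<lambda>n. log2_card (class_n Q n) / ereal (real (n choose 2))) \<longlonglongrightarrow> ereal (limit_entropy \<Gamma>Q)"
    and H: "simple_graph H" and \<epsilon>: "0 < \<epsilon>" and \<eta>: "0 < \<eta>"
  shows "\<forall>\<^sub>F n in sequentially.
    real (card {G \<in> class_labelled_n Q n. \<bar>graph_density H G - limit_density H \<Gamma>Q\<bar> > \<epsilon>})
      < \<eta> * real (card (class_n Q n))"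
proof (rule ccontr)
  let ?c = "limit_entropy \<Gamma>Q"
  define B where "B n = {G \<in> class_labelled_n Q n. \<bar>graph_density H G - limit_density H \<Gamma>Q\<bar> > \<epsilon>}" for n
  assume "\<not> ?thesis"
  then have freq: "\<exists>\<^sub>F n in sequentially. \<eta> * real (card (class_n Q n)) \<le> real (card (B n))"
    by (simp add: B_def frequently_def not_le)
  have dense: "\<exists>n\<ge>N. B n \<noteq> {} \<and> 2 powr ((?c - e) * (real n)\<^sup>2 / 2) \<le> real (card (B n))" if e: "0 < e" for e N
  proof -
    have "\<forall>\<^sub>F n in sequentially. class_n Q n \<noteq> {} \<and> (?c - e / 2) * real (n choose 2) \<le> log 2 (real (card (class_n Q n)))"
      using e by (intro log2_card_limit_lower[OF lim]) auto
    moreover have "\<forall>\<^sub>F n in sequentially. (?c - e) * (real n)\<^sup>2 / 2 \<le> (?c - e / 2) * real (n choose 2) + log 2 \<eta>"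
      by (rule quadratic_absorbs_linear[OF e])
    moreover have "\<forall>\<^sub>F n in sequentially. N \<le> n" by (rule eventually_ge_at_top)
    ultimately have ev: "\<forall>\<^sub>F n in sequentially. (class_n Q n \<noteq> {} \<and> (?c - e / 2) * real (n choose 2) \<le> log 2 (real (card (class_n Q n)))) \<and>
        (?c - e) * (real n)\<^sup>2 / 2 \<le> (?c - e / 2) * real (n choose 2) + log 2 \<eta> \<and> N \<le> n"
      by eventually_elim simp
    obtain n where n: "\<eta> * real (card (class_n Q n)) \<le> real (card (B n))" "class_n Q n \<noteq> {}"
      "(?c - e / 2) * real (n choose 2) \<le> log 2 (real (card (class_n Q n)))"
      "(?c - e) * (real n)\<^sup>2 / 2 \<le> (?c - e / 2) * real (n choose 2) + log 2 \<eta>" "N \<le> n"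
      using frequently_ex[OF frequently_eventually_frequently[OF freq ev]] by blast
    have pos: "0 < real (card (class_n Q n))" using n(2) finite_class_n by (simp add: card_gt_0_iff)
    have "2 powr ((?c - e) * (real n)\<^sup>2 / 2) \<le> 2 powr (log 2 (\<eta> * real (card (class_n Q n))))"
      using n(3,4) pos \<eta> by (intro powr_mono) (simp_all add: log_mult_pos)
    also have "\<dots> = \<eta> * real (card (class_n Q n))" using pos \<eta> by simp
    also note n(1)
    finally have "2 powr ((?c - e) * (real n)\<^sup>2 / 2) \<le> real (card (B n))" .
    moreover have "B n \<noteq> {}"
    proof
      assume "B n = {}"
      with calculation show False using powr_gt_zero[of 2 "(?c - e) * (real n)\<^sup>2 / 2"] by simp
    qed
    ultimately show ?thesis using n(5) by blast
  qed
  have "B n \<subseteq> class_labelled_n Q n" for n by (auto simp: B_def)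
  then obtain n G \<Gamma> where \<Gamma>: "\<Gamma> \<in> class_limits Q" "?c \<le> limit_entropy \<Gamma>" and G: "\<And>m. G m \<in> B (n m)"
    and conv: "\<And>H. simple_graph H \<Longrightarrow> (\<lambda>m. graph_density H (G m)) \<longlonglongrightarrow> limit_density H \<Gamma>"
    using dense_sets_class_limit[of B Q ?c, OF _ dense] by metis
  \<comment> \<open>The maximum is also attained at \<open>\<Gamma>\<close>, so uniqueness
    identifies it with \<open>\<Gamma>Q\<close>. But every graph of the sequence has a density of
    \<open>H\<close> more than \<open>\<epsilon>\<close> away from that of
    \<open>\<Gamma>Q\<close>.\<close>
  have "is_arg_max limit_entropy (\<lambda>\<Gamma>. \<Gamma> \<in> class_limits Q) \<Gamma>"
    using max \<Gamma> by (auto simp: is_arg_max_def)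
  then have "\<Gamma> = \<Gamma>Q" by (rule unique)
  then have "(\<lambda>m. graph_density H (G m)) \<longlonglongrightarrow> limit_density H \<Gamma>Q" using conv[OF H] by simp
  then have "\<forall>\<^sub>F m in sequentially. dist (graph_density H (G m)) (limit_density H \<Gamma>Q) < \<epsilon>"
    using \<epsilon> by (rule tendstoD)
  then obtain m where "dist (graph_density H (G m)) (limit_density H \<Gamma>Q) < \<epsilon>"
    by (auto simp: eventually_sequentially)
  then show False using G[of m] by (simp add: B_def dist_real_def)
qed

lemma prob_tendsto_0I:
  assumes "\<And>\<eta>. 0 < \<eta> \<Longrightarrow> \<forall>\<^sub>F n in sequentially. measure_pmf.prob (\<mu> n) (X n) \<le> \<eta>"
  shows "(\<lambda>n. measure_pmf.prob (\<mu> n) (X n)) \<longlonglongrightarrow> 0"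
proof (rule tendstoI)
  fix e :: real assume "0 < e"
  then have "\<forall>\<^sub>F n in sequentially. measure_pmf.prob (\<mu> n) (X n) \<le> e / 2" by (intro assms) simp
  then show "\<forall>\<^sub>F n in sequentially. dist (measure_pmf.prob (\<mu> n) (X n)) 0 < e"
    by eventually_elim (use \<open>0 < e\<close> in simp)
qed

text \<open>A bad class contains a labelled graph on [n], and this graph is bad as well, the density
  being invariant under isomorphism once \<open>H\<close> has at most \<open>n\<close>
  vertices.\<close>

lemma card_bad_classes_le:
  assumes H: "simple_graph H" and n: "card (verts H) \<le> n"
  shows "card (class_n Q n \<inter> {C. P (graph_density H (graph_rep C))}) \<le>
    card {G \<in> class_labelled_n Q n. P (graph_density H G)}"
proof -
  have "class_n Q n \<inter> {C. P (graph_density H (graph_rep C))} \<subseteq>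
      iso_class ` {G \<in> class_labelled_n Q n. P (graph_density H G)}"
  proof
    fix C assume C: "C \<in> class_n Q n \<inter> {C. P (graph_density H (graph_rep C))}"
    then obtain G where G: "G \<in> class_labelled_n Q n" "C = iso_class G"
      using class_n_labelled_rep by blast
    then have sG: "simple_graph G" "card (verts G) = n" by (auto simp: class_labelled_n_def labelled_graphs_def)
    have "G \<in> C" using G sG by (simp add: iso_rel_def graph_iso_refl)
    then have "graph_rep C \<in> C" unfolding graph_rep_def by (rule someI[of "\<lambda>G. G \<in> C"])
    then have "(G, graph_rep C) \<in> iso_rel" using G by simp
    then have "graph_density H G = graph_density H (graph_rep C)"
      using H sG n by (intro graph_density_iso) (auto simp: iso_rel_def)
    then show "C \<in> iso_class ` {G \<in> class_labelled_n Q n. P (graph_density H G)}" using C G by auto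
  qed
  then show ?thesis by (rule surj_card_le[rotated]) (simp add: finite_class_labelled_n)
qed

theorem theorem1p6:
  fixes Q :: "sgraph set set" and \<Gamma>Q :: graph_limit
  assumes "Q \<subseteq> unlabelled_graphs" and "infinite Q"
    and "is_arg_max limit_entropy (\<lambda>\<Gamma>. \<Gamma> \<in> class_limits Q) \<Gamma>Q"
    and "\<And>\<Gamma>. is_arg_max limit_entropy (\<lambda>\<Gamma>. \<Gamma> \<in> class_limits Q) \<Gamma> \<Longrightarrow> \<Gamma> = \<Gamma>Q"
    and "(\<lambda>n. log2_card (class_n Q n) / ereal (real (n choose 2)))
           \<longlonglongrightarrow> ereal (limit_entropy \<Gamma>Q)"
  shows "converges_in_prob (\<lambda>n. map_pmf graph_rep (pmf_of_set (class_n Q n))) \<Gamma>Q \<and>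
         converges_in_prob (\<lambda>n. pmf_of_set (class_labelled_n Q n)) \<Gamma>Q"
proof -
  \<comment> \<open>Nonemptiness is what gives \<open>pmf_of_set\<close> its meaning as a uniform
    law, and the bound on \<open>card (verts H)\<close> makes the densities of isomorphic graphs
    agree.\<close>
  have main: "\<forall>\<^sub>F n in sequentially. class_n Q n \<noteq> {} \<and> card (verts H) \<le> n \<and>
      real (card {G \<in> class_labelled_n Q n. \<bar>graph_density H G - limit_density H \<Gamma>Q\<bar> > \<epsilon>})
        \<le> \<eta> * real (card (class_n Q n))"
    if "simple_graph H" "0 < \<epsilon>" "0 < \<eta>" for H \<epsilon> \<eta>
  proof -
    have "\<forall>\<^sub>F n in sequentially.
      real (card {G \<in> class_labelled_n Q n. \<bar>graph_density H G - limit_density H \<Gamma>Q\<bar> > \<epsilon>})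
        < \<eta> * real (card (class_n Q n))"
      by (rule bad_graphs_rare[OF assms(3) _ assms(5) that]) (rule assms(4))
    then show ?thesis
      using log2_card_limit_lower[OF assms(5) zero_less_one] eventually_ge_at_top[of "card (verts H)"]
      by eventually_elim simp
  qed
  show ?thesis
    unfolding converges_in_prob_def
  proof (intro conjI allI impI)
    fix H and \<epsilon> :: real
    assume H: "simple_graph H" and \<epsilon>: "0 < \<epsilon>"
    let ?bad = "{G. \<epsilon> < \<bar>graph_density H G - limit_density H \<Gamma>Q\<bar>}"
    show "(\<lambda>n. measure_pmf.prob (map_pmf graph_rep (pmf_of_set (class_n Q n))) ?bad) \<longlonglongrightarrow> 0"
    proof (rule prob_tendsto_0I)
      fix \<eta> :: real assume \<eta>: "0 < \<eta>"
      from main[OF H \<epsilon> \<eta>]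
      show "\<forall>\<^sub>F n in sequentially. measure_pmf.prob (map_pmf graph_rep (pmf_of_set (class_n Q n))) ?bad \<le> \<eta>"
      proof eventually_elim
        case (elim n)
        then have pos: "0 < real (card (class_n Q n))" using finite_class_n by (simp add: card_gt_0_iff)
        have "measure_pmf.prob (map_pmf graph_rep (pmf_of_set (class_n Q n))) ?bad =
            real (card (class_n Q n \<inter> {C. graph_rep C \<in> ?bad})) / real (card (class_n Q n))"
          using elim finite_class_n by (simp add: measure_pmf_of_set vimage_def)
        also have "\<dots> \<le> \<eta>"
          using order_trans[OF of_nat_mono[OF card_bad_classes_le[OF H, of n Q "\<lambda>x. \<epsilon> < \<bar>x - limit_density H \<Gamma>Q\<bar>"]], of "\<eta> * real (card (class_n Q n))"]
            elim pos by (simp add: pos_divide_le_eq)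
        finally show ?case .
      qed
    qed
    show "(\<lambda>n. measure_pmf.prob (pmf_of_set (class_labelled_n Q n)) ?bad) \<longlonglongrightarrow> 0"
    proof (rule prob_tendsto_0I)
      fix \<eta> :: real assume \<eta>: "0 < \<eta>"
      from main[OF H \<epsilon> \<eta>]
      show "\<forall>\<^sub>F n in sequentially. measure_pmf.prob (pmf_of_set (class_labelled_n Q n)) ?bad \<le> \<eta>"
      proof eventually_elim
        case (elim n)
        then have "0 < card (class_n Q n)" using finite_class_n by (simp add: card_gt_0_iff)
        then have pos: "0 < real (card (class_labelled_n Q n))" using card_class_n_le[of Q n] by simp
        then have ne: "class_labelled_n Q n \<noteq> {}" by auto
        have "real (card (class_labelled_n Q n \<inter> ?bad)) \<le> \<eta> * real (card (class_n Q n))"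
          using elim by (simp add: Int_def)
        \<comment> \<open>Each class in \<open>class_n Q n\<close> has a labelled member, so the
          labelled class is at least as large and the unlabelled bound is more than enough.\<close>
        also have "\<dots> \<le> \<eta> * real (card (class_labelled_n Q n))"
          using \<eta> card_class_n_le[of Q n] by simp
        finally have "real (card (class_labelled_n Q n \<inter> ?bad)) / real (card (class_labelled_n Q n)) \<le> \<eta>"
          using pos by (simp add: pos_divide_le_eq)
        then show ?case using ne finite_class_labelled_n by (simp add: measure_pmf_of_set)
      qed
    qed
  qed
qed

end
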